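(* Let $m\ge 1$, $0\le s\le m$ and $k\in\mathbb N_0$. Then: (i) Under the $H$-action, $\operatorname{Ker}^s_k\tilde\Delta$ decomposes into inequivalent irreducible pieces as $$\operatorname{Ker}_k^s\tilde\Delta=\mathcal H^s_k\oplus\mathbf x\wedge \mathcal H^{s-1}_{k-1}\oplus\mathbf x\bullet \mathcal H^{s+1}_{k-1}\oplus \tilde{\mathcal W}^s_k,$$ where, for $1\le s\le m-1$ and $k\ge 2$, $$\tilde{\mathcal W}^s_k=\big((c_1+1)c_2\,\mathbf x\wedge\mathbf x\bullet+(c_2+1)c_1\,\mathbf x\bullet\mathbf x\wedge\big)\mathcal H^s_{k-2}$$ with $c_1=k-2+s$ and $c_2=k-2+m-s$, and $\tilde{\mathcal W}^s_k=\{0\}$ otherwise; here $\mathcal H^{s'}_{k'}=\{0\}$ unless $0\le s'\le m$ and $k'\in\mathbb N_0$. (ii) Moreover, $$\operatorname{Ker}^s_k\Delta\cap\operatorname{Ker}_k^s\tilde\Delta=\mathcal H^s_k\oplus\mathbf x\wedge \mathcal H^{s-1}_{k-1}\oplus\mathbf x\bullet \mathcal H^{s+1}_{k-1}.$$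
   Context: $\mathbb R_{0,m}$ is the real Clifford algebra generated by the standard basis $e_1,\ldots,e_m$ of $\mathbb R^m$ with relations $e_ie_j+e_je_i=-2\delta_{ij}$; $\mathbb R_{0,m}=\bigoplus_{s=0}^m\mathbb R^s_{0,m}$ where $\mathbb R^s_{0,m}$ is the space of $s$-vectors, and $\mathbb R^1_{0,m}$ is identified with $\mathbb R^m$. For a 1-vector $u$ and an $s$-vector $v$, $u\bullet v=\frac12(uv-(-1)^svu)$ and $u\wedge v=\frac12(uv+(-1)^svu)$, extended linearly in $v$. $\mathcal P^s_k$ denotes the space of $k$-homogeneous polynomials in $\mathbf x=(x_1,\ldots,x_m)\in\mathbb R^m$ with values in $\mathbb R^s_{0,m}$. $\mathbf x=\sum_j e_jx_j$; $\mathbf x\wedge$ and $\mathbf x\bullet$ denote the operators $P\mapsto\mathbf x\wedge P$, $P\mapsto \mathbf x\bullet P$, and products such as $\mathbf x\wedge\mathbf x\bullet$ denote compositions of these operators. $\partial^+P=\sum_j e_j\wedge(\partial_{x_j}P)$, $\partial^-P=\sum_j e_j\bullet(\partial_{x_j}P)$ (so the Dirac operator is $\partial=\sum_je_j\partial_{x_j}=\partial^++\partial^-$). $\Delta=\sum_j\partial_{x_j}^2$ is the Laplace operator and $\tilde\Delta=-(\partial^+\partial^--\partial^-\partial^+)$ the modified Laplace operator (for $P\in\mathcal P^s_k$ one has $\partial P\partial=(-1)^s\tilde\Delta P$, so $\tilde\Delta P=0$ means $P$ is inframonogenic). $\operatorname{Ker}^s_k\Delta=\{P\in\mathcal P^s_k:\Delta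 P=0\}$, $\operatorname{Ker}^s_k\tilde\Delta=\{P\in\mathcal P^s_k:\tilde\Delta P=0\}$. $\mathcal H^s_k=\{P\in\mathcal P^s_k:\partial^+P=0,\ \partial^-P=0\}$ (homogeneous solutions of the Hodge–de Rham system). The $H$-action of $Pin(m)$ on polynomials is $[H(r)P](\mathbf x)=r\,P(r^{-1}\mathbf x\,r)\,r^{-1}$. *)

theory Defs
  imports Complex_Main
begin

text \<open>An element of R_{0,m} is represented by its coefficient function w.r.t. the basis
  e_A = e_{a1} ... e_{as} (A = {a1 < ... < as} a subset of {0..<m}; the index j
  stands for the generator e_{j+1} of the paper).\<close>

type_synonym mvec = "nat set \<Rightarrow> real"

definition mv_zero :: mvec where "mv_zero = (\<lambda>A. 0)"
definition mv_one :: mvec where "mv_one = (\<lambda>A. if A = {} then 1 else 0)"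
definition mv_add :: "mvec \<Rightarrow> mvec \<Rightarrow> mvec" where "mv_add u v = (\<lambda>A. u A + v A)"
definition mv_scale :: "real \<Rightarrow> mvec \<Rightarrow> mvec" where "mv_scale c u = (\<lambda>A. c * u A)"
definition mv_neg :: "mvec \<Rightarrow> mvec" where "mv_neg u = (\<lambda>A. - u A)"

definition evec :: "nat \<Rightarrow> mvec" where "evec j = (\<lambda>A. if A = {j} then 1 else 0)"

text \<open>e_A e_B = cl_sign A B e_{A \<triangle> B}, from e_i e_j = - e_j e_i (i \<noteq> j), e_j e_j = -1.\<close>
definition cl_sign :: "nat set \<Rightarrow> nat set \<Rightarrow> real" where
  "cl_sign A B = (-1) ^ (card {(a, b). a \<in> A \<and> b \<in> B \<and> b < a} + card (A \<inter> B))"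

definition cl_mult :: "nat \<Rightarrow> mvec \<Rightarrow> mvec \<Rightarrow> mvec" where
  "cl_mult m u v = (\<lambda>C. \<Sum>A\<in>Pow {..<m}. \<Sum>B\<in>Pow {..<m}.
      if (A - B) \<union> (B - A) = C then cl_sign A B * u A * v B else 0)"

definition svec :: "nat \<Rightarrow> nat \<Rightarrow> mvec \<Rightarrow> bool" where
  "svec m s u \<longleftrightarrow> (\<forall>A. u A \<noteq> 0 \<longrightarrow> A \<subseteq> {..<m} \<and> card A = s)"

definition grade :: "nat \<Rightarrow> mvec \<Rightarrow> mvec" where
  "grade s u = (\<lambda>A. if card A = s then u A else 0)"

text \<open>u \<bullet> v = 1/2 (uv - (-1)^s vu), u \<wedge> v = 1/2 (uv + (-1)^s vu) for s-vectors v,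
  extended linearly in v.\<close>
definition cl_dot :: "nat \<Rightarrow> mvec \<Rightarrow> mvec \<Rightarrow> mvec" where
  "cl_dot m u v = (\<lambda>C. \<Sum>s\<le>m. (cl_mult m u (grade s v) C - (-1) ^ s * cl_mult m (grade s v) u C) / 2)"

definition cl_wedge :: "nat \<Rightarrow> mvec \<Rightarrow> mvec \<Rightarrow> mvec" where
  "cl_wedge m u v = (\<lambda>C. \<Sum>s\<le>m. (cl_mult m u (grade s v) C + (-1) ^ s * cl_mult m (grade s v) u C) / 2)"

text \<open>A polynomial is represented by its coefficients: P \<alpha> is the Clifford coefficient of
  the monomial x^\<alpha> = prod_j x_j^{\<alpha> j}.\<close>

type_synonym mindex = "nat \<Rightarrow> nat"
type_synonym cpoly = "mindex \<Rightarrow> mvec"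

definition mindices :: "nat \<Rightarrow> nat \<Rightarrow> mindex set" where
  "mindices m k = {\<alpha>. (\<forall>j\<ge>m. \<alpha> j = 0) \<and> (\<Sum>j<m. \<alpha> j) = k}"

definition pzero :: cpoly where "pzero = (\<lambda>\<alpha>. mv_zero)"
definition padd :: "cpoly \<Rightarrow> cpoly \<Rightarrow> cpoly" where "padd P Q = (\<lambda>\<alpha>. mv_add (P \<alpha>) (Q \<alpha>))"
definition pscale :: "real \<Rightarrow> cpoly \<Rightarrow> cpoly" where "pscale c P = (\<lambda>\<alpha>. mv_scale c (P \<alpha>))"
definition pdiff :: "cpoly \<Rightarrow> cpoly \<Rightarrow> cpoly" where "pdiff P Q = (\<lambda>\<alpha>. \<lambda>A. P \<alpha> A - Q \<alpha> A)"

definition Pspace :: "nat \<Rightarrow> nat \<Rightarrow> nat \<Rightarrow> cpoly set" where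
  "Pspace m s k = {P. (\<forall>\<alpha>. P \<alpha> \<noteq> mv_zero \<longrightarrow> \<alpha> \<in> mindices m k) \<and> (\<forall>\<alpha>. svec m s (P \<alpha>))}"

definition pd :: "nat \<Rightarrow> cpoly \<Rightarrow> cpoly" where
  "pd j P = (\<lambda>\<alpha>. mv_scale (real (\<alpha> j + 1)) (P (\<alpha>(j := \<alpha> j + 1))))"

definition xmul :: "nat \<Rightarrow> cpoly \<Rightarrow> cpoly" where
  "xmul j P = (\<lambda>\<alpha>. if 0 < \<alpha> j then P (\<alpha>(j := \<alpha> j - 1)) else mv_zero)"

definition dplus :: "nat \<Rightarrow> cpoly \<Rightarrow> cpoly" where
  "dplus m P = (\<lambda>\<alpha> A. \<Sum>j<m. cl_wedge m (evec j) (pd j P \<alpha>) A)"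

definition dminus :: "nat \<Rightarrow> cpoly \<Rightarrow> cpoly" where
  "dminus m P = (\<lambda>\<alpha> A. \<Sum>j<m. cl_dot m (evec j) (pd j P \<alpha>) A)"

definition lap :: "nat \<Rightarrow> cpoly \<Rightarrow> cpoly" where
  "lap m P = (\<lambda>\<alpha> A. \<Sum>j<m. pd j (pd j P) \<alpha> A)"

definition tlap :: "nat \<Rightarrow> cpoly \<Rightarrow> cpoly" where
  "tlap m P = pscale (-1) (pdiff (dplus m (dminus m P)) (dminus m (dplus m P)))"

definition xwedge :: "nat \<Rightarrow> cpoly \<Rightarrow> cpoly" where
  "xwedge m P = (\<lambda>\<alpha> A. \<Sum>j<m. cl_wedge m (evec j) (xmul j P \<alpha>) A)"

definition xdot :: "nat \<Rightarrow> cpoly \<Rightarrow> cpoly" where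
  "xdot m P = (\<lambda>\<alpha> A. \<Sum>j<m. cl_dot m (evec j) (xmul j P \<alpha>) A)"

definition KerLap :: "nat \<Rightarrow> nat \<Rightarrow> nat \<Rightarrow> cpoly set" where
  "KerLap m s k = {P \<in> Pspace m s k. lap m P = pzero}"

definition KerTLap :: "nat \<Rightarrow> nat \<Rightarrow> nat \<Rightarrow> cpoly set" where
  "KerTLap m s k = {P \<in> Pspace m s k. tlap m P = pzero}"

definition Hsp :: "nat \<Rightarrow> int \<Rightarrow> int \<Rightarrow> cpoly set" where
  "Hsp m s k = (if 0 \<le> s \<and> s \<le> int m \<and> 0 \<le> k
      then {P \<in> Pspace m (nat s) (nat k). dplus m P = pzero \<and> dminus m P = pzero}
      else {pzero})"

definition Wt :: "nat \<Rightarrow> nat \<Rightarrow> nat \<Rightarrow> cpoly set" where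
  "Wt m s k = (if 1 \<le> s \<and> s \<le> m - 1 \<and> 2 \<le> k then
      (let c1 = real k - 2 + real s; c2 = real k - 2 + real m - real s in
        (\<lambda>P. padd (pscale ((c1 + 1) * c2) (xwedge m (xdot m P)))
                   (pscale ((c2 + 1) * c1) (xdot m (xwedge m P)))) ` Hsp m (int s) (int k - 2))
    else {pzero})"

text \<open>Pin(m) consists of the products u_1 ... u_n of unit vectors; we parametrize its
  elements by the list of factors. The inverse of u_1...u_n is u_n^{-1}...u_1^{-1}, u^{-1} = -u.\<close>
definition unit_vecs :: "nat \<Rightarrow> mvec list \<Rightarrow> bool" where
  "unit_vecs m us \<longleftrightarrow> (\<forall>u\<in>set us. svec m 1 u \<and> (\<Sum>j<m. (u {j})\<^sup>2) = 1)"

definition pin_elem :: "nat \<Rightarrow> mvec list \<Rightarrow> mvec" where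
  "pin_elem m us = foldr (\<lambda>u r. cl_mult m u r) us mv_one"

definition pin_inv :: "nat \<Rightarrow> mvec list \<Rightarrow> mvec" where
  "pin_inv m us = foldr (\<lambda>u r. cl_mult m r (mv_neg u)) us mv_one"

definition xvec :: "nat \<Rightarrow> (nat \<Rightarrow> real) \<Rightarrow> mvec" where
  "xvec m x = (\<lambda>A. \<Sum>j<m. if A = {j} then x j else 0)"

definition peval :: "nat \<Rightarrow> nat \<Rightarrow> cpoly \<Rightarrow> (nat \<Rightarrow> real) \<Rightarrow> mvec" where
  "peval m k P x = (\<lambda>A. \<Sum>\<alpha>\<in>mindices m k. (\<Prod>j<m. x j ^ \<alpha> j) * P \<alpha> A)"

definition Hact :: "nat \<Rightarrow> mvec list \<Rightarrow> ((nat \<Rightarrow> real) \<Rightarrow> mvec) \<Rightarrow> ((nat \<Rightarrow> real) \<Rightarrow> mvec)" where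
  "Hact m us f = (\<lambda>x. cl_mult m (cl_mult m (pin_elem m us)
        (f (\<lambda>j. cl_mult m (cl_mult m (pin_inv m us) (xvec m x)) (pin_elem m us) {j})))
      (pin_inv m us))"

definition psubspace :: "cpoly set \<Rightarrow> bool" where
  "psubspace V \<longleftrightarrow> pzero \<in> V \<and> (\<forall>P\<in>V. \<forall>Q\<in>V. padd P Q \<in> V) \<and> (\<forall>c. \<forall>P\<in>V. pscale c P \<in> V)"

definition H_invariant :: "nat \<Rightarrow> nat \<Rightarrow> cpoly set \<Rightarrow> bool" where
  "H_invariant m k V \<longleftrightarrow>
     (\<forall>us P. unit_vecs m us \<and> P \<in> V \<longrightarrow> (\<exists>Q\<in>V. peval m k Q = Hact m us (peval m k P)))"

definition H_irreducible :: "nat \<Rightarrow> nat \<Rightarrow> cpoly set \<Rightarrow> bool" where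
  "H_irreducible m k V \<longleftrightarrow> psubspace V \<and> V \<noteq> {pzero} \<and> H_invariant m k V \<and>
     (\<forall>W. psubspace W \<and> W \<subseteq> V \<and> H_invariant m k W \<longrightarrow> W = {pzero} \<or> W = V)"

definition H_equivalent :: "nat \<Rightarrow> nat \<Rightarrow> cpoly set \<Rightarrow> cpoly set \<Rightarrow> bool" where
  "H_equivalent m k V W \<longleftrightarrow> (\<exists>T. bij_betw T V W \<and>
     (\<forall>P\<in>V. \<forall>Q\<in>V. T (padd P Q) = padd (T P) (T Q)) \<and>
     (\<forall>c. \<forall>P\<in>V. T (pscale c P) = pscale c (T P)) \<and>
     (\<forall>us P Q. unit_vecs m us \<and> P \<in> V \<and> Q \<in> V \<and> peval m k Q = Hact m us (peval m k P)
         \<longrightarrow> peval m k (T Q) = Hact m us (peval m k (T P))))"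

definition is_direct_sum :: "cpoly set \<Rightarrow> cpoly set list \<Rightarrow> bool" where
  "is_direct_sum X Vs \<longleftrightarrow>
     X = {foldr padd Ps pzero | Ps. length Ps = length Vs \<and> (\<forall>i<length Vs. Ps ! i \<in> Vs ! i)} \<and>
     (\<forall>Ps. length Ps = length Vs \<and> (\<forall>i<length Vs. Ps ! i \<in> Vs ! i) \<and> foldr padd Ps pzero = pzero
        \<longrightarrow> (\<forall>i<length Vs. Ps ! i = pzero))"

end

theory Submission
  imports Defs "HOL-Library.Function_Algebras" "HOL-Library.FuncSet" "HOL-Computational_Algebra.Polynomial"
begin

text \<open>
  On \<open>s\<close>-vector valued \<open>k\<close>-homogeneous polynomials the operators \<open>x\<and>\<close>, \<open>x\<bullet>\<close>, \<open>\<partial>\<^sup>+\<close>, \<open>\<partial>\<^sup>-\<close> square to zero;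
  \<open>x\<bullet>\<close> with \<open>\<partial>\<^sup>+\<close> and \<open>x\<and>\<close> with \<open>\<partial>\<^sup>-\<close> anticommute up to the scalars \<open>k + s\<close> and \<open>k + m - s\<close>. If \<open>P\<close> is inframonogenic then
  \<open>\<partial>\<^sup>+\<partial>\<^sup>-P = \<partial>\<^sup>-\<partial>\<^sup>+P\<close> solves the Hodge-de Rham system; it determines the component of \<open>P\<close> in the fourth
  summand, and after subtracting that component \<open>\<partial>\<^sup>-P\<close> and \<open>\<partial>\<^sup>+P\<close> determine the next two. This component
  vanishes exactly when \<open>P\<close> is also harmonic.

  A unit vector \<open>u\<close> acts, up to a common sign, by the reflection \<open>R\<^sub>u\<close>. For \<open>u\<close> proportional to
  \<open>e\<^sub>1 + t e\<^sub>0\<close> the action is polynomial in \<open>t\<close> after clearing denominators, so its value at \<open>t = \<i>\<close> is a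
  complex combination of reflections. It maps \<open>P\<close> to a multiple of \<open>\<langle>a, x\<rangle>\<^sup>k a \<and> \<iota>\<^sub>a P(a)\<close> with \<open>a = e\<^sub>1 + \<i> e\<^sub>0\<close>
  isotropic. For a solution \<open>P \<noteq> 0\<close> of the Hodge-de Rham system this is nonzero for some isotropic vector,
  because a harmonic polynomial that vanishes on the null cone is zero. Sign changes and exchanges of the
  remaining coordinates then produce the same vectors \<open>\<langle>a, x\<rangle>\<^sup>k a \<and> e\<^sub>B\<close> in every nonzero invariant
  subspace, so a proper invariant subspace would meet its orthogonal complement. For the inequivalence, the same
  operator formed for the larger of two degrees annihilates the space of smaller degree, and in equal degree
  the sum of the sign changes has different eigenvalues on its image.
\<close>

text \<open>Instead of differentiating the group action, the argument interpolates it. A polynomial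
  in \<open>t\<close> of degree at most \<open>2 * n\<close> takes at \<open>\<i>\<close> a fixed
  combination of its values at \<open>0, ..., 2 * n\<close>. The real and imaginary parts of the
  weights give two operators \<open>gact\<close>, which preserve every real invariant subspace. The
  weights depend on \<open>n\<close> only, so these operators commute with all equivariant maps and
  can be compared across summands. Clearing denominators with exponent \<open>n\<close> instead of
  the minimal \<open>k + 1\<close> leaves a spare power of \<open>1 + t\<^sup>2\<close>, which is
  zero at \<open>\<i>\<close>: among the degrees below \<open>n\<close> only
  \<open>k = n - 1\<close> survives. The vectors \<open>fF m k (ev m av (bs B))\<close> take the
  part of highest weight vectors.

  The coefficients of the fourth summand are forced by the requirement that the two second-order
  operators agree on it. Another combination of the same two products of multiplications is
  harmonic, and it carries the null cone argument.\<close>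

instantiation "fun" :: (type, real_vector) real_vector
begin

definition scaleR_fun :: "real \<Rightarrow> ('a \<Rightarrow> 'b) \<Rightarrow> 'a \<Rightarrow> 'b" where
  "scaleR_fun c f = (\<lambda>x. c *\<^sub>R f x)"

instance
  by standard (simp_all add: scaleR_fun_def fun_eq_iff scaleR_add_right scaleR_add_left)

end

lemma scaleR_fun_apply [simp]: "(c *\<^sub>R f) x = c *\<^sub>R f x"
  by (simp add: scaleR_fun_def)

lemma sum_fun_apply [simp]: "(\<Sum>i\<in>S. f i) x = (\<Sum>i\<in>S. f i x)"
  by (induction S rule: infinite_finite_induct) simp_all

text \<open>The operations of the statement are the pointwise vector space operations, so
  \<open>linear\<close>, \<open>subspace\<close> and \<open>span\<close> apply to
  polynomials.\<close>

lemma pzero_eq: "pzero = 0"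
  by (simp add: pzero_def mv_zero_def fun_eq_iff)

lemma padd_eq: "padd P Q = P + Q"
  by (simp add: padd_def mv_add_def fun_eq_iff)

lemma pscale_eq: "pscale c P = c *\<^sub>R P"
  by (simp add: pscale_def mv_scale_def fun_eq_iff)

lemma pdiff_eq: "pdiff P Q = P - Q"
  by (simp add: pdiff_def fun_eq_iff)

section \<open>Exterior and interior multiplication\<close>

text \<open>The sign of moving the generator with index \<open>j\<close> past the smaller ones. The
  coefficient ring stays a parameter because isotropic vectors force complex multivectors.\<close>

definition sg :: "nat \<Rightarrow> nat set \<Rightarrow> 'a::comm_ring_1" where
  "sg j C = (-1) ^ card {b \<in> C. b < j}"

definition ew :: "nat \<Rightarrow> (nat set \<Rightarrow> 'a::comm_ring_1) \<Rightarrow> nat set \<Rightarrow> 'a" where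
  "ew j v = (\<lambda>C. if j \<in> C then sg j C * v (C - {j}) else 0)"

definition iw :: "nat \<Rightarrow> (nat set \<Rightarrow> 'a::comm_ring_1) \<Rightarrow> nat set \<Rightarrow> 'a" where
  "iw j v = (\<lambda>C. if j \<notin> C then sg j C * v (insert j C) else 0)"

lemma sg_square [simp]: "sg j C * sg j C = (1::'a::comm_ring_1)"
  by (simp add: sg_def flip: power_add)

lemma sg_square_left [simp]: "sg j C * (sg j C * x) = (x::'a::comm_ring_1)"
  by (simp flip: mult.assoc)

lemma sg_insert:
  assumes "j \<notin> C" shows "sg i (insert j C) = (if j < i then - sg i C else (sg i C :: 'a::comm_ring_1))"
proof (cases "j < i")
  case True
  have "{b \<in> insert j C. b < i} = insert j {b \<in> C. b < i}" using True by auto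
  then show ?thesis using True assms by (simp add: sg_def)
next
  case False
  then have "{b \<in> insert j C. b < i} = {b \<in> C. b < i}" by auto
  then show ?thesis using False by (simp add: sg_def)
qed

lemma sg_remove:
  assumes "j \<in> C" shows "sg i (C - {j}) = (if j < i then - sg i C else (sg i C :: 'a::comm_ring_1))"
  using sg_insert[of j "C - {j}" i, where ?'a = 'a] assms by (simp add: insert_absorb)

lemma ew_ew: "ew i (ew j v) = - ew j (ew i (v :: nat set \<Rightarrow> 'a::comm_ring_1))"
proof
  fix C
  show "ew i (ew j v) C = (- ew j (ew i v)) C"
    by (cases "i = j") (auto simp: ew_def sg_remove Diff_insert2[symmetric] insert_commute[of i j]
        algebra_simps)
qed

lemma iw_iw: "iw i (iw j v) = - iw j (iw i (v :: nat set \<Rightarrow> 'a::comm_ring_1))"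
proof
  fix C
  show "iw i (iw j v) C = (- iw j (iw i v)) C"
    by (cases "i = j") (auto simp: iw_def sg_insert insert_commute[of i j] algebra_simps)
qed

text \<open>Canonical anticommutation relations. For \<open>i = j\<close> exactly one of the two
  summands survives at each \<open>C\<close>. For \<open>i \<noteq> j\<close> exactly one of the two
  indices is counted in the sign of the other, so the two orders cancel.\<close>

lemma ew_iw: "ew i (iw j v) + iw j (ew i v) = (if i = j then v else (0 :: nat set \<Rightarrow> 'a::comm_ring_1))"
proof
  fix C
  show "(ew i (iw j v) + iw j (ew i v)) C = (if i = j then v else 0) C"
  proof (cases "i = j")
    case True
    then show ?thesis by (auto simp: ew_def iw_def sg_insert sg_remove insert_absorb)
  next
    case False
    then have "insert j (C - {i}) = insert j C - {i}" by auto
    then show ?thesis using False by (auto simp: ew_def iw_def sg_insert sg_remove algebra_simps)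
  qed
qed

lemma ew_ew_same [simp]: "ew i (ew i v) = (0 :: nat set \<Rightarrow> 'a::comm_ring_1)"
  by (auto simp: ew_def fun_eq_iff)

lemma iw_iw_same [simp]: "iw i (iw i v) = (0 :: nat set \<Rightarrow> 'a::comm_ring_1)"
  by (auto simp: iw_def fun_eq_iff)

lemma ew_add: "ew j (v + w) = ew j v + ew j w"
  and iw_add: "iw j (v + w) = iw j v + iw j w"
  by (auto simp: ew_def iw_def algebra_simps)

section \<open>Operators on polynomials\<close>

definition pE :: "nat \<Rightarrow> cpoly \<Rightarrow> cpoly" where "pE j P = (\<lambda>\<alpha>. ew j (P \<alpha>))"
definition pI :: "nat \<Rightarrow> cpoly \<Rightarrow> cpoly" where "pI j P = (\<lambda>\<alpha>. iw j (P \<alpha>))"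

lemma pE_pE: "pE i (pE j P) + pE j (pE i P) = 0"
  by (simp add: pE_def ew_ew[of i j] fun_eq_iff)

lemma pI_pI: "pI i (pI j P) + pI j (pI i P) = 0"
  by (simp add: pI_def iw_iw[of i j] fun_eq_iff)

lemma pE_pI: "pE i (pI j P) + pI j (pE i P) = (if i = j then P else 0)"
  using ew_iw[of i j "P _"] by (auto simp: pE_def pI_def plus_fun_def fun_eq_iff)

lemma linear_pE [simp]: "linear (pE j)"
  and linear_pI [simp]: "linear (pI j)"
  by (rule linearI; simp add: pE_def pI_def ew_def iw_def fun_eq_iff algebra_simps)+

lemma pd_eq: "pd j P = (\<lambda>\<alpha>. real (\<alpha> j + 1) *\<^sub>R P (\<alpha>(j := \<alpha> j + 1)))"
  by (simp add: pd_def mv_scale_def fun_eq_iff)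

lemma xmul_eq: "xmul j P = (\<lambda>\<alpha>. if 0 < \<alpha> j then P (\<alpha>(j := \<alpha> j - 1)) else 0)"
  by (simp add: xmul_def mv_zero_def fun_eq_iff)

lemma linear_pd [simp]: "linear (pd j)"
  and linear_xmul [simp]: "linear (xmul j)"
  by (rule linearI; simp add: pd_eq xmul_eq fun_eq_iff algebra_simps)+

text \<open>Written as a commutator, like \<open>xmul_pd\<close>, to match the hypothesis
  \<open>pq\<close> of \<open>gop_anticommutator\<close>.\<close>

lemma pd_pd: "pd i (pd j P) - pd j (pd i P) = 0"
  by (cases "i = j") (simp_all add: pd_eq fun_eq_iff fun_upd_twist)

lemma pd_xmul: "pd i (xmul j P) - xmul j (pd i P) = (if i = j then P else 0)"
proof (cases "i = j")
  case True
  have "pd j (xmul j P) \<alpha> A - xmul j (pd j P) \<alpha> A = P \<alpha> A" for \<alpha> A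
    by (cases "\<alpha> j") (auto simp: pd_eq xmul_eq algebra_simps fun_upd_idem)
  then show ?thesis using True by (simp add: fun_eq_iff)
next
  case False
  then show ?thesis by (auto simp: pd_eq xmul_eq fun_eq_iff fun_upd_twist)
qed

lemma xmul_pd: "xmul i (pd j P) - pd j (xmul i P) = (if i = j then - P else 0)"
  using pd_xmul[of j i P] by (auto simp: algebra_simps split: if_splits)

lemma pE_pd: "pE i (pd j P) = pd j (pE i P)"
  and pE_xmul: "pE i (xmul j P) = xmul j (pE i P)"
  and pI_pd: "pI i (pd j P) = pd j (pI i P)"
  and pI_xmul: "pI i (xmul j P) = xmul j (pI i P)"
  by (auto simp: pE_def pI_def ew_def iw_def pd_eq xmul_eq fun_eq_iff)

text \<open>With \<open>A\<close> exterior or interior multiplication and \<open>p\<close> the multiplication by \<open>x\<^sub>j\<close> or the derivative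
  \<open>\<partial>\<^sub>j\<close>, this covers the four first-order operators of the theory.\<close>

definition gop :: "nat \<Rightarrow> (nat \<Rightarrow> cpoly \<Rightarrow> cpoly) \<Rightarrow> (nat \<Rightarrow> cpoly \<Rightarrow> cpoly) \<Rightarrow> cpoly \<Rightarrow> cpoly" where
  "gop m A p P = (\<Sum>j<m. A j (p j P))"

lemma linear_gop:
  assumes "\<And>j. linear (A j)" "\<And>j. linear (p j)" shows "linear (gop m A p)"
  by (rule linearI)
    (simp_all add: gop_def linear_add[OF assms(1)] linear_add[OF assms(2)] linear_cmul[OF assms(1)]
      linear_cmul[OF assms(2)] sum.distrib scaleR_sum_right)

text \<open>Exchange \<open>q j\<close> and \<open>p i\<close> in the second double sum. What
  remains is the anticommutator of \<open>A i\<close> and \<open>B j\<close> applied to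
  \<open>p i (q j P)\<close>, while the commutator contributes the diagonal sum of
  \<open>B i (A i P)\<close>.\<close>

lemma gop_anticommutator:
  assumes lin: "\<And>j. linear (A j)" "\<And>j. linear (B j)" "\<And>j. linear (p j)" "\<And>j. linear (q j)"
    and Bp: "\<And>i j P. B i (p j P) = p j (B i P)" and Aq: "\<And>i j P. A i (q j P) = q j (A i P)"
    and AB: "\<And>i j P. A i (B j P) + B j (A i P) = (if i = j then a *\<^sub>R P else 0)"
    and pq: "\<And>i j P. p i (q j P) - q j (p i P) = (if i = j then d *\<^sub>R P else 0)"
  shows "gop m A p (gop m B q P) + gop m B q (gop m A p P)
     = a *\<^sub>R (\<Sum>i<m. p i (q i P)) - d *\<^sub>R (\<Sum>i<m. B i (A i P))"
proof -
  have 1: "gop m A p (gop m B q P) = (\<Sum>i<m. \<Sum>j<m. A i (B j (p i (q j P))))"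
    by (simp add: gop_def linear_sum[OF lin(1)] linear_sum[OF lin(3)] Bp)
  have "gop m B q (gop m A p P) = (\<Sum>j<m. \<Sum>i<m. B j (A i (q j (p i P))))"
    by (simp add: gop_def linear_sum[OF lin(2)] linear_sum[OF lin(4)] Aq)
  also have "\<dots> = (\<Sum>i<m. \<Sum>j<m. B j (A i (q j (p i P))))" by (rule sum.swap)
  finally have 2: "gop m B q (gop m A p P) = (\<Sum>i<m. \<Sum>j<m. B j (A i (q j (p i P))))" .
  have 3: "A i (B j (p i (q j P))) + B j (A i (q j (p i P)))
      = (if i = j then a *\<^sub>R p i (q j P) else 0) - (if i = j then d *\<^sub>R B j (A i P) else 0)" for i j
  proof -
    have "q j (p i P) = p i (q j P) - (if i = j then d *\<^sub>R P else 0)"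
      using pq[of i j P] by (auto simp: algebra_simps split: if_splits)
    then have "B j (A i (q j (p i P))) = B j (A i (p i (q j P))) - (if i = j then d *\<^sub>R B j (A i P) else 0)"
      by (auto simp: linear_diff[OF lin(1)] linear_diff[OF lin(2)] linear_cmul[OF lin(1)] linear_cmul[OF lin(2)]
        linear_0[OF lin(1)] linear_0[OF lin(2)])
    then show ?thesis using AB[of i j "p i (q j P)"] by (simp add: algebra_simps)
  qed
  show ?thesis
    unfolding 1 2 sum.distrib[symmetric] 3
    by (simp add: sum_subtractf sum.delta scaleR_sum_right)
qed

text \<open>The operators \<open>x\<bullet>\<close> and \<open>\<partial>\<^sup>-\<close> of the statement are the negatives of \<open>oJ\<close> and \<open>oC\<close>.\<close>

abbreviation "oX m \<equiv> gop m pE xmul"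
abbreviation "oJ m \<equiv> gop m pI xmul"
abbreviation "oD m \<equiv> gop m pE pd"
abbreviation "oC m \<equiv> gop m pI pd"

definition euler :: "nat \<Rightarrow> cpoly \<Rightarrow> cpoly" where "euler m P = (\<Sum>j<m. xmul j (pd j P))"
definition rsq :: "nat \<Rightarrow> cpoly \<Rightarrow> cpoly" where "rsq m P = (\<Sum>j<m. xmul j (xmul j P))"
text \<open>Number operators: they count the generators present, respectively absent. With
  \<open>euler\<close> they turn the mixed anticommutators into scalars on each
  \<open>Pspace m s k\<close>.\<close>

definition numE :: "nat \<Rightarrow> cpoly \<Rightarrow> cpoly" where "numE m P = (\<Sum>j<m. pE j (pI j P))"
definition numI :: "nat \<Rightarrow> cpoly \<Rightarrow> cpoly" where "numI m P = (\<Sum>j<m. pI j (pE j P))"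

lemma linear_ops [simp]: "linear (oX m)" "linear (oJ m)" "linear (oD m)" "linear (oC m)"
  by (simp_all add: linear_gop)

lemma pE_same [simp]: "pE i (pE i P) = 0" and pI_same [simp]: "pI i (pI i P) = 0"
  by (auto simp: pE_def pI_def fun_eq_iff)

lemma lap_eq: "lap m P = (\<Sum>j<m. pd j (pd j P))"
  by (simp add: lap_def fun_eq_iff)

lemma double_zero: "x + x = 0 \<Longrightarrow> x = (0::cpoly)"
  by (auto simp: fun_eq_iff)

lemma oD_oD: "oD m (oD m P) = 0"
  by (rule double_zero, subst gop_anticommutator[where a = 0 and d = 0])
    (simp_all add: pE_pd pE_pE pd_pd)
lemma oC_oC: "oC m (oC m P) = 0"
  by (rule double_zero, subst gop_anticommutator[where a = 0 and d = 0])
    (simp_all add: pI_pd pI_pI pd_pd)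
lemma oX_oD: "oX m (oD m P) + oD m (oX m P) = 0"
  by (subst gop_anticommutator[where a = 0 and d = "-1"])
    (simp_all add: pE_xmul pE_pd pE_pE xmul_pd)
lemma oJ_oC: "oJ m (oC m P) + oC m (oJ m P) = 0"
  by (subst gop_anticommutator[where a = 0 and d = "-1"])
    (simp_all add: pI_xmul pI_pd pI_pI xmul_pd)
lemma oX_oC: "oX m (oC m P) + oC m (oX m P) = euler m P + numI m P"
  by (subst gop_anticommutator[where a = 1 and d = "-1"])
    (simp_all add: pI_xmul pE_pd pE_pI xmul_pd euler_def numI_def)
lemma oJ_oD: "oJ m (oD m P) + oD m (oJ m P) = euler m P + numE m P"
  by (subst gop_anticommutator[where a = 1 and d = "-1"])
    (simp_all add: pE_xmul pI_pd pE_pI[unfolded add.commute[of "pE _ _"]] xmul_pd euler_def numE_def)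
lemma oD_oC: "oD m (oC m P) + oC m (oD m P) = lap m P"
  by (subst gop_anticommutator[where a = 1 and d = 0])
    (simp_all add: pI_pd pE_pd pE_pI pd_pd lap_eq)

section \<open>Clifford multiplication by vectors\<close>

abbreviation sd :: "nat set \<Rightarrow> nat set \<Rightarrow> nat set" where "sd A B \<equiv> (A - B) \<union> (B - A)"

lemma sd_eq_iff: "sd A B = C \<longleftrightarrow> B = sd A C" by auto

text \<open>Inversions and coincidences together are the pairs with \<open>b \<le> a\<close>. In
  product form the sign is visibly multiplicative in each argument, which later gives
  associativity.\<close>

lemma cl_sign_prod:
  assumes "finite A" "finite B"
  shows "cl_sign A B = (\<Prod>a\<in>A. \<Prod>b\<in>B. if b \<le> a then -1 else 1)"
proof -
  have fin: "finite {(a, b). a \<in> A \<and> b \<in> B \<and> b < a}"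
    by (rule finite_subset[of _ "A \<times> B"]) (use assms in auto)
  have inj: "inj_on (\<lambda>a. (a, a)) (A \<inter> B)" by (auto simp: inj_on_def)
  have "card {(a, b). a \<in> A \<and> b \<in> B \<and> b < a} + card (A \<inter> B)
      = card ({(a, b). a \<in> A \<and> b \<in> B \<and> b < a} \<union> (\<lambda>a. (a, a)) ` (A \<inter> B))"
    using fin assms by (subst card_Un_disjoint) (auto simp: card_image[OF inj])
  also have "{(a, b). a \<in> A \<and> b \<in> B \<and> b < a} \<union> (\<lambda>a. (a, a)) ` (A \<inter> B) = {x \<in> A \<times> B. snd x \<le> fst x}"
    by (auto simp: image_def)
  finally have "cl_sign A B = (-1) ^ card {x \<in> A \<times> B. snd x \<le> fst x}" by (simp add: cl_sign_def)
  also have "\<dots> = (\<Prod>x\<in>A \<times> B. if snd x \<le> fst x then -1 else 1)"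
    using assms by (simp add: prod.If_cases Int_def)
  also have "\<dots> = (\<Prod>a\<in>A. \<Prod>b\<in>B. if b \<le> a then -1 else 1)"
    by (simp add: prod.cartesian_product case_prod_beta)
  finally show ?thesis .
qed

lemma cl_sign_left:
  assumes "finite B" shows "cl_sign {j} B = sg j B * (if j \<in> B then -1 else 1)"
proof -
  have "{b \<in> B. b \<le> j} = {b \<in> B. b < j} \<union> (if j \<in> B then {j} else {})" by (auto simp: le_less)
  then have "card {b \<in> B. b \<le> j} = card {b \<in> B. b < j} + (if j \<in> B then 1 else 0)"
    using assms by simp
  then show ?thesis using assms
    by (simp add: cl_sign_prod prod.If_cases Int_def sg_def)
qed

lemma cl_sign_right:
  assumes "finite B" shows "cl_sign B {j} = (-1) ^ card B * sg j B"
proof -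
  have "card B = card {b \<in> B. b < j} + card {b \<in> B. j \<le> b}"
    using assms by (subst card_Un_disjoint[symmetric]) (auto intro!: arg_cong[where f = card])
  then have "(-1) ^ card B * sg j B = ((-1) ^ card {b \<in> B. j \<le> b} :: real) * (sg j B * sg j B)"
    by (simp add: sg_def power_add)
  moreover have "cl_sign B {j} = (\<Prod>a\<in>B. if j \<le> a then -1 else 1)"
    using assms by (simp add: cl_sign_prod)
  ultimately show ?thesis using assms
    by (simp add: prod.If_cases Int_def)
qed

lemma cl_mult_eq:
  "cl_mult m u v C = (if C \<subseteq> {..<m}
     then \<Sum>A\<in>Pow {..<m}. cl_sign A (sd A C) * u A * v (sd A C) else 0)"
proof (cases "C \<subseteq> {..<m}")
  case True
  have "(\<Sum>B\<in>Pow {..<m}. if sd A B = C then cl_sign A B * u A * v B else 0)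
      = cl_sign A (sd A C) * u A * v (sd A C)" if "A \<in> Pow {..<m}" for A
  proof -
    have "sd A C \<in> Pow {..<m}" using that True by blast
    then show ?thesis unfolding sd_eq_iff by (subst sum.delta) (simp_all add: sum.delta)
  qed
  then show ?thesis using True by (simp add: cl_mult_def)
next
  case False
  then show ?thesis by (auto simp: cl_mult_def intro!: sum.neutral)
qed

lemma cl_mult_eq':
  "cl_mult m u v C = (if C \<subseteq> {..<m}
     then \<Sum>B\<in>Pow {..<m}. cl_sign (sd B C) B * u (sd B C) * v B else 0)"
proof (cases "C \<subseteq> {..<m}")
  case True
  have "(\<Sum>A\<in>Pow {..<m}. cl_sign A (sd A C) * u A * v (sd A C))
     = (\<Sum>B\<in>Pow {..<m}. cl_sign (sd B C) B * u (sd B C) * v B)"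
  proof (rule sum.reindex_bij_witness[of _ "\<lambda>A. sd A C" "\<lambda>A. sd A C"])
    fix A assume "A \<in> Pow {..<m}"
    then show "sd A C \<in> Pow {..<m}" using True by auto
    show 1: "sd (sd A C) C = A" by auto
    show "cl_sign (sd (sd A C) C) (sd A C) * u (sd (sd A C) C) * v (sd A C)
      = cl_sign A (sd A C) * u A * v (sd A C)" unfolding 1 ..
  qed (insert True, blast+)
  then show ?thesis using True by (simp add: cl_mult_eq)
qed (simp add: cl_mult_eq)

lemma sum_Pow_singletons:
  assumes "\<And>A. A \<in> Pow {..<m} \<Longrightarrow> card A \<noteq> 1 \<Longrightarrow> f A = 0"
  shows "(\<Sum>A\<in>Pow {..<m::nat}. f A) = (\<Sum>j<m. f {j})"
proof -
  have "(\<Sum>A\<in>Pow {..<m}. f A) = (\<Sum>A\<in>(\<lambda>j. {j}) ` {..<m}. f A)"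
    by (rule sum.mono_neutral_right) (auto simp: card_1_singleton_iff intro!: assms)
  also have "\<dots> = (\<Sum>j<m. f {j})" by (subst sum.reindex) (auto simp: inj_on_def)
  finally show ?thesis .
qed

definition supp_in :: "nat \<Rightarrow> (nat set \<Rightarrow> 'a::zero) \<Rightarrow> bool" where
  "supp_in m v \<longleftrightarrow> (\<forall>A. v A \<noteq> 0 \<longrightarrow> A \<subseteq> {..<m})"

text \<open>The minus sign reflects \<open>e\<^sub>j e\<^sub>j = -1\<close>. Multiplication from the
  right gives the sum instead, up to \<open>(-1) ^ s\<close>, so half sums and half differences
  isolate exterior and interior multiplication.\<close>

lemma cl_mult_vec_left:
  assumes u: "svec m 1 u" and v: "supp_in m v"
  shows "cl_mult m u v = (\<Sum>j<m. u {j} *\<^sub>R (ew j v - iw j v))"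
proof
  fix C
  show "cl_mult m u v C = (\<Sum>j<m. u {j} *\<^sub>R (ew j v - iw j v)) C"
  proof (cases "C \<subseteq> {..<m}")
    case True
    then have fin: "finite C" by (rule finite_subset) simp
    have z: "u A = 0" if "card A \<noteq> 1" for A using u that by (auto simp: svec_def)
    have "cl_mult m u v C = (\<Sum>j<m. cl_sign {j} (sd {j} C) * u {j} * v (sd {j} C))"
      using True by (simp add: cl_mult_eq sum_Pow_singletons z)
    also have "\<dots> = (\<Sum>j<m. u {j} *\<^sub>R (ew j v - iw j v) C)"
      by (rule sum.cong) (use fin in \<open>auto simp: cl_sign_left ew_def iw_def sg_insert sg_remove\<close>)
    finally show ?thesis by simp
  next
    case False
    have "ew j v C = 0" "iw j v C = 0" if "j < m" for j
      using False v that by (auto simp: ew_def iw_def supp_in_def)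
    then show ?thesis using False by (simp add: cl_mult_eq)
  qed
qed

lemma cl_mult_vec_right:
  assumes u: "svec m 1 u" and v: "svec m s v"
  shows "cl_mult m v u = (-1) ^ s *\<^sub>R (\<Sum>j<m. u {j} *\<^sub>R (ew j v + iw j v))"
proof
  fix C
  show "cl_mult m v u C = ((-1) ^ s *\<^sub>R (\<Sum>j<m. u {j} *\<^sub>R (ew j v + iw j v))) C"
  proof (cases "C \<subseteq> {..<m}")
    case True
    then have fin: "finite C" by (rule finite_subset) simp
    have z: "u A = 0" if "card A \<noteq> 1" for A using u that by (auto simp: svec_def)
    have "cl_mult m v u C = (\<Sum>j<m. cl_sign (sd {j} C) {j} * v (sd {j} C) * u {j})"
      using True by (simp add: cl_mult_eq' sum_Pow_singletons z)
    also have "\<dots> = (\<Sum>j<m. (-1) ^ s *\<^sub>R u {j} *\<^sub>R (ew j v + iw j v) C)"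
    proof (rule sum.cong)
      fix j
      have "(-1) ^ card B * v B = (-1) ^ s * v B" for B
        using v by (cases "v B = 0") (auto simp: svec_def)
      then have "cl_sign (sd {j} C) {j} * v (sd {j} C) = (-1) ^ s * (sg j (sd {j} C) * v (sd {j} C))"
        using fin by (simp add: cl_sign_right mult.assoc mult.left_commute)
      then show "cl_sign (sd {j} C) {j} * v (sd {j} C) * u {j} = (-1) ^ s *\<^sub>R u {j} *\<^sub>R (ew j v + iw j v) C"
        by (auto simp: ew_def iw_def sg_insert sg_remove)
    qed simp
    finally show ?thesis by (simp add: sum_distrib_left)
  next
    case False
    have "ew j v C = 0" "iw j v C = 0" if "j < m" for j
      using False v that by (auto simp: ew_def iw_def svec_def)
    then show ?thesis using False by (simp add: cl_mult_eq)
  qed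
qed

lemma svec_supp_in: "svec m s v \<Longrightarrow> supp_in m v"
  by (auto simp: svec_def supp_in_def)

lemma svec_evec: "j < m \<Longrightarrow> svec m 1 (evec j)"
  by (auto simp: svec_def evec_def)

lemma svec_grade: "supp_in m v \<Longrightarrow> svec m s (grade s v)"
  by (auto simp: svec_def supp_in_def grade_def)

lemma sum_evec: "j < m \<Longrightarrow> (\<Sum>i<m. evec j {i} *\<^sub>R f i) = (f j :: 'a::real_vector)"
  by (subst sum.remove[of _ j]) (auto simp: evec_def intro!: sum.neutral)

lemma sum_grade:
  assumes v: "supp_in m v" shows "(\<Sum>s\<le>m. grade s v) = v"
proof
  fix A
  show "(\<Sum>s\<le>m. grade s v) A = v A"
  proof (cases "v A = 0")
    case True then show ?thesis by (simp add: grade_def)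
  next
    case False
    then have "card A \<le> m" using v subset_eq_atLeast0_lessThan_card[of A m]
      by (auto simp: supp_in_def lessThan_atLeast0)
    then show ?thesis by (simp add: grade_def sum.delta')
  qed
qed

lemma linear_ew: "linear (ew j :: mvec \<Rightarrow> mvec)" and linear_iw: "linear (iw j :: mvec \<Rightarrow> mvec)"
  by (rule linearI; simp add: ew_def iw_def fun_eq_iff algebra_simps)+

lemma cl_wedge_evec:
  assumes "j < m" "supp_in m v" shows "cl_wedge m (evec j) v = ew j v"
proof -
  have "cl_wedge m (evec j) v = (\<Sum>s\<le>m. ew j (grade s v))"
  proof
    fix C
    have "(cl_mult m (evec j) (grade s v) C + (- 1) ^ s * cl_mult m (grade s v) (evec j) C) / 2
       = ew j (grade s v) C" for s
      using assms svec_grade[OF assms(2), of s] svec_evec[OF assms(1)]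
      by (simp add: cl_mult_vec_left cl_mult_vec_right svec_supp_in sum_evec del: sum_fun_apply)
    then show "cl_wedge m (evec j) v C = (\<Sum>s\<le>m. ew j (grade s v)) C"
      by (simp add: cl_wedge_def)
  qed
  also have "\<dots> = ew j v"
    by (simp add: linear_sum[OF linear_ew, symmetric] sum_grade assms)
  finally show ?thesis .
qed

lemma cl_dot_evec:
  assumes "j < m" "supp_in m v" shows "cl_dot m (evec j) v = - iw j v"
proof -
  have "cl_dot m (evec j) v = - (\<Sum>s\<le>m. iw j (grade s v))"
  proof
    fix C
    have "(cl_mult m (evec j) (grade s v) C - (- 1) ^ s * cl_mult m (grade s v) (evec j) C) / 2
       = - iw j (grade s v) C" for s
      using assms svec_grade[OF assms(2), of s] svec_evec[OF assms(1)]
      by (simp add: cl_mult_vec_left cl_mult_vec_right svec_supp_in sum_evec del: sum_fun_apply)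
    then show "cl_dot m (evec j) v C = (- (\<Sum>s\<le>m. iw j (grade s v))) C"
      by (simp add: cl_dot_def sum_negf)
  qed
  also have "\<dots> = - iw j v"
    by (simp add: linear_sum[OF linear_iw, symmetric] sum_grade assms)
  finally show ?thesis .
qed

section \<open>Degrees\<close>

lemma Pspace_iff: "P \<in> Pspace m s k \<longleftrightarrow>
  (\<forall>\<alpha> A. P \<alpha> A \<noteq> 0 \<longrightarrow> \<alpha> \<in> mindices m k \<and> A \<subseteq> {..<m} \<and> card A = s)"
  unfolding Pspace_def svec_def mv_zero_def fun_eq_iff mem_Collect_eq by blast

lemma subspace_Pspace: "subspace (Pspace m s k)"
  unfolding subspace_def
proof (intro conjI ballI allI)
  fix P Q assume "P \<in> Pspace m s k" "Q \<in> Pspace m s k"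
  then show "P + Q \<in> Pspace m s k" unfolding Pspace_iff plus_fun_apply by (metis add_0)
qed (simp_all add: Pspace_iff, blast)

lemma Pspace_add: "P \<in> Pspace m s k \<Longrightarrow> Q \<in> Pspace m s k \<Longrightarrow> P + Q \<in> Pspace m s k"
  and Pspace_diff: "P \<in> Pspace m s k \<Longrightarrow> Q \<in> Pspace m s k \<Longrightarrow> P - Q \<in> Pspace m s k"
  and Pspace_neg: "P \<in> Pspace m s k \<Longrightarrow> - P \<in> Pspace m s k"
  and Pspace_scale: "P \<in> Pspace m s k \<Longrightarrow> c *\<^sub>R P \<in> Pspace m s k"
  and Pspace_0: "0 \<in> Pspace m s k"
  and Pspace_sum: "(\<And>i. i \<in> S \<Longrightarrow> f i \<in> Pspace m s k) \<Longrightarrow> sum f S \<in> Pspace m s k"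
  using subspace_Pspace[of m s k]
  by (auto intro: subspace_add subspace_diff subspace_neg subspace_scale subspace_0 subspace_sum)

lemmas Pspace_intros = Pspace_add Pspace_diff Pspace_neg Pspace_scale Pspace_0 Pspace_sum

lemma mindices_upd:
  assumes "j < m" shows "\<alpha>(j := Suc (\<alpha> j)) \<in> mindices m (Suc k) \<longleftrightarrow> \<alpha> \<in> mindices m k"
proof -
  have "(\<Sum>i<m. (\<alpha>(j := Suc (\<alpha> j))) i) = Suc (\<Sum>i<m. \<alpha> i)"
    using assms by (simp add: sum.remove[of "{..<m}" j])
  then show ?thesis using assms by (auto simp: mindices_def)
qed

lemma mindices_upd_0: "j < m \<Longrightarrow> \<alpha>(j := Suc (\<alpha> j)) \<notin> mindices m 0"
  by (auto simp: mindices_def)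

text \<open>In degree \<open>0\<close> the result is zero and lies in every such space, so the
  truncated \<open>k - 1\<close> is harmless.\<close>

lemma pd_Pspace:
  assumes "j < m" "P \<in> Pspace m s k" shows "pd j P \<in> Pspace m s (k - 1)"
proof (cases k)
  case 0
  then show ?thesis using assms mindices_upd_0[OF assms(1)] by (simp add: Pspace_iff pd_eq) blast
next
  case (Suc n)
  then show ?thesis using assms mindices_upd[OF assms(1), of _ n] by (simp add: Pspace_iff pd_eq) blast
qed

lemma pd_Pspace_0:
  assumes "j < m" "P \<in> Pspace m s 0" shows "pd j P = 0"
  using assms mindices_upd_0[OF assms(1)]
  by (force simp: Pspace_iff pd_eq fun_eq_iff)

lemma xmul_Pspace:
  assumes "j < m" "P \<in> Pspace m s k" shows "xmul j P \<in> Pspace m s (Suc k)"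
  unfolding Pspace_iff
proof (intro allI impI)
  fix \<alpha> A assume *: "xmul j P \<alpha> A \<noteq> 0"
  define \<beta> where "\<beta> = \<alpha>(j := \<alpha> j - 1)"
  have "\<alpha> j > 0" "P \<beta> A \<noteq> 0" using * by (auto simp: xmul_eq \<beta>_def split: if_splits)
  moreover from this have "\<alpha> = \<beta>(j := Suc (\<beta> j))" by (auto simp: \<beta>_def)
  ultimately show "\<alpha> \<in> mindices m (Suc k) \<and> A \<subseteq> {..<m} \<and> card A = s"
    using assms mindices_upd[OF assms(1), of \<beta> k] by (auto simp: Pspace_iff)
qed

lemma pE_Pspace:
  assumes "j < m" "P \<in> Pspace m s k" shows "pE j P \<in> Pspace m (Suc s) k"
  unfolding Pspace_iff
proof (intro allI impI)
  fix \<alpha> A assume "pE j P \<alpha> A \<noteq> 0"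
  then have *: "j \<in> A" "P \<alpha> (A - {j}) \<noteq> 0" by (auto simp: pE_def ew_def split: if_splits)
  then have **: "\<alpha> \<in> mindices m k" "A - {j} \<subseteq> {..<m}" "card (A - {j}) = s"
    using assms by (auto simp: Pspace_iff)
  then have "finite A" by (metis finite_Diff_insert finite_lessThan finite_subset Diff_empty)
  then show "\<alpha> \<in> mindices m k \<and> A \<subseteq> {..<m} \<and> card A = Suc s"
    using * ** assms(1) card_Suc_Diff1 by fastforce
qed

lemma pI_Pspace:
  assumes "j < m" "P \<in> Pspace m s k" shows "pI j P \<in> Pspace m (s - 1) k"
  unfolding Pspace_iff
proof (intro allI impI)
  fix \<alpha> A assume "pI j P \<alpha> A \<noteq> 0"
  then have *: "j \<notin> A" "P \<alpha> (insert j A) \<noteq> 0" by (auto simp: pI_def iw_def split: if_splits)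
  then have **: "\<alpha> \<in> mindices m k" "insert j A \<subseteq> {..<m}" "card (insert j A) = s"
    using assms unfolding Pspace_iff by blast+
  then have "finite A" by (metis finite_insert finite_lessThan finite_subset)
  then show "\<alpha> \<in> mindices m k \<and> A \<subseteq> {..<m} \<and> card A = s - 1"
    using * ** by auto
qed

lemma pI_Pspace_0:
  assumes "P \<in> Pspace m 0 k" shows "pI j P = 0"
proof -
  have "P \<alpha> (insert j A) = 0" for \<alpha> A
    using assms unfolding Pspace_iff
    by (metis card_0_eq finite_lessThan finite_subset insert_not_empty)
  then show ?thesis by (simp add: pI_def iw_def fun_eq_iff)
qed

lemma Pspace_gt: "P \<in> Pspace m s k \<Longrightarrow> m < s \<Longrightarrow> P = 0"
  by (auto simp: Pspace_iff fun_eq_iff) (metis card_lessThan card_mono finite_lessThan not_less)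

lemma oX_Pspace: "P \<in> Pspace m s k \<Longrightarrow> oX m P \<in> Pspace m (Suc s) (Suc k)"
  and oJ_Pspace: "P \<in> Pspace m s k \<Longrightarrow> oJ m P \<in> Pspace m (s - 1) (Suc k)"
  and oD_Pspace: "P \<in> Pspace m s k \<Longrightarrow> oD m P \<in> Pspace m (Suc s) (k - 1)"
  and oC_Pspace: "P \<in> Pspace m s k \<Longrightarrow> oC m P \<in> Pspace m (s - 1) (k - 1)"
  unfolding gop_def by (intro Pspace_sum pE_Pspace pI_Pspace pd_Pspace xmul_Pspace; simp)+

lemma oC_Pspace_0: "P \<in> Pspace m 0 k \<Longrightarrow> oC m P = 0"
  and oJ_Pspace_0: "P \<in> Pspace m 0 k \<Longrightarrow> oJ m P = 0"
  by (auto simp: gop_def intro!: sum.neutral) (metis pI_Pspace_0 pd_Pspace xmul_Pspace)+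

lemma oD_Pspace_0: "P \<in> Pspace m s 0 \<Longrightarrow> oD m P = 0"
  and oC_Pspace_0': "P \<in> Pspace m s 0 \<Longrightarrow> oC m P = 0"
  by (auto simp: gop_def pd_Pspace_0 linear_0 intro!: sum.neutral)

lemma euler_Pspace: assumes "P \<in> Pspace m s k" shows "euler m P = real k *\<^sub>R P"
proof (intro ext)
  fix \<alpha> A
  have "xmul j (pd j P) \<alpha> A = real (\<alpha> j) * P \<alpha> A" for j
    by (cases "\<alpha> j") (auto simp: xmul_eq pd_eq fun_upd_idem)
  then have "euler m P \<alpha> A = real (\<Sum>j<m. \<alpha> j) * P \<alpha> A"
    by (simp add: euler_def sum_distrib_right)
  also have "\<dots> = real k * P \<alpha> A"
    using assms by (cases "P \<alpha> A = 0") (auto simp: Pspace_iff mindices_def)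
  finally show "euler m P \<alpha> A = (real k *\<^sub>R P) \<alpha> A" by simp
qed

lemma numE_Pspace: assumes "P \<in> Pspace m s k" shows "numE m P = real s *\<^sub>R P"
proof (intro ext)
  fix \<alpha> A
  have "pE j (pI j P) \<alpha> A = (if j \<in> A then P \<alpha> A else 0)" for j
    by (auto simp: pE_def pI_def ew_def iw_def sg_remove insert_absorb)
  then have "numE m P \<alpha> A = real (card (A \<inter> {..<m})) * P \<alpha> A"
    by (simp add: numE_def sum.If_cases Int_commute)
  also have "\<dots> = real s * P \<alpha> A"
    using assms by (cases "P \<alpha> A = 0") (auto simp: Pspace_iff Int_absorb2)
  finally show "numE m P \<alpha> A = (real s *\<^sub>R P) \<alpha> A" by simp
qed

lemma numI_numE: "numI m P = real m *\<^sub>R P - numE m P"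
proof -
  have "pI j (pE j P) = P - pE j (pI j P)" for j using pE_pI[of j j P] by (simp add: algebra_simps)
  then show ?thesis by (simp add: numI_def numE_def sum_subtractf sum_constant_scaleR del: sum_constant)
qed

lemma numI_Pspace: assumes "P \<in> Pspace m s k" shows "numI m P = (real m - real s) *\<^sub>R P"
  using assms by (simp add: numI_numE numE_Pspace algebra_simps)

lemma oX_oC': "P \<in> Pspace m s k \<Longrightarrow> oC m (oX m P) = (real k + real m - real s) *\<^sub>R P - oX m (oC m P)"
  using oX_oC[of m P] by (simp add: euler_Pspace numI_Pspace algebra_simps)

lemma oJ_oD': "P \<in> Pspace m s k \<Longrightarrow> oD m (oJ m P) = (real k + real s) *\<^sub>R P - oJ m (oD m P)"
  using oJ_oD[of m P] by (simp add: euler_Pspace numE_Pspace algebra_simps)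

lemma oX_oD': "oD m (oX m P) = - oX m (oD m P)" using oX_oD[of m P] by (simp add: eq_neg_iff_add_eq_0 add.commute)
lemma oJ_oC': "oC m (oJ m P) = - oJ m (oC m P)" using oJ_oC[of m P] by (simp add: eq_neg_iff_add_eq_0 add.commute)

lemma Pspace_supp_in: "P \<in> Pspace m s k \<Longrightarrow> supp_in m (P \<alpha>)"
  by (auto simp: Pspace_iff supp_in_def)

lemma dplus_eq: "P \<in> Pspace m s k \<Longrightarrow> dplus m P = oD m P"
  and dminus_eq: "P \<in> Pspace m s k \<Longrightarrow> dminus m P = - oC m P"
  and xwedge_eq: "P \<in> Pspace m s k \<Longrightarrow> xwedge m P = oX m P"
  and xdot_eq: "P \<in> Pspace m s k \<Longrightarrow> xdot m P = - oJ m P"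
  by (simp_all add: dplus_def dminus_def xwedge_def xdot_def fun_eq_iff gop_def
      cl_wedge_evec cl_dot_evec pE_def pI_def sum_negf Pspace_supp_in[OF pd_Pspace] Pspace_supp_in[OF xmul_Pspace])

section \<open>Decomposition of the kernel\<close>

text \<open>\<open>Hsp\<close> with natural indices and the sign-free operators. It is zero for
  \<open>m < s\<close> by \<open>HH_gt\<close>, in accordance with the convention for
  \<open>Hsp\<close>.\<close>

definition HH :: "nat \<Rightarrow> nat \<Rightarrow> nat \<Rightarrow> cpoly set" where
  "HH m s k = {P \<in> Pspace m s k. oD m P = 0 \<and> oC m P = 0}"

text \<open>Origin of the coefficients: let \<open>h\<close> be in \<open>HH m s k\<close>, with
  \<open>a\<close> and \<open>b\<close> as in the context below. Applying \<open>oD\<close> after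
  \<open>oC\<close> to \<open>p oX oJ h + q oJ oX h\<close> gives
  \<open>a (p (b + 2) - q b) h\<close>, and the opposite order gives
  \<open>b (q (a + 2) - p a) h\<close>. They agree if \<open>p a (b + 1) = q b (a + 1)\<close>,
  which \<open>p = (a + 1) b\<close> and \<open>q = (b + 1) a\<close> satisfy.\<close>

definition wop :: "nat \<Rightarrow> real \<Rightarrow> real \<Rightarrow> cpoly \<Rightarrow> cpoly" where
  "wop m a b h = ((a + 1) * b) *\<^sub>R oX m (oJ m h) + ((b + 1) * a) *\<^sub>R oJ m (oX m h)"

lemma linear_wop: "linear (wop m a b)"
  by (rule linearI)
    (simp_all add: wop_def linear_add[OF linear_ops(1)] linear_add[OF linear_ops(2)] linear_cmul[OF linear_ops(1)]
      linear_cmul[OF linear_ops(2)] algebra_simps)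

lemma subspace_HH: "subspace (HH m s k)"
  unfolding subspace_def HH_def
  by (auto simp: Pspace_intros linear_add[OF linear_ops(3)] linear_add[OF linear_ops(4)] linear_cmul[OF linear_ops(3)]
      linear_cmul[OF linear_ops(4)] linear_0)

lemmas ops_linear = linear_add[OF linear_ops(1)] linear_add[OF linear_ops(2)] linear_add[OF linear_ops(3)]
  linear_add[OF linear_ops(4)] linear_cmul[OF linear_ops(1)] linear_cmul[OF linear_ops(2)]
  linear_cmul[OF linear_ops(3)] linear_cmul[OF linear_ops(4)] linear_diff[OF linear_ops(1)]
  linear_diff[OF linear_ops(2)] linear_diff[OF linear_ops(3)] linear_diff[OF linear_ops(4)]
  linear_0[OF linear_ops(1)] linear_0[OF linear_ops(2)] linear_0[OF linear_ops(3)] linear_0[OF linear_ops(4)]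
  linear_neg[OF linear_ops(1)] linear_neg[OF linear_ops(2)] linear_neg[OF linear_ops(3)] linear_neg[OF linear_ops(4)]

text \<open>On \<open>h\<close> the compositions \<open>oD oJ\<close> and \<open>oC oX\<close>
  reduce to the scalars \<open>a\<close> and \<open>b\<close>; all further identities follow by
  moving derivatives to the right.\<close>

context
  fixes m s k :: nat and h :: cpoly and a b :: real
  assumes h: "h \<in> HH m s k"
  defines "a \<equiv> real k + real s" and "b \<equiv> real k + real m - real s"
begin

lemma HH_Pspace: "h \<in> Pspace m s k" and HH_D: "oD m h = 0" and HH_C: "oC m h = 0"
  using h by (auto simp: HH_def)

lemma HH_CX: "oC m (oX m h) = b *\<^sub>R h"
  using oX_oC'[OF HH_Pspace] by (simp add: HH_C ops_linear b_def)

lemma HH_DJ: "oD m (oJ m h) = a *\<^sub>R h"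
  using oJ_oD'[OF HH_Pspace] by (simp add: HH_D ops_linear a_def)

lemma HH_DX: "oD m (oX m h) = 0"
  by (simp add: oX_oD' HH_D ops_linear)

lemma HH_CJ: "oC m (oJ m h) = 0"
  by (simp add: oJ_oC' HH_C ops_linear)

lemma HH_DXJ: "oD m (oX m (oJ m h)) = - a *\<^sub>R oX m h"
  by (simp add: oX_oD' HH_DJ ops_linear)

lemma HH_CJX: "oC m (oJ m (oX m h)) = - b *\<^sub>R oJ m h"
  by (simp add: oJ_oC' HH_CX ops_linear)

lemma HH_CXJ: "oC m (oX m (oJ m h)) = (b + 2) *\<^sub>R oJ m h"
proof (cases s)
  \<comment> \<open>The truncated grade \<open>s - 1\<close> would give the scalar
    \<open>b + 1\<close> here, but \<open>oJ m h\<close> is zero.\<close>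
  case 0
  then show ?thesis using oJ_Pspace_0 HH_Pspace by (simp add: ops_linear)
next
  case (Suc n)
  then show ?thesis using oX_oC'[OF oJ_Pspace[OF HH_Pspace]]
    by (simp add: HH_CJ ops_linear b_def algebra_simps)
qed

lemma HH_DJX: "oD m (oJ m (oX m h)) = (a + 2) *\<^sub>R oX m h"
  using oJ_oD'[OF oX_Pspace[OF HH_Pspace]]
  by (simp add: HH_DX ops_linear a_def algebra_simps)

lemma HH_DC_wop: "oD m (oC m (wop m a b h)) = (a * b * (a + b + 2)) *\<^sub>R h"
  by (simp add: wop_def ops_linear HH_CXJ HH_CJX HH_DJ flip: scaleR_left_distrib scaleR_left_diff_distrib)
    (simp add: algebra_simps)

lemma HH_CD_wop: "oC m (oD m (wop m a b h)) = (a * b * (a + b + 2)) *\<^sub>R h"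
  by (simp add: wop_def ops_linear HH_DXJ HH_DJX HH_CX flip: scaleR_left_distrib scaleR_left_diff_distrib)
    (simp add: algebra_simps)

text \<open>The Laplacian of \<open>p oX oJ h + q oJ oX h\<close> is \<open>2 (p a + q b) h\<close>,
  which cancels for \<open>p = b\<close> and \<open>q = - a\<close>. This combination is used on the
  null cone.\<close>

lemma HH_lap_XJ_JX: "lap m (b *\<^sub>R oX m (oJ m h) - a *\<^sub>R oJ m (oX m h)) = 0"
  by (simp add: oD_oC[symmetric] ops_linear HH_DXJ HH_DJX HH_CX HH_CXJ HH_CJX HH_DJ algebra_simps)

lemma wop_Pspace: "wop m c d h \<in> Pspace m s (Suc (Suc k))"
proof -
  have "oX m (oJ m h) \<in> Pspace m s (Suc (Suc k))"
    using oX_Pspace[OF oJ_Pspace[OF HH_Pspace]] oJ_Pspace_0[of h] HH_Pspace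
    by (cases s) (auto simp: ops_linear Pspace_0)
  moreover have "oJ m (oX m h) \<in> Pspace m s (Suc (Suc k))"
    using oJ_Pspace[OF oX_Pspace[OF HH_Pspace]] by simp
  ultimately show ?thesis unfolding wop_def by (intro Pspace_intros)
qed

lemma HH_oX_Pspace: "oX m h \<in> Pspace m (Suc s) (Suc k)"
  and HH_oJ_Pspace: "oJ m h \<in> Pspace m (s - 1) (Suc k)"
  using HH_Pspace by (rule oX_Pspace oJ_Pspace)+

end

text \<open>The parameter spaces of the last three summands, indexed by the target
  \<open>(s, k)\<close>. The case distinctions keep natural subtraction away from degenerate
  indices.\<close>

definition S1 :: "nat \<Rightarrow> nat \<Rightarrow> nat \<Rightarrow> cpoly set" where
  "S1 m s k = (if 1 \<le> s \<and> 1 \<le> k then HH m (s - 1) (k - 1) else {0})"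
definition S2 :: "nat \<Rightarrow> nat \<Rightarrow> nat \<Rightarrow> cpoly set" where
  "S2 m s k = (if s < m \<and> 1 \<le> k then HH m (s + 1) (k - 1) else {0})"
definition S3 :: "nat \<Rightarrow> nat \<Rightarrow> nat \<Rightarrow> cpoly set" where
  "S3 m s k = (if 1 \<le> s \<and> s < m \<and> 2 \<le> k then HH m s (k - 2) else {0})"
definition wop3 :: "nat \<Rightarrow> nat \<Rightarrow> nat \<Rightarrow> cpoly \<Rightarrow> cpoly" where
  "wop3 m s k = wop m (real (k - 2) + real s) (real (k - 2) + real m - real s)"

lemma S1_facts:
  assumes "h \<in> S1 m s k"
  shows "oC m (oX m h) = (real k + real m - real s) *\<^sub>R h" "oD m (oX m h) = 0" "oX m h \<in> Pspace m s k"
proof (atomize (full), cases "1 \<le> s \<and> 1 \<le> k")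
  case True
  then have h: "h \<in> HH m (s - 1) (k - 1)" using assms by (simp add: S1_def)
  show "oC m (oX m h) = (real k + real m - real s) *\<^sub>R h \<and> oD m (oX m h) = 0 \<and> oX m h \<in> Pspace m s k"
    using HH_CX[OF h] HH_DX[OF h] HH_oX_Pspace[OF h] True by (auto simp: of_nat_diff)
qed (use assms in \<open>auto simp: S1_def ops_linear Pspace_0\<close>)

lemma S2_facts:
  assumes "h \<in> S2 m s k"
  shows "oD m (oJ m h) = (real k + real s) *\<^sub>R h" "oC m (oJ m h) = 0" "oJ m h \<in> Pspace m s k"
proof (atomize (full), cases "s < m \<and> 1 \<le> k")
  case True
  then have h: "h \<in> HH m (s + 1) (k - 1)" using assms by (simp add: S2_def)
  show "oD m (oJ m h) = (real k + real s) *\<^sub>R h \<and> oC m (oJ m h) = 0 \<and> oJ m h \<in> Pspace m s k"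
    using HH_DJ[OF h] HH_CJ[OF h] HH_oJ_Pspace[OF h] True by (auto simp: of_nat_diff)
qed (use assms in \<open>auto simp: S2_def ops_linear Pspace_0\<close>)

lemma S3_facts:
  assumes "h \<in> S3 m s k"
  obtains c where "c \<noteq> 0" "oD m (oC m (wop3 m s k h)) = c *\<^sub>R h" "oC m (oD m (wop3 m s k h)) = c *\<^sub>R h"
    "wop3 m s k h \<in> Pspace m s k"
proof (cases "1 \<le> s \<and> s < m \<and> 2 \<le> k")
  case True
  define a where "a = real (k - 2) + real s"
  define b where "b = real (k - 2) + real m - real s"
  have h: "h \<in> HH m s (k - 2)" using True assms by (simp add: S3_def)
  \<comment> \<open>Positivity of \<open>a\<close> needs \<open>1 \<le> s\<close> and that of
    \<open>b\<close> needs \<open>s < m\<close>; this excludes the extreme grades from the fourth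
    summand.\<close>
  have "a > 0" "b > 0" using True by (auto simp: a_def b_def)
  then have "a * b * (a + b + 2) \<noteq> 0" by simp
  moreover have "Suc (Suc (k - 2)) = k" using True by linarith
  ultimately show ?thesis using that[of "a * b * (a + b + 2)"] HH_DC_wop[OF h] HH_CD_wop[OF h] wop_Pspace[OF h]
    by (simp add: wop3_def a_def b_def)
next
  case False
  then show ?thesis using assms that[of 1] by (auto simp: S3_def wop3_def linear_0[OF linear_wop] ops_linear Pspace_0)
qed

text \<open>\<open>oD\<close> kills this element because its square is zero, and \<open>oC\<close>
  kills it because the two orders agree on \<open>P\<close>. In the degenerate cases one of the two
  equal expressions vanishes for lack of grade or degree.\<close>

lemma DC_S3:
  assumes P: "P \<in> Pspace m s k" and eq: "oD m (oC m P) = oC m (oD m P)" and "s \<le> m"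
  shows "oD m (oC m P) \<in> S3 m s k"
proof (cases "1 \<le> s \<and> s < m \<and> 2 \<le> k")
  case True
  have "oD m (oC m P) \<in> Pspace m s (k - 2)"
    using oD_Pspace[OF oC_Pspace[OF P]] True by (simp add: numeral_2_eq_2)
  moreover have "oC m (oD m (oC m P)) = 0" unfolding eq by (simp add: oC_oC)
  ultimately show ?thesis using True by (simp add: S3_def HH_def oD_oD)
next
  case False
  then consider "s = 0" | "s = m" | "k < 2" using assms by linarith
  then have "oD m (oC m P) = 0"
  proof cases
    case 1 then show ?thesis using P oC_Pspace_0 by (simp add: ops_linear)
  next
    case 2 then have "oD m P = 0" using Pspace_gt[OF oD_Pspace[OF P]] by simp
    then show ?thesis by (simp add: eq ops_linear)
  next
    case 3
    then have k: "k - 1 = 0" by linarith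
    have "oC m P \<in> Pspace m (s - 1) 0" using oC_Pspace[OF P] unfolding k .
    then show ?thesis using oD_Pspace_0 by blast
  qed
  then show ?thesis unfolding S3_def if_not_P[OF False] by simp
qed

lemma subspace_S: "subspace (S1 m s k)" "subspace (S2 m s k)" "subspace (S3 m s k)"
  by (auto simp: S1_def S2_def S3_def subspace_HH)

lemma inframonogenic_decomposition:
  assumes P: "P \<in> Pspace m s k" and eq: "oD m (oC m P) = oC m (oD m P)" and "s \<le> m"
  obtains h0 h1 h2 h3 where "h0 \<in> HH m s k" "h1 \<in> S1 m s k" "h2 \<in> S2 m s k" "h3 \<in> S3 m s k"
    "P = h0 + oX m h1 + oJ m h2 + wop3 m s k h3" "lap m P = 0 \<Longrightarrow> h3 = 0"
proof -
  define Q where "Q = oD m (oC m P)"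
  have Q: "Q \<in> S3 m s k" using DC_S3 assms by (simp add: Q_def)
  from S3_facts[OF Q] obtain c where c: "c \<noteq> 0" "oD m (oC m (wop3 m s k Q)) = c *\<^sub>R Q"
    "oC m (oD m (wop3 m s k Q)) = c *\<^sub>R Q" "wop3 m s k Q \<in> Pspace m s k" .
  define h3 where "h3 = (1 / c) *\<^sub>R Q"
  have w: "wop3 m s k h3 = (1 / c) *\<^sub>R wop3 m s k Q"
    by (simp add: h3_def wop3_def linear_cmul[OF linear_wop])
  have h3: "h3 \<in> S3 m s k" using Q subspace_S by (simp add: h3_def subspace_scale)
  define P' where "P' = P - wop3 m s k h3"
  have P': "P' \<in> Pspace m s k" using P c by (simp add: P'_def w Pspace_intros)
  have D: "oD m (oC m P') = 0" using c by (simp add: P'_def w ops_linear Q_def)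
  have C: "oC m (oD m P') = 0" using c by (simp add: P'_def w ops_linear Q_def eq)
  have S1: "oC m P' \<in> S1 m s k"
  proof (cases "1 \<le> s \<and> 1 \<le> k")
    case True
    then show ?thesis using oC_Pspace[OF P'] D by (simp add: S1_def HH_def oC_oC)
  next
    case False
    then have "s = 0 \<or> k = 0" by linarith
    then have "oC m P' = 0" using oC_Pspace_0 oC_Pspace_0' P' by metis
    then show ?thesis unfolding S1_def if_not_P[OF False] by simp
  qed
  have S2: "oD m P' \<in> S2 m s k"
  proof (cases "s < m \<and> 1 \<le> k")
    case True
    then show ?thesis using oD_Pspace[OF P'] C by (simp add: S2_def HH_def oD_oD)
  next
    case False
    then have "m < Suc s \<or> k = 0" by linarith
    then have "oD m P' = 0" using oD_Pspace_0 Pspace_gt[OF oD_Pspace[OF P']] P' by metis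
    then show ?thesis unfolding S2_def if_not_P[OF False] by simp
  qed
  \<comment> \<open>The scalars are those of \<open>S1_facts\<close> and \<open>S2_facts\<close>, so
    that \<open>oC m (oX m h1)\<close> and \<open>oD m (oJ m h2)\<close> reproduce
    \<open>oC m P'\<close> and \<open>oD m P'\<close>.\<close>
  define h1 where "h1 = (1 / (real k + real m - real s)) *\<^sub>R oC m P'"
  define h2 where "h2 = (1 / (real k + real s)) *\<^sub>R oD m P'"
  have h1: "h1 \<in> S1 m s k" and h2: "h2 \<in> S2 m s k"
    using S1 S2 subspace_S by (simp_all add: h1_def h2_def subspace_scale)
  \<comment> \<open>For \<open>k = 0\<close> and \<open>s = m\<close> the divisor is zero, but in
    degree \<open>0\<close> the right-hand side vanishes as well.\<close>
  have e1: "(real k + real m - real s) *\<^sub>R h1 = oC m P'"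
    using oC_Pspace_0' P' \<open>s \<le> m\<close> by (cases "k = 0") (auto simp: h1_def)
  have e2: "(real k + real s) *\<^sub>R h2 = oD m P'"
    using oD_Pspace_0 P' by (cases "k = 0") (auto simp: h2_def)
  define h0 where "h0 = P' - oX m h1 - oJ m h2"
  have "h0 \<in> HH m s k"
    using P' S1_facts[OF h1] S2_facts[OF h2] by (simp add: h0_def HH_def Pspace_intros ops_linear e1 e2)
  moreover have "P = h0 + oX m h1 + oJ m h2 + wop3 m s k h3" by (simp add: h0_def P'_def)
  moreover have "h3 = 0" if "lap m P = 0"
  proof -
    have "Q + Q = 0" using that by (simp add: Q_def oD_oC[symmetric] eq)
    then show ?thesis using double_zero by (auto simp: h3_def)
  qed
  ultimately show ?thesis using that h1 h2 h3 by blast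
qed

text \<open>\<open>oD\<close> after \<open>oC\<close> kills all components but the last. Once that
  one is gone, \<open>oC\<close> isolates \<open>h1\<close> and \<open>oD\<close> isolates
  \<open>h2\<close>.\<close>

lemma inframonogenic_unique:
  assumes "h0 \<in> HH m s k" "h1 \<in> S1 m s k" "h2 \<in> S2 m s k" "h3 \<in> S3 m s k" "s \<le> m"
    "h0 + oX m h1 + oJ m h2 + wop3 m s k h3 = 0"
  shows "h0 = 0 \<and> h1 = 0 \<and> h2 = 0 \<and> h3 = 0"
proof -
  from S3_facts[OF assms(4)] obtain c where c: "c \<noteq> 0" "oD m (oC m (wop3 m s k h3)) = c *\<^sub>R h3" .
  \<comment> \<open>The alternative \<open>k \<noteq> 0\<close> makes the scalar
    \<open>k + m - s\<close> nonzero when \<open>h1\<close> is cancelled at the end.\<close>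
  have h1: "oD m h1 = 0" "h1 = 0 \<or> k \<noteq> 0" using assms(2) by (auto simp: S1_def HH_def ops_linear split: if_splits)
  have h2: "h2 = 0 \<or> k \<noteq> 0" using assms(3) by (auto simp: S2_def HH_def ops_linear split: if_splits)
  have h0: "oC m h0 = 0" "oD m h0 = 0" using assms by (auto simp: HH_def)
  have "oD m (oC m (h0 + oX m h1 + oJ m h2 + wop3 m s k h3)) = 0"
    unfolding assms(6) by (simp add: ops_linear)
  then have h3: "h3 = 0" using c h1 h0
    by (simp add: ops_linear S1_facts[OF assms(2)] S2_facts[OF assms(3)])
  then have e: "h0 + oX m h1 + oJ m h2 = 0" using assms(6) by (simp add: wop3_def linear_0[OF linear_wop])
  have "oC m (h0 + oX m h1 + oJ m h2) = 0" "oD m (h0 + oX m h1 + oJ m h2) = 0"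
    unfolding e by (simp_all add: ops_linear)
  then have "(real k + real m - real s) *\<^sub>R h1 = 0" "(real k + real s) *\<^sub>R h2 = 0"
    using h0 by (simp_all add: ops_linear S1_facts[OF assms(2)] S2_facts[OF assms(3)])
  then have "h1 = 0" "h2 = 0" using h1 h2 \<open>s \<le> m\<close> by auto
  then show ?thesis using h3 e by (simp add: ops_linear)
qed

section \<open>Translation to the spaces and direct sums of the statement\<close>

lemma tlap_eq: "P \<in> Pspace m s k \<Longrightarrow> tlap m P = oD m (oC m P) - oC m (oD m P)"
  by (simp add: tlap_def pscale_eq pdiff_eq dplus_eq dminus_eq[of P] dplus_eq[OF Pspace_neg[OF oC_Pspace]]
      dminus_eq[OF oD_Pspace] ops_linear)

lemma KerTLap_eq: "KerTLap m s k = {P \<in> Pspace m s k. oD m (oC m P) = oC m (oD m P)}"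
  by (auto simp: KerTLap_def tlap_eq pzero_eq)

lemma Hsp_eq: "s \<le> m \<Longrightarrow> Hsp m (int s) (int k) = HH m s k"
  by (auto simp: Hsp_def HH_def dplus_eq dminus_eq pzero_eq)

lemma HH_gt: "m < s \<Longrightarrow> HH m s k = {0}"
  using Pspace_gt by (auto simp: HH_def Pspace_0 ops_linear)

lemma summand1: "s \<le> m \<Longrightarrow> xwedge m ` Hsp m (int s - 1) (int k - 1) = oX m ` S1 m s k"
proof (cases "1 \<le> s \<and> 1 \<le> k")
  case True
  assume "s \<le> m"
  then have "Hsp m (int s - 1) (int k - 1) = HH m (s - 1) (k - 1)"
    using Hsp_eq[of "s - 1" m "k - 1"] True by (simp add: of_nat_diff)
  then show ?thesis using True xwedge_eq[of _ m "s - 1" "k - 1"] by (simp add: S1_def HH_def cong: image_cong_simp)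
next
  case False
  then have "Hsp m (int s - 1) (int k - 1) = {0}" by (auto simp: Hsp_def pzero_eq)
  then show ?thesis using False xwedge_eq[of 0 m 0 0] by (auto simp: S1_def ops_linear Pspace_0)
qed

text \<open>Absorbs the sign between \<open>xdot\<close> and \<open>oJ\<close>, and between the
  operator in \<open>Wt\<close> and \<open>wop\<close>.\<close>

lemma subspace_uminus_image:
  assumes "subspace S" "linear f" shows "(\<lambda>x. - f x) ` S = f ` S"
proof -
  have "uminus ` S = S" using assms subspace_neg by force
  then have "f ` S = f ` uminus ` S" by simp
  then show ?thesis by (simp add: image_image linear_neg[OF assms(2)])
qed

lemma summand2: "s \<le> m \<Longrightarrow> xdot m ` Hsp m (int s + 1) (int k - 1) = oJ m ` S2 m s k"
proof (cases "s < m \<and> 1 \<le> k")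
  case True
  then have "Hsp m (int s + 1) (int k - 1) = HH m (s + 1) (k - 1)"
    using Hsp_eq[of "s + 1" m "k - 1"] by (simp add: of_nat_diff add.commute)
  then have "xdot m ` Hsp m (int s + 1) (int k - 1) = (\<lambda>h. - oJ m h) ` S2 m s k"
    using True xdot_eq[of _ m "s + 1" "k - 1"] by (simp add: S2_def HH_def cong: image_cong_simp)
  then show ?thesis by (simp add: subspace_uminus_image subspace_S)
next
  case False
  then have "Hsp m (int s + 1) (int k - 1) = {0}" by (auto simp: Hsp_def pzero_eq)
  then show ?thesis using False xdot_eq[of 0 m 0 0] by (auto simp: S2_def ops_linear Pspace_0)
qed

lemma summand3: "s \<le> m \<Longrightarrow> Wt m s k = wop3 m s k ` S3 m s k"
proof (cases "1 \<le> s \<and> s < m \<and> 2 \<le> k")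
  case True
  then have H: "Hsp m (int s) (int k - 2) = HH m s (k - 2)"
    using Hsp_eq[of s m "k - 2"] by (simp add: of_nat_diff)
  define a where "a = real (k - 2) + real s"
  define b where "b = real (k - 2) + real m - real s"
  have "padd (pscale ((a + 1) * b) (xwedge m (xdot m P))) (pscale ((b + 1) * a) (xdot m (xwedge m P)))
     = - wop m a b P" if "P \<in> HH m s (k - 2)" for P
  proof -
    have P: "P \<in> Pspace m s (k - 2)" using that by (simp add: HH_def)
    have "xwedge m (xdot m P) = - oX m (oJ m P)"
      using xdot_eq[OF P] xwedge_eq[OF Pspace_neg[OF oJ_Pspace[OF P]]] by (simp add: ops_linear)
    moreover have "xdot m (xwedge m P) = - oJ m (oX m P)"
      using xwedge_eq[OF P] xdot_eq[OF oX_Pspace[OF P]] by simp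
    ultimately show ?thesis by (simp add: padd_eq pscale_eq wop_def)
  qed
  then have "Wt m s k = (\<lambda>h. - wop m a b h) ` HH m s (k - 2)"
    using True less_imp_le[of s m] unfolding Wt_def H by (simp add: le_diff_conv2 a_def b_def Let_def of_nat_diff algebra_simps cong: image_cong_simp)
  also have "\<dots> = wop3 m s k ` S3 m s k"
    using True by (simp add: subspace_uminus_image subspace_HH linear_wop wop3_def S3_def a_def b_def)
  finally show ?thesis .
next
  case False
  assume "s \<le> m"
  then show ?thesis using False by (auto simp: Wt_def S3_def wop3_def linear_0[OF linear_wop] pzero_eq)
qed

lemma is_direct_sum4:
  "is_direct_sum X [A, B, C, D] \<longleftrightarrow> X = {a + b + c + d | a b c d. a \<in> A \<and> b \<in> B \<and> c \<in> C \<and> d \<in> D} \<and>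
    (\<forall>a\<in>A. \<forall>b\<in>B. \<forall>c\<in>C. \<forall>d\<in>D. a + b + c + d = 0 \<longrightarrow> a = 0 \<and> b = 0 \<and> c = 0 \<and> d = 0)"
proof -
  have len: "(length Ps = length [A, B, C, D] \<and> (\<forall>i<length [A, B, C, D]. Ps ! i \<in> [A, B, C, D] ! i)) \<longleftrightarrow>
    (\<exists>a\<in>A. \<exists>b\<in>B. \<exists>c\<in>C. \<exists>d\<in>D. Ps = [a, b, c, d])" for Ps
    by (auto simp: length_Suc_conv All_less_Suc2 numeral_eq_Suc)
  have f: "foldr padd [a, b, c, d] pzero = a + b + c + d" for a b c d
    by (simp add: padd_eq pzero_eq add.assoc)
  have "{foldr padd Ps pzero | Ps. length Ps = length [A, B, C, D] \<and> (\<forall>i<length [A, B, C, D]. Ps ! i \<in> [A, B, C, D] ! i)}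
    = {foldr padd [a, b, c, d] pzero | a b c d. a \<in> A \<and> b \<in> B \<and> c \<in> C \<and> d \<in> D}"
    unfolding len by blast
  moreover have "(\<forall>Ps. length Ps = length [A, B, C, D] \<and> (\<forall>i<length [A, B, C, D]. Ps ! i \<in> [A, B, C, D] ! i) \<and> foldr padd Ps pzero = pzero
        \<longrightarrow> (\<forall>i<length [A, B, C, D]. Ps ! i = pzero)) \<longleftrightarrow>
     (\<forall>a\<in>A. \<forall>b\<in>B. \<forall>c\<in>C. \<forall>d\<in>D. a + b + c + d = 0 \<longrightarrow> a = 0 \<and> b = 0 \<and> c = 0 \<and> d = 0)" (is "?L \<longleftrightarrow> ?R")
  proof -
    have "?L \<longleftrightarrow> (\<forall>a\<in>A. \<forall>b\<in>B. \<forall>c\<in>C. \<forall>d\<in>D. foldr padd [a, b, c, d] pzero = pzero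
        \<longrightarrow> (\<forall>i<length [A, B, C, D]. [a, b, c, d] ! i = pzero))"
      unfolding conj_assoc[symmetric] len by blast
    then show ?thesis unfolding f by (simp add: pzero_eq All_less_Suc2 numeral_eq_Suc)
  qed
  ultimately show ?thesis unfolding is_direct_sum_def f by simp
qed

lemma is_direct_sum3:
  "is_direct_sum X [A, B, C] \<longleftrightarrow> X = {a + b + c | a b c. a \<in> A \<and> b \<in> B \<and> c \<in> C} \<and>
    (\<forall>a\<in>A. \<forall>b\<in>B. \<forall>c\<in>C. a + b + c = 0 \<longrightarrow> a = 0 \<and> b = 0 \<and> c = 0)"
proof -
  have len: "(length Ps = length [A, B, C] \<and> (\<forall>i<length [A, B, C]. Ps ! i \<in> [A, B, C] ! i)) \<longleftrightarrow>
    (\<exists>a\<in>A. \<exists>b\<in>B. \<exists>c\<in>C. Ps = [a, b, c])" for Ps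
    by (auto simp: length_Suc_conv All_less_Suc2 numeral_eq_Suc)
  have f: "foldr padd [a, b, c] pzero = a + b + c" for a b c
    by (simp add: padd_eq pzero_eq add.assoc)
  have "{foldr padd Ps pzero | Ps. length Ps = length [A, B, C] \<and> (\<forall>i<length [A, B, C]. Ps ! i \<in> [A, B, C] ! i)}
    = {foldr padd [a, b, c] pzero | a b c. a \<in> A \<and> b \<in> B \<and> c \<in> C}"
    unfolding len by blast
  moreover have "(\<forall>Ps. length Ps = length [A, B, C] \<and> (\<forall>i<length [A, B, C]. Ps ! i \<in> [A, B, C] ! i) \<and> foldr padd Ps pzero = pzero
        \<longrightarrow> (\<forall>i<length [A, B, C]. Ps ! i = pzero)) \<longleftrightarrow>
     (\<forall>a\<in>A. \<forall>b\<in>B. \<forall>c\<in>C. a + b + c = 0 \<longrightarrow> a = 0 \<and> b = 0 \<and> c = 0)" (is "?L \<longleftrightarrow> ?R")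
  proof -
    have "?L \<longleftrightarrow> (\<forall>a\<in>A. \<forall>b\<in>B. \<forall>c\<in>C. foldr padd [a, b, c] pzero = pzero
        \<longrightarrow> (\<forall>i<length [A, B, C]. [a, b, c] ! i = pzero))"
      unfolding conj_assoc[symmetric] len by blast
    then show ?thesis unfolding f by (simp add: pzero_eq All_less_Suc2 numeral_eq_Suc)
  qed
  ultimately show ?thesis unfolding is_direct_sum_def f by simp
qed

lemma direct_sum_KerTLap:
  assumes "s \<le> m"
  shows "is_direct_sum (KerTLap m s k) [HH m s k, oX m ` S1 m s k, oJ m ` S2 m s k, wop3 m s k ` S3 m s k]"
  unfolding is_direct_sum4
proof (intro conjI)
  show "KerTLap m s k = {a + b + c + d | a b c d. a \<in> HH m s k \<and> b \<in> oX m ` S1 m s k \<and>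
     c \<in> oJ m ` S2 m s k \<and> d \<in> wop3 m s k ` S3 m s k}" (is "_ = ?R")
  proof
    show "KerTLap m s k \<subseteq> ?R"
    proof
      fix P assume "P \<in> KerTLap m s k"
      then have *: "P \<in> Pspace m s k" "oD m (oC m P) = oC m (oD m P)" by (auto simp: KerTLap_eq)
      from inframonogenic_decomposition[OF * assms] obtain h0 h1 h2 h3
        where "h0 \<in> HH m s k" "h1 \<in> S1 m s k" "h2 \<in> S2 m s k" "h3 \<in> S3 m s k"
          "P = h0 + oX m h1 + oJ m h2 + wop3 m s k h3" by metis
      then show "P \<in> ?R" by blast
    qed
    show "?R \<subseteq> KerTLap m s k"
    proof clarify
      fix h0 h1 h2 h3 assume h: "h0 \<in> HH m s k" "h1 \<in> S1 m s k" "h2 \<in> S2 m s k" "h3 \<in> S3 m s k"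
      from S3_facts[OF h(4)] obtain c where c: "oD m (oC m (wop3 m s k h3)) = c *\<^sub>R h3"
        "oC m (oD m (wop3 m s k h3)) = c *\<^sub>R h3" "wop3 m s k h3 \<in> Pspace m s k" .
      have "oD m h1 = 0" "oC m h2 = 0" using h by (auto simp: S1_def S2_def HH_def ops_linear split: if_splits)
      then show "h0 + oX m h1 + oJ m h2 + wop3 m s k h3 \<in> KerTLap m s k"
        using h(1) S1_facts[OF h(2)] S2_facts[OF h(3)] c
        by (simp add: KerTLap_eq HH_def Pspace_intros ops_linear)
    qed
  qed
  show "\<forall>a\<in>HH m s k. \<forall>b\<in>oX m ` S1 m s k. \<forall>c\<in>oJ m ` S2 m s k. \<forall>d\<in>wop3 m s k ` S3 m s k.
       a + b + c + d = 0 \<longrightarrow> a = 0 \<and> b = 0 \<and> c = 0 \<and> d = 0"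
  proof (intro ballI impI)
    fix a b c d assume a: "a \<in> HH m s k" and "b \<in> oX m ` S1 m s k" "c \<in> oJ m ` S2 m s k" "d \<in> wop3 m s k ` S3 m s k"
      and sum: "a + b + c + d = 0"
    then obtain h1 h2 h3 where h: "h1 \<in> S1 m s k" "b = oX m h1" "h2 \<in> S2 m s k" "c = oJ m h2"
      "h3 \<in> S3 m s k" "d = wop3 m s k h3" by blast
    from inframonogenic_unique[OF a h(1,3,5) assms] sum
    show "a = 0 \<and> b = 0 \<and> c = 0 \<and> d = 0" unfolding h(2,4,6) by (simp add: ops_linear linear_0[OF linear_wop] wop3_def)
  qed
qed

lemma S3_0: "0 \<in> S3 m s k" using subspace_S subspace_0 by blast

lemma direct_sum_KerLap:
  assumes "s \<le> m"
  shows "is_direct_sum (KerLap m s k \<inter> KerTLap m s k) [HH m s k, oX m ` S1 m s k, oJ m ` S2 m s k]"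
  unfolding is_direct_sum3
proof (intro conjI)
  show "KerLap m s k \<inter> KerTLap m s k = {a + b + c | a b c. a \<in> HH m s k \<and> b \<in> oX m ` S1 m s k \<and>
     c \<in> oJ m ` S2 m s k}" (is "_ = ?R")
  proof
    show "KerLap m s k \<inter> KerTLap m s k \<subseteq> ?R"
    proof
      fix P assume "P \<in> KerLap m s k \<inter> KerTLap m s k"
      then have *: "P \<in> Pspace m s k" "oD m (oC m P) = oC m (oD m P)" "lap m P = 0"
        by (auto simp: KerTLap_eq KerLap_def pzero_eq)
      from inframonogenic_decomposition[OF *(1,2) assms] obtain h0 h1 h2 h3
        where h: "h0 \<in> HH m s k" "h1 \<in> S1 m s k" "h2 \<in> S2 m s k"
          "P = h0 + oX m h1 + oJ m h2 + wop3 m s k h3" "lap m P = 0 \<Longrightarrow> h3 = 0" by metis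
      then have "P = h0 + oX m h1 + oJ m h2" using *(3) by (simp add: wop3_def linear_0[OF linear_wop])
      then show "P \<in> ?R" using h by blast
    qed
    show "?R \<subseteq> KerLap m s k \<inter> KerTLap m s k"
    proof clarify
      fix h0 h1 h2 assume h: "h0 \<in> HH m s k" "h1 \<in> S1 m s k" "h2 \<in> S2 m s k"
      have "oD m h1 = 0" "oC m h2 = 0" using h by (auto simp: S1_def S2_def HH_def ops_linear split: if_splits)
      then show "h0 + oX m h1 + oJ m h2 \<in> KerLap m s k \<inter> KerTLap m s k"
        using h(1) S1_facts[OF h(2)] S2_facts[OF h(3)]
        by (simp add: KerTLap_eq KerLap_def HH_def Pspace_intros ops_linear oD_oC[symmetric] pzero_eq)
    qed
  qed
  have w0: "wop3 m s k 0 = 0" by (simp add: wop3_def linear_0 linear_wop)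
  show "\<forall>a\<in>HH m s k. \<forall>b\<in>oX m ` S1 m s k. \<forall>c\<in>oJ m ` S2 m s k.
       a + b + c = 0 \<longrightarrow> a = 0 \<and> b = 0 \<and> c = 0"
  proof (intro ballI impI)
    fix a b c assume a: "a \<in> HH m s k" and "b \<in> oX m ` S1 m s k" "c \<in> oJ m ` S2 m s k" and sum: "a + b + c = 0"
    then obtain h1 h2 where h: "h1 \<in> S1 m s k" "b = oX m h1" "h2 \<in> S2 m s k" "c = oJ m h2" by blast
    from inframonogenic_unique[OF a h(1,3) S3_0 assms] sum
    show "a = 0 \<and> b = 0 \<and> c = 0" unfolding h(2,4) by (simp add: ops_linear w0)
  qed
qed

text \<open>As simplification rules these equations would also rewrite unapplied sums and differences of
  functions, after eta expansion.\<close>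

lemmas fun_apply_simps = sum_fun_apply plus_fun_apply zero_fun_apply scaleR_fun_apply minus_apply uminus_apply
  times_fun_apply numeral_fun_apply

declare fun_apply_simps [simp del] one_fun_apply [simp del]

section \<open>Reflections of multivectors\<close>

text \<open>Scalar multiplication over the coefficient ring, so that complex scalars are
  covered.\<close>

definition csc :: "'a::comm_ring_1 \<Rightarrow> (nat set \<Rightarrow> 'a) \<Rightarrow> nat set \<Rightarrow> 'a" where
  "csc c v = (\<lambda>C. c * v C)"

definition ev :: "nat \<Rightarrow> (nat \<Rightarrow> 'a::comm_ring_1) \<Rightarrow> (nat set \<Rightarrow> 'a) \<Rightarrow> nat set \<Rightarrow> 'a" where
  "ev m z v = (\<Sum>j<m. csc (z j) (ew j v))"

definition iv :: "nat \<Rightarrow> (nat \<Rightarrow> 'a::comm_ring_1) \<Rightarrow> (nat set \<Rightarrow> 'a) \<Rightarrow> nat set \<Rightarrow> 'a" where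
  "iv m z v = (\<Sum>j<m. csc (z j) (iw j v))"

definition bil :: "nat \<Rightarrow> (nat \<Rightarrow> 'a::comm_ring_1) \<Rightarrow> (nat \<Rightarrow> 'a) \<Rightarrow> 'a" where
  "bil m z w = (\<Sum>j<m. z j * w j)"

definition rv :: "nat \<Rightarrow> (nat \<Rightarrow> 'a::comm_ring_1) \<Rightarrow> (nat \<Rightarrow> 'a) \<Rightarrow> nat \<Rightarrow> 'a" where
  "rv m u z = (\<lambda>j. z j - 2 * bil m u z * u j)"

text \<open>For a unit vector \<open>u\<close> this is the reflection \<open>rv m u\<close> extended
  to the exterior algebra: multiples of \<open>u\<close> are the range of \<open>ev m u\<close>
  after \<open>iv m u\<close> and get the factor \<open>-1\<close>.\<close>

definition Lv :: "nat \<Rightarrow> (nat \<Rightarrow> 'a::comm_ring_1) \<Rightarrow> (nat set \<Rightarrow> 'a) \<Rightarrow> nat set \<Rightarrow> 'a" where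
  "Lv m u v = v - csc 2 (ev m u (iv m u v))"

lemma csc_add: "csc c (v + w) = csc c v + csc c w"
  and csc_add_left: "csc (a + b) v = csc a v + csc b v"
  and csc_diff: "csc c (v - w) = csc c v - csc c w"
  and csc_diff_left: "csc (a - b) v = csc a v - csc b v"
  and csc_neg: "csc c (- v) = - csc c v"
  and csc_csc [simp]: "csc a (csc b v) = csc (a * b) v"
  and csc_0 [simp]: "csc c 0 = 0" "csc 0 v = 0"
  and csc_1 [simp]: "csc 1 v = v"
  and csc_sum: "csc c (sum f S) = (\<Sum>i\<in>S. csc c (f i))"
  and csc_sum_left: "csc (sum g S) v = (\<Sum>i\<in>S. csc (g i) v)"
  by (simp_all add: csc_def fun_eq_iff fun_apply_simps algebra_simps sum_distrib_left sum_distrib_right)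

lemma ew_csc: "ew j (csc c v) = csc c (ew j v)" and iw_csc: "iw j (csc c v) = csc c (iw j v)"
  by (auto simp: ew_def iw_def csc_def)

lemma ew_0 [simp]: "ew j 0 = 0" and iw_0 [simp]: "iw j 0 = 0"
  by (auto simp: ew_def iw_def fun_eq_iff fun_apply_simps)

lemma ew_sum: "ew j (sum f S) = (\<Sum>i\<in>S. ew j (f i))" and iw_sum: "iw j (sum f S) = (\<Sum>i\<in>S. iw j (f i))"
  by (induction S rule: infinite_finite_induct) (simp_all add: ew_add iw_add)

lemma ev_add: "ev m z (v + w) = ev m z v + ev m z w" and iv_add: "iv m z (v + w) = iv m z v + iv m z w"
  by (simp_all add: ev_def iv_def ew_add iw_add csc_add sum.distrib)

lemma ev_csc: "ev m z (csc c v) = csc c (ev m z v)" and iv_csc: "iv m z (csc c v) = csc c (iv m z v)"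
  by (simp_all add: ev_def iv_def ew_csc iw_csc csc_sum mult.commute)

lemma ev_0 [simp]: "ev m z 0 = 0" and iv_0 [simp]: "iv m z 0 = 0"
  by (simp_all add: ev_def iv_def)

lemma ev_diff: "ev m z (v - w) = ev m z v - ev m z w" and iv_diff: "iv m z (v - w) = iv m z v - iv m z w"
  using ev_add[of m z "v - w" w] iv_add[of m z "v - w" w] by simp_all

lemma ev_neg: "ev m z (- v) = - ev m z v"
  using ev_diff[of m z 0 v] by simp

lemma ev_ev_sum: "ev m z (ev m w v) = (\<Sum>i<m. \<Sum>j<m. csc (z i * w j) (ew i (ew j v)))"
  and ev_iv_sum: "ev m z (iv m w v) = (\<Sum>i<m. \<Sum>j<m. csc (z i * w j) (ew i (iw j v)))"
  and iv_ev_sum: "iv m z (ev m w v) = (\<Sum>i<m. \<Sum>j<m. csc (z i * w j) (iw i (ew j v)))"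
  and iv_iv_sum: "iv m z (iv m w v) = (\<Sum>i<m. \<Sum>j<m. csc (z i * w j) (iw i (iw j v)))"
  by (simp_all add: ev_def iv_def ew_sum iw_sum ew_csc iw_csc csc_sum)

lemma ev_ev: "ev m z (ev m w v) = - ev m w (ev m z v)"
proof -
  have "ev m w (ev m z v) = (\<Sum>i<m. \<Sum>j<m. csc (w j * z i) (ew j (ew i v)))"
    unfolding ev_ev_sum by (rule sum.swap)
  also have "\<dots> = (\<Sum>i<m. \<Sum>j<m. - csc (z i * w j) (ew i (ew j v)))"
    by (intro sum.cong refl) (metis ew_ew csc_neg mult.commute)
  also have "\<dots> = - ev m z (ev m w v)"
    unfolding ev_ev_sum by (simp add: sum_negf)
  finally show ?thesis by simp
qed

lemma iv_iv: "iv m z (iv m w v) = - iv m w (iv m z v)"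
proof -
  have "iv m w (iv m z v) = (\<Sum>i<m. \<Sum>j<m. csc (w j * z i) (iw j (iw i v)))"
    unfolding iv_iv_sum by (rule sum.swap)
  also have "\<dots> = (\<Sum>i<m. \<Sum>j<m. - csc (z i * w j) (iw i (iw j v)))"
    by (intro sum.cong refl) (metis iw_iw csc_neg mult.commute)
  also have "\<dots> = - iv m z (iv m w v)"
    unfolding iv_iv_sum by (simp add: sum_negf)
  finally show ?thesis by simp
qed

lemma ev_iv: "ev m z (iv m w v) + iv m w (ev m z v) = csc (bil m z w) v"
proof -
  have "iv m w (ev m z v) = (\<Sum>i<m. \<Sum>j<m. csc (w j * z i) (iw j (ew i v)))"
    unfolding iv_ev_sum by (rule sum.swap)
  then have "ev m z (iv m w v) + iv m w (ev m z v)
    = (\<Sum>i<m. \<Sum>j<m. csc (z i * w j) (ew i (iw j v) + iw j (ew i v)))"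
    unfolding ev_iv_sum by (simp add: sum.distrib csc_add mult.commute)
  also have "\<dots> = (\<Sum>i<m. \<Sum>j<m. if i = j then csc (z i * w j) v else 0)"
    unfolding ew_iw by (intro sum.cong) auto
  also have "\<dots> = csc (bil m z w) v" by (simp add: bil_def csc_sum_left)
  finally show ?thesis .
qed

lemma iv_ev: "iv m w (ev m z v) = csc (bil m z w) v - ev m z (iv m w v)"
  using ev_iv[of m z w v] by (simp add: algebra_simps)

lemma bil_commute: "bil m z w = bil m w z" by (simp add: bil_def mult.commute)

lemma ev_ev_same [simp]: "ev m z (ev m z v) = (0 :: nat set \<Rightarrow> 'a::real_field)"
proof
  fix C
  have "ev m z (ev m z v) C = - ev m z (ev m z v) C" using ev_ev[of m z z v] by (metis uminus_apply)
  then have "2 * ev m z (ev m z v) C = 0" unfolding eq_neg_iff_add_eq_0 mult_2 .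
  then show "ev m z (ev m z v) C = 0 C" by (simp add: fun_apply_simps)
qed

lemma iv_iv_same [simp]: "iv m z (iv m z v) = (0 :: nat set \<Rightarrow> 'a::real_field)"
proof
  fix C
  have "iv m z (iv m z v) C = - iv m z (iv m z v) C" using iv_iv[of m z z v] by (metis uminus_apply)
  then have "2 * iv m z (iv m z v) C = 0" unfolding eq_neg_iff_add_eq_0 mult_2 .
  then show "iv m z (iv m z v) C = 0 C" by (simp add: fun_apply_simps)
qed

lemma ev_lin: "ev m (\<lambda>j. a j - c * b j) v = ev m a v - csc c (ev m b v)"
  and iv_lin: "iv m (\<lambda>j. a j - c * b j) v = iv m a v - csc c (iv m b v)"
  by (simp_all add: ev_def iv_def csc_diff_left csc_sum sum_subtractf)

text \<open>Moving \<open>iv m u\<close> past \<open>ev m z\<close> produces the term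
  \<open>bil m u z\<close>, which is exactly the correction in \<open>rv\<close>; the product of two
  corrections contains \<open>ev m u\<close> twice and vanishes.\<close>

lemma Lv_ev:
  fixes u z :: "nat \<Rightarrow> 'a::real_field"
  shows "Lv m u (ev m z v) = ev m (rv m u z) (Lv m u v)"
proof -
  have "ev m u (ev m z w) = - ev m z (ev m u w)" for w by (rule ev_ev)
  then show ?thesis
    by (simp add: Lv_def rv_def ev_lin ev_diff iv_ev csc_diff ev_csc csc_neg bil_commute[of m z u])
      (simp add: csc_def fun_eq_iff fun_apply_simps algebra_simps)
qed

text \<open>Here the normalisation enters: \<open>iv m u\<close> passes \<open>ev m u\<close> and
  leaves the scalar \<open>bil m u u\<close>.\<close>

lemma Lv_iv:
  fixes u z :: "nat \<Rightarrow> 'a::real_field"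
  assumes "bil m u u = 1"
  shows "Lv m u (iv m z v) = iv m (rv m u z) (Lv m u v)"
proof -
  have 1: "iv m u (iv m z v) = - iv m z (iv m u v)" by (rule iv_iv)
  have 2: "iv m u (ev m u (iv m u v)) = iv m u v" using assms by (simp add: iv_ev)
  have 3: "iv m z (ev m u (iv m u v)) = csc (bil m u z) (iv m u v) - ev m u (iv m z (iv m u v))"
    by (simp add: iv_ev)
  show ?thesis
    by (simp add: Lv_def rv_def iv_lin iv_diff iv_csc 1 2 3 ev_neg csc_neg csc_diff)
      (simp add: csc_def fun_eq_iff fun_apply_simps algebra_simps)
qed

lemma Lv_Lv:
  fixes u :: "nat \<Rightarrow> 'a::real_field"
  assumes "bil m u u = 1"
  shows "Lv m u (Lv m u v) = v"
proof -
  have 2: "iv m u (ev m u (iv m u v)) = iv m u v" using assms by (simp add: iv_ev)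
  show ?thesis
    by (simp add: Lv_def iv_diff ev_diff iv_csc ev_csc 2 csc_diff) (simp add: csc_def fun_eq_iff fun_apply_simps algebra_simps)
qed

lemma Lv_add: "Lv m u (v + w) = Lv m u v + Lv m u w"
  and Lv_csc: "Lv m u (csc c v) = csc c (Lv m u v)"
  by (simp_all add: Lv_def ev_add iv_add csc_add ev_csc iv_csc csc_diff mult.commute algebra_simps)

lemma Lv_0 [simp]: "Lv m u 0 = 0" by (simp add: Lv_def)

lemma Lv_sum: "Lv m u (sum f S) = (\<Sum>i\<in>S. Lv m u (f i))"
  by (induction S rule: infinite_finite_induct) (simp_all add: Lv_add)

section \<open>Evaluation of polynomials\<close>

text \<open>Coefficients are real while the point may be complex; this allows real polynomials to be
  evaluated at isotropic vectors.\<close>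

definition pev :: "nat \<Rightarrow> nat \<Rightarrow> cpoly \<Rightarrow> (nat \<Rightarrow> 'a::real_field) \<Rightarrow> nat set \<Rightarrow> 'a" where
  "pev m k P x = (\<lambda>A. \<Sum>\<alpha>\<in>mindices m k. (\<Prod>j<m. x j ^ \<alpha> j) * of_real (P \<alpha> A))"

lemma peval_pev: "peval m k P = pev m k P"
  by (simp add: peval_def pev_def fun_eq_iff fun_apply_simps)

lemma finite_mindices [simp]: "finite (mindices m k)"
proof -
  have "\<alpha> j \<le> k" if "\<alpha> \<in> mindices m k" "j < m" for j \<alpha>
    using member_le_sum[of j "{..<m}" \<alpha>] that by (simp add: mindices_def)
  note * = this
  have "mindices m k \<subseteq> (\<lambda>f j. if j < m then f j else 0) ` (PiE {..<m} (\<lambda>_. {..k}))"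
  proof (intro subsetI)
    fix \<alpha> assume \<alpha>: "\<alpha> \<in> mindices m k"
    show "\<alpha> \<in> (\<lambda>f j. if j < m then f j else 0) ` (PiE {..<m} (\<lambda>_. {..k}))"
      by (rule image_eqI[where x = "restrict \<alpha> {..<m}"])
        (use \<alpha> * in \<open>auto simp: mindices_def fun_eq_iff fun_apply_simps\<close>)
  qed
  then show ?thesis by (rule finite_subset) (simp add: finite_PiE)
qed

lemma pev_add: "pev m k (P + Q) x = pev m k P x + pev m k Q x"
  by (simp add: pev_def fun_eq_iff fun_apply_simps algebra_simps sum.distrib)

lemma pev_scale: "pev m k (c *\<^sub>R P) x = csc (of_real c) (pev m k P x)"
  by (simp add: pev_def csc_def fun_eq_iff fun_apply_simps sum_distrib_left mult_ac)

lemma pev_0 [simp]: "pev m k 0 x = 0" by (simp add: pev_def fun_eq_iff fun_apply_simps)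

lemma pev_sum: "pev m k (sum f S) x = (\<Sum>i\<in>S. pev m k (f i) x)"
  by (induction S rule: infinite_finite_induct) (simp_all add: pev_add)

lemma pev_neg: "pev m k (- P) x = - pev m k P x"
  using pev_add[of m k "- P" P x] by (simp add: eq_neg_iff_add_eq_0)

lemma pev_diff: "pev m k (P - Q) x = pev m k P x - pev m k Q x"
  using pev_add[of m k P "- Q" x] by (simp add: pev_neg)

lemma of_real_sg [simp]: "of_real (sg j C) = sg j C"
  by (simp add: sg_def)

lemma pev_pE: "pev m k (pE j P) x = ew j (pev m k P x)"
  and pev_pI: "pev m k (pI j P) x = iw j (pev m k P x)"
  by (auto simp: pev_def pE_def pI_def ew_def iw_def fun_eq_iff fun_apply_simps sum_distrib_left mult_ac)

lemma bij_mindices: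
  assumes "j < m"
  shows "bij_betw (\<lambda>\<alpha>. \<alpha>(j := Suc (\<alpha> j))) (mindices m k) {\<alpha> \<in> mindices m (Suc k). 0 < \<alpha> j}"
proof (rule bij_betw_byWitness[where f' = "\<lambda>\<alpha>. \<alpha>(j := \<alpha> j - 1)"])
  show "(\<lambda>\<alpha>. \<alpha>(j := \<alpha> j - 1)) ` {\<alpha> \<in> mindices m (Suc k). 0 < \<alpha> j} \<subseteq> mindices m k"
  proof clarify
    fix \<alpha> :: mindex assume \<alpha>: "\<alpha> \<in> mindices m (Suc k)" "0 < \<alpha> j"
    then show "\<alpha>(j := \<alpha> j - 1) \<in> mindices m k"
      using mindices_upd[OF assms, of "\<alpha>(j := \<alpha> j - 1)" k] by simp
  qed
qed (use mindices_upd[OF assms, of _ k] in \<open>auto simp: fun_upd_idem\<close>)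

lemma prod_pow_upd:
  fixes m :: nat
  assumes "j < m"
  shows "(\<Prod>i<m. x i ^ (\<alpha>(j := Suc (\<alpha> j))) i) = x j * (\<Prod>i<m. (x i ::'a::comm_monoid_mult) ^ \<alpha> i)"
proof -
  have "(\<Prod>i<m. x i ^ (\<alpha>(j := Suc (\<alpha> j))) i) = x j ^ Suc (\<alpha> j) * (\<Prod>i\<in>{..<m} - {j}. x i ^ \<alpha> i)"
    using assms by (subst prod.remove[of "{..<m}" j]) auto
  moreover have "(\<Prod>i<m. x i ^ \<alpha> i) = x j ^ \<alpha> j * (\<Prod>i\<in>{..<m} - {j}. x i ^ \<alpha> i)"
    using assms by (subst prod.remove[of "{..<m}" j]) auto
  ultimately show ?thesis by (simp add: mult.assoc)
qed

lemma sum_mindices_Suc: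
  assumes "j < m" "\<And>\<alpha>. \<alpha> j = 0 \<Longrightarrow> f \<alpha> = 0"
  shows "(\<Sum>\<alpha>\<in>mindices m (Suc k). f \<alpha>) = (\<Sum>\<alpha>\<in>mindices m k. f (\<alpha>(j := Suc (\<alpha> j))))"
proof -
  have "(\<Sum>\<alpha>\<in>mindices m (Suc k). f \<alpha>) = (\<Sum>\<alpha>\<in>{\<alpha> \<in> mindices m (Suc k). 0 < \<alpha> j}. f \<alpha>)"
    by (rule sum.mono_neutral_right) (auto intro: assms)
  also have "\<dots> = (\<Sum>\<alpha>\<in>mindices m k. f (\<alpha>(j := Suc (\<alpha> j))))"
    by (rule sum.reindex_bij_betw[OF bij_mindices[OF assms(1)], symmetric])
  finally show ?thesis .
qed

lemma pev_xmul:
  assumes "j < m" shows "pev m (Suc k) (xmul j P) x = csc (x j) (pev m k P x)"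
  by (auto simp: pev_def csc_def sum_mindices_Suc[OF assms] prod_pow_upd[OF assms] xmul_eq sum_distrib_left mult_ac
      fun_apply_simps simp del: fun_upd_apply) (simp add: mult_ac)

lemma mindices_0: "mindices m 0 = {\<lambda>_. 0}"
  by (auto simp: mindices_def fun_eq_iff fun_apply_simps) (metis lessThan_iff not_le)

lemma pev_has_derivative:
  fixes x :: "nat \<Rightarrow> real"
  assumes "l < m"
  shows "((\<lambda>t. pev m (Suc k) P (x(l := t)) A) has_real_derivative pev m k (pd l P) x A) (at (x l))"
proof -
  define c where "c \<alpha> = (\<Prod>j\<in>{..<m} - {l}. x j ^ \<alpha> j)" for \<alpha> :: mindex
  have p: "(\<Prod>j<m. (x(l := t)) j ^ \<alpha> j) = t ^ \<alpha> l * c \<alpha>" for t \<alpha>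
    using assms by (simp add: prod.remove[of "{..<m}" l] c_def)
  have c': "c (\<alpha>(l := v)) = c \<alpha>" for \<alpha> v by (simp add: c_def)
  have "((\<lambda>t. \<Sum>\<alpha>\<in>mindices m (Suc k). t ^ \<alpha> l * c \<alpha> * P \<alpha> A) has_real_derivative
     (\<Sum>\<alpha>\<in>mindices m (Suc k). (real (\<alpha> l) * x l ^ (\<alpha> l - 1)) * c \<alpha> * P \<alpha> A)) (at (x l))"
    by (auto intro!: derivative_eq_intros sum.cong)
  also have "(\<Sum>\<alpha>\<in>mindices m (Suc k). (real (\<alpha> l) * x l ^ (\<alpha> l - 1)) * c \<alpha> * P \<alpha> A)
     = (\<Sum>\<alpha>\<in>mindices m k. real (Suc (\<alpha> l)) * x l ^ \<alpha> l * c \<alpha> * P (\<alpha>(l := Suc (\<alpha> l))) A)"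
    by (subst sum_mindices_Suc[OF assms]) (simp_all add: c')
  also have "\<dots> = pev m k (pd l P) x A"
    using p[of "x l"] by (simp add: pev_def pd_eq fun_apply_simps mult_ac fun_upd_triv[of x l] del: fun_upd_apply)
  finally show ?thesis unfolding pev_def p by simp
qed

lemma pev_euler:
  assumes "P \<in> Pspace m s (Suc k)"
  shows "csc (of_nat (Suc k)) (pev m (Suc k) P x) = (\<Sum>l<m. csc (x l) (pev m k (pd l P) x))"
proof -
  have "pev m (Suc k) (real (Suc k) *\<^sub>R P) x = pev m (Suc k) (euler m P) x"
    using euler_Pspace[OF assms] by simp
  also have "\<dots> = (\<Sum>l<m. csc (x l) (pev m k (pd l P) x))"
    by (simp add: euler_def pev_sum pev_xmul)
  finally show ?thesis by (simp add: pev_scale del: of_nat_Suc)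
qed

text \<open>If the polynomial function is zero, so are its partial derivatives; by induction the
  formal derivatives vanish, and Euler's identity gives \<open>P = 0\<close>.\<close>

lemma pev_inject_0:
  assumes "P \<in> Pspace m s k" "\<And>x :: nat \<Rightarrow> real. pev m k P x = 0" shows "P = 0"
  using assms
proof (induction k arbitrary: P)
  case 0
  have "P (\<lambda>_. 0) A = 0" for A using 0(2)[of "\<lambda>_. 0"] by (simp add: pev_def mindices_0 fun_eq_iff fun_apply_simps)
  moreover have "\<alpha> = (\<lambda>_. 0)" if "P \<alpha> A \<noteq> 0" for \<alpha> A
    using 0(1) that unfolding Pspace_iff mindices_0 by blast
  ultimately have "P \<alpha> A = 0" for \<alpha> A by blast
  then show ?case by (simp add: fun_eq_iff fun_apply_simps)
next
  case (Suc k)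
  have "pd l P = 0" if l: "l < m" for l
  proof (rule Suc.IH)
    show "pd l P \<in> Pspace m s k" using pd_Pspace[OF l Suc.prems(1)] by simp
    fix x :: "nat \<Rightarrow> real"
    have "pev m k (pd l P) x A = 0" for A
      using pev_has_derivative[OF l, of k P x A] Suc.prems(2) DERIV_unique[OF _ DERIV_const]
      by (auto simp: fun_apply_simps)
    then show "pev m k (pd l P) x = 0" by (simp add: fun_eq_iff fun_apply_simps)
  qed
  then have "euler m P = 0" by (simp add: euler_def linear_0)
  then show ?case using euler_Pspace[OF Suc.prems(1)] by simp
qed

lemma pev_inject:
  assumes "P \<in> Pspace m s k" "Q \<in> Pspace m s k" "\<And>x :: nat \<Rightarrow> real. pev m k P x = pev m k Q x" shows "P = Q"
  using pev_inject_0[of "P - Q" m s k] assms by (simp add: Pspace_diff pev_diff)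

section \<open>Linear substitutions\<close>

text \<open>\<open>psub m R k P\<close> is \<open>P(R x)\<close> for homogeneous \<open>P\<close> of degree \<open>k\<close>; the recursion is Euler's identity
  \<open>k P(y) = \<Sum>\<^sub>l y\<^sub>l (\<partial>\<^sub>l P)(y)\<close> at \<open>y = R x\<close>.\<close>

fun psub :: "nat \<Rightarrow> (nat \<Rightarrow> nat \<Rightarrow> real) \<Rightarrow> nat \<Rightarrow> cpoly \<Rightarrow> cpoly" where
  "psub m R 0 P = P"
| "psub m R (Suc k) P = (1 / real (Suc k)) *\<^sub>R (\<Sum>l<m. \<Sum>i<m. R l i *\<^sub>R xmul i (psub m R k (pd l P)))"

lemma linear_psub [simp]: "linear (psub m R k)"
proof (induction k)
  case 0
  show ?case by (rule linearI) simp_all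
next
  case (Suc k)
  show ?case
    by (rule linearI)
      (simp_all add: linear_add[OF Suc] linear_cmul[OF Suc] linear_add[OF linear_pd] linear_cmul[OF linear_pd]
        linear_add[OF linear_xmul] linear_cmul[OF linear_xmul] scaleR_add_right sum.distrib scaleR_sum_right mult_ac)
qed

lemma psub_Pspace: "P \<in> Pspace m s k \<Longrightarrow> psub m R k P \<in> Pspace m s k"
proof (induction k arbitrary: P)
  case (Suc k)
  then have "psub m R k (pd l P) \<in> Pspace m s k" if "l < m" for l
    using pd_Pspace[OF that Suc.prems] by simp
  then show ?case by (auto intro!: Pspace_scale Pspace_sum xmul_Pspace)
qed simp

lemma pev_psub:
  fixes x :: "nat \<Rightarrow> 'a::real_field"
  shows "P \<in> Pspace m s k \<Longrightarrow> pev m k (psub m R k P) x = pev m k P (\<lambda>l. \<Sum>i<m. of_real (R l i) * x i)"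
proof (induction k arbitrary: P)
  case 0
  then show ?case by (simp add: pev_def mindices_0)
next
  case (Suc k)
  let ?y = "\<lambda>l. \<Sum>i<m. of_real (R l i) * x i"
  have IH: "pev m k (psub m R k (pd l P)) x = pev m k (pd l P) ?y" if "l < m" for l
    using Suc.IH[of "pd l P"] pd_Pspace[OF that Suc.prems] by simp
  have "pev m (Suc k) (psub m R (Suc k) P) x = csc (1 / of_nat (Suc k)) (\<Sum>l<m. \<Sum>i<m. csc (of_real (R l i) * x i) (pev m k (pd l P) ?y))"
    by (simp add: pev_scale pev_sum pev_xmul IH del: of_nat_Suc)
  also have "\<dots> = csc (1 / of_nat (Suc k)) (\<Sum>l<m. csc (?y l) (pev m k (pd l P) ?y))"
    by (simp add: csc_sum_left)
  also have "\<dots> = pev m (Suc k) P ?y"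
    by (simp add: pev_euler[OF Suc.prems, symmetric] del: of_nat_Suc)
  finally show ?case .
qed

lemma pd_xmul': "pd i (xmul j P) = xmul j (pd i P) + (if i = j then P else 0)"
  using pd_xmul[of i j P] by (auto simp: algebra_simps split: if_splits)

lemmas pdx_linear = linear_sum[OF linear_pd] linear_sum[OF linear_xmul] linear_cmul[OF linear_pd] linear_cmul[OF linear_xmul]
  linear_sum[OF linear_psub] linear_cmul[OF linear_psub]

text \<open>Chain rule, by induction along the recursion of \<open>psub\<close>: the derivative
  falls either on the inner polynomial or on the factor \<open>xmul\<close>.\<close>

lemma pd_psub:
  assumes i: "i < m"
  shows "P \<in> Pspace m s (Suc k) \<Longrightarrow> pd i (psub m R (Suc k) P) = (\<Sum>l<m. R l i *\<^sub>R psub m R k (pd l P))"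
proof (induction k arbitrary: P)
  case 0
  have "pd i (pd l P) = 0" if "l < m" for l using pd_Pspace_0[OF i] pd_Pspace[OF that 0] by simp
  then have "pd i (psub m R (Suc 0) P) = (\<Sum>l<m. \<Sum>j<m. if i = j then R l j *\<^sub>R pd l P else 0)"
    by (simp add: pdx_linear pd_xmul' linear_0 scaleR_add_right if_distrib[of "scaleR _"] cong: if_cong)
  then show ?case using i by simp
next
  case (Suc k)
  have IH: "pd i (psub m R (Suc k) (pd l P)) = (\<Sum>q<m. R q i *\<^sub>R psub m R k (pd q (pd l P)))" if "l < m" for l
    using Suc.IH[of "pd l P"] pd_Pspace[OF that Suc.prems] by simp
  have com: "pd q (pd l P) = pd l (pd q P)" for q l using pd_pd[of q l P] by simp
  have "(\<Sum>l<m. \<Sum>j<m. R l j *\<^sub>R xmul j (pd i (psub m R (Suc k) (pd l P))))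
    = (\<Sum>l<m. \<Sum>j<m. \<Sum>q<m. R q i *\<^sub>R R l j *\<^sub>R xmul j (psub m R k (pd l (pd q P))))"
    by (simp add: IH pdx_linear scaleR_sum_right com mult.commute del: psub.simps)
  also have "\<dots> = (\<Sum>l<m. \<Sum>q<m. \<Sum>j<m. R q i *\<^sub>R R l j *\<^sub>R xmul j (psub m R k (pd l (pd q P))))"
    by (intro sum.cong refl sum.swap)
  also have "\<dots> = (\<Sum>q<m. \<Sum>l<m. \<Sum>j<m. R q i *\<^sub>R R l j *\<^sub>R xmul j (psub m R k (pd l (pd q P))))"
    by (rule sum.swap)
  also have "\<dots> = (\<Sum>q<m. R q i *\<^sub>R real (Suc k) *\<^sub>R psub m R (Suc k) (pd q P))"
    by (simp add: scaleR_sum_right del: of_nat_Suc)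
  finally have 1: "(\<Sum>l<m. \<Sum>j<m. R l j *\<^sub>R xmul j (pd i (psub m R (Suc k) (pd l P))))
     = real (Suc k) *\<^sub>R (\<Sum>q<m. R q i *\<^sub>R psub m R (Suc k) (pd q P))"
    by (simp add: scaleR_sum_right mult.commute del: psub.simps of_nat_Suc)
  have "pd i (psub m R (Suc (Suc k)) P) = (1 / real (Suc (Suc k))) *\<^sub>R (\<Sum>l<m. \<Sum>j<m. R l j *\<^sub>R pd i (xmul j (psub m R (Suc k) (pd l P))))"
    by (subst psub.simps(2)) (simp only: pdx_linear)
  also have "(\<Sum>l<m. \<Sum>j<m. R l j *\<^sub>R pd i (xmul j (psub m R (Suc k) (pd l P))))
    = (\<Sum>l<m. \<Sum>j<m. R l j *\<^sub>R xmul j (pd i (psub m R (Suc k) (pd l P))))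
      + (\<Sum>l<m. \<Sum>j<m. if i = j then R l j *\<^sub>R psub m R (Suc k) (pd l P) else 0)"
    by (simp add: pd_xmul' scaleR_add_right sum.distrib if_distrib[of "scaleR _"] del: psub.simps cong: if_cong)
  \<comment> \<open>Differentiating the inner polynomials yields \<open>k + 1\<close> copies of the
    claimed sum by Euler's identity, and differentiating the factors \<open>xmul\<close> yields one
    more. The total \<open>k + 2\<close> cancels the prefactor.\<close>
  also have "\<dots> = real (Suc k) *\<^sub>R (\<Sum>q<m. R q i *\<^sub>R psub m R (Suc k) (pd q P)) + (\<Sum>q<m. R q i *\<^sub>R psub m R (Suc k) (pd q P))"
    using i by (simp add: 1 del: psub.simps of_nat_Suc)
  also have "\<dots> = real (Suc (Suc k)) *\<^sub>R (\<Sum>q<m. R q i *\<^sub>R psub m R (Suc k) (pd q P))"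
    by (simp only: of_nat_Suc scaleR_add_left scaleR_one add_ac)
  finally show ?case by (simp del: psub.simps of_nat_Suc)
qed

lemma psub_xmul:
  assumes "l < m" "P \<in> Pspace m s k"
  shows "psub m R (Suc k) (xmul l P) = (\<Sum>i<m. R l i *\<^sub>R xmul i (psub m R k P))"
proof (rule pev_inject[where s = s])
  show "psub m R (Suc k) (xmul l P) \<in> Pspace m s (Suc k)" using assms psub_Pspace xmul_Pspace by blast
  show "(\<Sum>i<m. R l i *\<^sub>R xmul i (psub m R k P)) \<in> Pspace m s (Suc k)"
    using assms psub_Pspace by (auto intro!: Pspace_intros xmul_Pspace)
  fix x :: "nat \<Rightarrow> real"
  show "pev m (Suc k) (psub m R (Suc k) (xmul l P)) x = pev m (Suc k) (\<Sum>i<m. R l i *\<^sub>R xmul i (psub m R k P)) x"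
    using assms(1)
    by (simp add: pev_xmul pev_sum pev_scale csc_sum_left pev_psub[OF xmul_Pspace[OF assms]] pev_psub[OF assms(2)]
        del: psub.simps)
qed

lemma pE_psub: "pE j (psub m R k P) = psub m R k (pE j P)"
  and pI_psub: "pI j (psub m R k P) = psub m R k (pI j P)"
  by (induction k arbitrary: P)
    (simp_all add: linear_sum[OF linear_pE] linear_cmul[OF linear_pE] pE_xmul pE_pd
      linear_sum[OF linear_pI] linear_cmul[OF linear_pI] pI_xmul pI_pd)

section \<open>Reflections of polynomials\<close>

definition pL :: "nat \<Rightarrow> (nat \<Rightarrow> real) \<Rightarrow> cpoly \<Rightarrow> cpoly" where
  "pL m u P = (\<lambda>\<alpha>. Lv m u (P \<alpha>))"

definition rmat :: "(nat \<Rightarrow> real) \<Rightarrow> nat \<Rightarrow> nat \<Rightarrow> real" where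
  "rmat u l i = (if l = i then 1 else 0) - 2 * u l * u i"

text \<open>The reflection acts on values and argument at once; being an involution, it needs no
  inverse in the argument.\<close>

definition prefl :: "nat \<Rightarrow> nat \<Rightarrow> (nat \<Rightarrow> real) \<Rightarrow> cpoly \<Rightarrow> cpoly" where
  "prefl m k u P = pL m u (psub m (rmat u) k P)"

lemma rmat_sum: "l < m \<Longrightarrow> (\<Sum>i<m. of_real (rmat u l i) * x i) = (rv m (\<lambda>j. of_real (u j)) x l :: 'a::real_field)"
proof -
  assume "l < m"
  then have "(\<Sum>i<m. of_real (rmat u l i) * x i) = (\<Sum>i<m. (if l = i then x i else 0) - 2 * of_real (u l) * (of_real (u i) * x i))"
    by (intro sum.cong) (auto simp: rmat_def algebra_simps)
  then show ?thesis using \<open>l < m\<close> by (simp add: sum_subtractf rv_def bil_def sum_distrib_left mult_ac)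
qed

lemma rmat_orth:
  assumes "bil m u u = 1" "l < m" "q < m"
  shows "(\<Sum>i<m. rmat u l i * rmat u q i) = (if l = q then 1 else 0)"
proof -
  have "(\<Sum>i<m. rmat u l i * rmat u q i) = rv m u (rmat u q) l"
    using rmat_sum[OF assms(2), of u "rmat u q"] by simp
  also have "bil m u (rmat u q) = - u q"
  proof -
    have "bil m u (rmat u q) = (\<Sum>i<m. (if q = i then u i else 0) - 2 * u q * (u i * u i))"
      unfolding bil_def by (intro sum.cong) (auto simp: rmat_def algebra_simps)
    also have "\<dots> = u q - 2 * u q * bil m u u"
      using assms(3) by (simp add: sum_subtractf bil_def sum_distrib_left)
    finally show ?thesis using assms(1) by simp
  qed
  then have "rv m u (rmat u q) l = rmat u q l + 2 * u q * u l" by (simp add: rv_def)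
  finally show ?thesis by (auto simp: rmat_def)
qed

lemma rmat_sym: "rmat u l i = rmat u i l" by (auto simp: rmat_def)

lemma pev_cong: "(\<And>j. j < m \<Longrightarrow> x j = y j) \<Longrightarrow> pev m k P x = pev m k P y"
  by (simp add: pev_def)

lemma of_real_ev: "of_real (ev m u v C) = ev m (\<lambda>j. of_real (u j)) (\<lambda>C. of_real (v C) :: 'a::real_field) C"
  and of_real_iv: "of_real (iv m u v C) = iv m (\<lambda>j. of_real (u j)) (\<lambda>C. of_real (v C) :: 'a) C"
  by (auto simp: ev_def iv_def csc_def ew_def iw_def fun_apply_simps intro!: sum.cong)

lemma pev_pL: "pev m k (pL m u P) x = Lv m (\<lambda>j. of_real (u j)) (pev m k P x)"
proof -
  have "pev m k Q x = (\<Sum>\<alpha>\<in>mindices m k. csc (\<Prod>j<m. x j ^ \<alpha> j) (\<lambda>A. of_real (Q \<alpha> A)))" for Q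
    by (simp add: pev_def csc_def fun_eq_iff fun_apply_simps)
  moreover have "(\<lambda>A. of_real (Lv m u v A)) = Lv m (\<lambda>j. of_real (u j) :: 'a) (\<lambda>A. of_real (v A))" for v
  proof -
    have "(\<lambda>C. of_real (iv m u v C)) = iv m (\<lambda>j. of_real (u j) :: 'a) (\<lambda>C. of_real (v C))"
      by (simp add: of_real_iv fun_eq_iff fun_apply_simps)
    then show ?thesis by (simp add: Lv_def csc_def of_real_ev fun_eq_iff fun_apply_simps)
  qed
  ultimately show ?thesis by (simp add: pL_def Lv_sum Lv_csc)
qed

lemma pev_refl:
  "P \<in> Pspace m s k \<Longrightarrow> pev m k (prefl m k u P) x =
    Lv m (\<lambda>j. of_real (u j)) (pev m k P (rv m (\<lambda>j. of_real (u j)) x))"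
  using pev_cong[of m "\<lambda>l. \<Sum>i<m. of_real (rmat u l i) * x i" "rv m (\<lambda>j. of_real (u j)) x" k P]
  by (simp add: prefl_def pev_pL pev_psub rmat_sum)

lemma pL_eq: "pL m u P = P - 2 *\<^sub>R (\<Sum>i<m. \<Sum>j<m. (u i * u j) *\<^sub>R pE i (pI j P))"
  by (simp add: pL_def Lv_def ev_iv_sum fun_eq_iff fun_apply_simps csc_def pE_def pI_def fun_apply_simps)

lemma linear_pL [simp]: "linear (pL m u)"
  by (rule linearI) (simp_all add: pL_eq linear_add[OF linear_pE] linear_cmul[OF linear_pE] linear_add[OF linear_pI]
      linear_cmul[OF linear_pI] scaleR_add_right sum.distrib scaleR_sum_right scaleR_diff_right mult_ac)

lemma pL_Pspace:
  assumes "P \<in> Pspace m s k" shows "pL m u P \<in> Pspace m s k"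
proof -
  have "pE i (pI j P) \<in> Pspace m s k" if "i < m" "j < m" for i j
    using pE_Pspace[OF that(1) pI_Pspace[OF that(2) assms]] pI_Pspace_0[of P] assms
    by (cases s) (auto simp: linear_0[OF linear_pE] Pspace_0)
  then show ?thesis unfolding pL_eq using assms by (auto intro!: Pspace_intros)
qed

lemma refl_Pspace: "P \<in> Pspace m s k \<Longrightarrow> prefl m k u P \<in> Pspace m s k"
  by (simp add: prefl_def pL_Pspace psub_Pspace)

lemma linear_refl [simp]: "linear (prefl m k u)"
  unfolding prefl_def using linear_compose[OF linear_psub linear_pL] by (simp add: o_def)

lemma ew_ev_unit: "l < m \<Longrightarrow> ew l v = ev m (\<lambda>j. if j = l then 1 else 0) v"
  and iw_iv_unit: "l < m \<Longrightarrow> iw l v = iv m (\<lambda>j. if j = l then 1 else 0) v"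
  by (simp_all add: ev_def iv_def if_distrib[of csc] if_distribR cong: if_cong)

lemma rv_unit: "l < m \<Longrightarrow> rv m u (\<lambda>j. if j = l then 1 else 0) j = rmat u l j"
  by (simp add: rv_def bil_def rmat_def if_distrib cong: if_cong)

lemma csc_scaleR: "csc c v = c *\<^sub>R (v :: nat set \<Rightarrow> real)" by (simp add: csc_def fun_eq_iff fun_apply_simps)

lemma pL_pE: "l < m \<Longrightarrow> pL m u (pE l P) = (\<Sum>j<m. rmat u l j *\<^sub>R pE j (pL m u P))"
  by (intro ext) (simp add: pL_def pE_def ew_ev_unit[of l m] Lv_ev ev_def[of m "rv _ _ _"] rv_unit csc_def fun_apply_simps)

lemma pL_pI: "l < m \<Longrightarrow> bil m u u = 1 \<Longrightarrow> pL m u (pI l P) = (\<Sum>j<m. rmat u l j *\<^sub>R pI j (pL m u P))"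
  by (intro ext) (simp add: pL_def pI_def iw_iv_unit[of l m] Lv_iv iv_def[of m "rv _ _ _"] rv_unit csc_def fun_apply_simps)

text \<open>The chain rule solved for the derivatives of \<open>P\<close>, by orthogonality of
  \<open>rmat u\<close>.\<close>

lemma psub_pd:
  assumes u: "bil m u u = 1" and l: "l < m" and P: "P \<in> Pspace m s k"
  shows "psub m (rmat u) (k - 1) (pd l P) = (\<Sum>i<m. rmat u l i *\<^sub>R pd i (psub m (rmat u) k P))"
proof (cases k)
  case 0
  then have "pd i P = 0" if "i < m" for i using pd_Pspace_0[OF that] P by blast
  then show ?thesis using 0 l by simp
next
  case (Suc n)
  have "(\<Sum>i<m. rmat u l i *\<^sub>R pd i (psub m (rmat u) k P))
     = (\<Sum>i<m. \<Sum>q<m. (rmat u l i * rmat u q i) *\<^sub>R psub m (rmat u) n (pd q P))"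
    using pd_psub[of _ m P s n "rmat u"] P Suc by (simp add: scaleR_sum_right del: psub.simps)
  also have "\<dots> = (\<Sum>q<m. (\<Sum>i<m. rmat u l i * rmat u q i) *\<^sub>R psub m (rmat u) n (pd q P))"
    by (subst sum.swap) (simp add: scaleR_sum_left)
  also have "\<dots> = (\<Sum>q<m. if l = q then psub m (rmat u) n (pd q P) else 0)"
    by (intro sum.cong) (auto simp: rmat_orth[OF u l])
  finally show ?thesis using Suc l by simp
qed

text \<open>Both families \<open>A\<close> and \<open>p\<close> transform by the same orthogonal
  matrix, so the contraction over the common index is invariant.\<close>

lemma refl_gop:
  assumes u: "bil m u u = 1" and lin: "\<And>j. linear (A j)" "\<And>j. linear (p j)"
    and A: "\<And>l P. l < m \<Longrightarrow> pL m u (A l P) = (\<Sum>j<m. rmat u l j *\<^sub>R A j (pL m u P))"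
    and As: "\<And>j P. A j (psub m (rmat u) k' P) = psub m (rmat u) k' (A j P)"
    and p: "\<And>l. l < m \<Longrightarrow> psub m (rmat u) k' (p l P) = (\<Sum>i<m. rmat u l i *\<^sub>R p i (psub m (rmat u) k P))"
    and pl: "\<And>j P. pL m u (p j P) = p j (pL m u P)"
  shows "prefl m k' u (gop m A p P) = gop m A p (prefl m k u P)"
proof -
  let ?Q = "\<lambda>j i. A j (p i (prefl m k u P))"
  have "prefl m k' u (gop m A p P) = (\<Sum>l<m. pL m u (A l (psub m (rmat u) k' (p l P))))"
    by (simp add: prefl_def gop_def linear_sum[OF linear_psub] linear_sum[OF linear_pL] As)
  also have "\<dots> = (\<Sum>l<m. \<Sum>i<m. \<Sum>j<m. (rmat u l i * rmat u l j) *\<^sub>R ?Q j i)"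
    by (simp add: A p linear_sum[OF lin(1)] linear_cmul[OF lin(1)] linear_sum[OF linear_pL] linear_cmul[OF linear_pL]
      scaleR_sum_right pl prefl_def As[symmetric])
  also have "\<dots> = (\<Sum>l<m. \<Sum>j<m. \<Sum>i<m. (rmat u l i * rmat u l j) *\<^sub>R ?Q j i)"
    by (intro sum.cong refl sum.swap)
  also have "\<dots> = (\<Sum>l<m. \<Sum>j<m. \<Sum>i<m. (rmat u l j * rmat u l i) *\<^sub>R ?Q j i)"
    by (simp add: mult.commute)
  also have "\<dots> = (\<Sum>j<m. \<Sum>l<m. \<Sum>i<m. (rmat u l j * rmat u l i) *\<^sub>R ?Q j i)"
    by (rule sum.swap)
  also have "\<dots> = (\<Sum>j<m. \<Sum>i<m. \<Sum>l<m. (rmat u l j * rmat u l i) *\<^sub>R ?Q j i)"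
    by (intro sum.cong refl sum.swap)
  also have "\<dots> = (\<Sum>j<m. \<Sum>i<m. (\<Sum>l<m. rmat u j l * rmat u i l) *\<^sub>R ?Q j i)"
    by (simp add: scaleR_sum_left rmat_sym[of u])
  also have "\<dots> = (\<Sum>j<m. \<Sum>i<m. if j = i then ?Q j i else 0)"
    by (intro sum.cong) (auto simp: rmat_orth[OF u])
  finally show ?thesis by (simp add: gop_def)
qed

lemma pL_pd: "pL m u (pd j P) = pd j (pL m u P)"
  by (simp add: pL_eq linear_diff[OF linear_pd] pdx_linear pE_pd pI_pd)
lemma pL_xmul: "pL m u (xmul j P) = xmul j (pL m u P)"
  by (simp add: pL_eq linear_diff[OF linear_xmul] pdx_linear pE_xmul pI_xmul)

context
  fixes m s k :: nat and u :: "nat \<Rightarrow> real" and P :: cpoly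
  assumes u: "bil m u u = 1" and P: "P \<in> Pspace m s k"
begin

lemma refl_oX: "prefl m (Suc k) u (oX m P) = oX m (prefl m k u P)"
  by (rule refl_gop[OF u]) (simp_all add: pL_pE pE_psub pL_xmul psub_xmul[OF _ P] del: psub.simps)

lemma refl_oJ: "prefl m (Suc k) u (oJ m P) = oJ m (prefl m k u P)"
  by (rule refl_gop[OF u]) (simp_all add: pL_pI[OF _ u] pI_psub pL_xmul psub_xmul[OF _ P] del: psub.simps)

lemma refl_oD: "prefl m (k - 1) u (oD m P) = oD m (prefl m k u P)"
  by (rule refl_gop[OF u]) (simp_all add: pL_pE pE_psub pL_pd psub_pd[OF u _ P, simplified] del: psub.simps)

lemma refl_oC: "prefl m (k - 1) u (oC m P) = oC m (prefl m k u P)"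
  by (rule refl_gop[OF u]) (simp_all add: pL_pI[OF _ u] pI_psub pL_pd psub_pd[OF u _ P, simplified] del: psub.simps)

end

lemma refl_HH: "bil m u u = 1 \<Longrightarrow> P \<in> HH m s k \<Longrightarrow> prefl m k u P \<in> HH m s k"
  using refl_oD[of m u P s k] refl_oC[of m u P s k] refl_Pspace[of P m s k u] linear_0[OF linear_refl]
  by (auto simp: HH_def)

section \<open>The action of the Pin group\<close>

lemma prod_sd:
  assumes "finite A" "finite D" "\<And>a. g a * g a = (1::real)"
  shows "prod g (sd A D) = prod g A * prod g D"
proof -
  have "prod g A = prod g (A - D) * prod g (A \<inter> D)"
    using assms by (subst prod.union_disjoint[symmetric]) (auto intro!: arg_cong[where f = "prod g"])
  moreover have "prod g D = prod g (D - A) * prod g (A \<inter> D)"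
    using assms by (subst prod.union_disjoint[symmetric]) (auto intro!: arg_cong[where f = "prod g"])
  moreover have "prod g (sd A D) = prod g (A - D) * prod g (D - A)"
    using assms by (subst prod.union_disjoint[symmetric]) auto
  moreover have "prod g (A \<inter> D) * prod g (A \<inter> D) = 1"
    by (simp add: prod.distrib[symmetric] assms)
  ultimately show ?thesis by (simp add: mult.assoc mult.left_commute)
qed

text \<open>The sign is multiplicative under symmetric differences in each argument, so both sides
  are the product of the signs of the pairs \<open>(A, B)\<close>, \<open>(D, B)\<close> and
  \<open>(A, D)\<close>.\<close>

lemma cl_sign_cocycle:
  assumes "finite A" "finite B" "finite D"
  shows "cl_sign (sd A D) B * cl_sign A D = cl_sign A (sd D B) * cl_sign D B"
proof -
  have 1: "cl_sign (sd A D) B = cl_sign A B * cl_sign D B"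
    using assms by (subst (1 2 3) cl_sign_prod) (auto intro!: prod_sd prod.neutral simp: prod.distrib[symmetric])
  have "cl_sign A (sd D B) = cl_sign A D * cl_sign A B"
    using assms by (subst (1 2 3) cl_sign_prod) (simp_all add: prod_sd prod.distrib)
  with 1 show ?thesis by simp
qed

lemma cl_mult_assoc: "cl_mult m (cl_mult m u v) w = cl_mult m u (cl_mult m v w)"
proof
  fix C
  show "cl_mult m (cl_mult m u v) w C = cl_mult m u (cl_mult m v w) C"
  proof (cases "C \<subseteq> {..<m}")
    case True
    \<comment> \<open>The index of the middle factor, determined by the outer two and by
      \<open>C\<close>.\<close>
    let ?D = "\<lambda>A B. sd A (sd B C)"
    have s: "sd B C \<subseteq> {..<m}" if "B \<in> Pow {..<m}" for B using that True by blast
    have "cl_mult m (cl_mult m u v) w C = (\<Sum>B\<in>Pow {..<m}. \<Sum>A\<in>Pow {..<m}.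
       cl_sign (sd B C) B * (cl_sign A (?D A B) * u A * v (?D A B)) * w B)"
      using True s by (simp only: cl_mult_eq'[of m "cl_mult m u v"] cl_mult_eq[of m u v] if_True sum_distrib_left sum_distrib_right
        cong: sum.cong)
    also have "\<dots> = (\<Sum>A\<in>Pow {..<m}. \<Sum>B\<in>Pow {..<m}.
       cl_sign (sd B C) B * (cl_sign A (?D A B) * u A * v (?D A B)) * w B)"
      by (rule sum.swap)
    also have "\<dots> = (\<Sum>A\<in>Pow {..<m}. \<Sum>B\<in>Pow {..<m}.
       cl_sign A (sd A C) * u A * (cl_sign (?D B A) B * v (?D B A) * w B))"
    proof (intro sum.cong refl)
      fix A B assume AB: "A \<in> Pow {..<m}" "B \<in> Pow {..<m}"
      have D: "?D B A = ?D A B" by blast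
      have "sd B C = sd A (?D A B)" "sd A C = sd (?D A B) B" by blast+
      moreover have "finite A" "finite B" "finite (?D A B)" using AB True
        by (auto intro: finite_subset[of _ "{..<m}"])
      ultimately have "cl_sign (sd B C) B * cl_sign A (?D A B) = cl_sign A (sd A C) * cl_sign (?D A B) B"
        using cl_sign_cocycle[of A B "?D A B"] by metis
      then show "cl_sign (sd B C) B * (cl_sign A (?D A B) * u A * v (?D A B)) * w B
         = cl_sign A (sd A C) * u A * (cl_sign (?D B A) B * v (?D B A) * w B)"
        unfolding D by algebra
    qed
    also have "\<dots> = cl_mult m u (cl_mult m v w) C"
      using True s by (simp only: cl_mult_eq[of m u] cl_mult_eq'[of m v] if_True sum_distrib_left sum_distrib_right
        cong: sum.cong)
    finally show ?thesis .
  qed (simp add: cl_mult_eq)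
qed

lemma supp_in_cl_mult: "supp_in m (cl_mult m u v)"
  by (auto simp: supp_in_def cl_mult_eq)

lemma cl_mult_one_right: assumes "supp_in m v" shows "cl_mult m v mv_one = v"
proof
  fix C
  show "cl_mult m v mv_one C = v C"
  proof (cases "C \<subseteq> {..<m}")
    case True
    have "cl_mult m v mv_one C = (\<Sum>B\<in>Pow {..<m}. if B = {} then cl_sign (sd B C) B * v (sd B C) else 0)"
      using True by (simp add: cl_mult_eq' mv_one_def if_distrib cong: if_cong)
    also have "\<dots> = v C" by (simp add: cl_sign_def)
    finally show ?thesis .
  qed (use assms in \<open>auto simp: cl_mult_eq supp_in_def\<close>)
qed

lemma cl_mult_one_left: assumes "supp_in m v" shows "cl_mult m mv_one v = v"
proof
  fix C
  show "cl_mult m mv_one v C = v C"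
  proof (cases "C \<subseteq> {..<m}")
    case True
    have "cl_mult m mv_one v C = (\<Sum>A\<in>Pow {..<m}. if A = {} then cl_sign A (sd A C) * v (sd A C) else 0)"
      using True by (simp add: cl_mult_eq mv_one_def if_distrib if_distribR cong: if_cong)
    also have "\<dots> = v C" by (simp add: cl_sign_def)
    finally show ?thesis .
  qed (use assms in \<open>auto simp: cl_mult_eq supp_in_def\<close>)
qed

lemma cl_mult_neg_left: "cl_mult m (mv_neg u) v = - cl_mult m u v"
  and cl_mult_neg_right: "cl_mult m u (mv_neg v) = - cl_mult m u v"
  by (auto simp: cl_mult_eq mv_neg_def sum_negf fun_eq_iff fun_apply_simps)

lemma cl_mult_uminus_right: "cl_mult m u (- v) = - cl_mult m u v"
  by (auto simp: cl_mult_eq sum_negf fun_eq_iff fun_apply_simps)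

definition vc :: "mvec \<Rightarrow> nat \<Rightarrow> real" where "vc u = (\<lambda>j. u {j})"

lemma svec_neg: "svec m s u \<Longrightarrow> svec m s (mv_neg u)"
  by (auto simp: svec_def mv_neg_def)

text \<open>With \<open>E\<close> and \<open>I\<close> exterior and interior multiplication by
  \<open>u\<close>, the product is governed by
  \<open>(E - I) (E + I) = E I - I E = 2 E I - 1\<close>, since the squares vanish and
  \<open>E I + I E = 1\<close>. The inverse of \<open>u\<close> is \<open>mv_neg u\<close>.\<close>

lemma cl_sandwich:
  assumes u: "svec m 1 u" "bil m (vc u) (vc u) = 1" and v: "svec m s v"
  shows "cl_mult m u (cl_mult m v (mv_neg u)) = (-1) ^ s *\<^sub>R Lv m (vc u) v"
proof -
  let ?E = "ev m (vc u)" and ?I = "iv m (vc u)"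
  have vu: "cl_mult m v u = csc ((-1) ^ s) (?E v + ?I v)"
    unfolding cl_mult_vec_right[OF u(1) v] by (simp add: ev_def iv_def csc_scaleR sum.distrib vc_def scaleR_add_right)
  have "cl_mult m u (cl_mult m v u) = ?E (cl_mult m v u) - ?I (cl_mult m v u)"
    unfolding cl_mult_vec_left[OF u(1) supp_in_cl_mult]
    by (simp add: ev_def iv_def csc_scaleR sum_subtractf vc_def scaleR_diff_right)
  also have "\<dots> = csc ((-1) ^ s) (?E (?I v) - ?I (?E v))"
    by (simp add: vu ev_csc iv_csc ev_add iv_add csc_diff)
  also have "?E (?I v) - ?I (?E v) = - Lv m (vc u) v"
    by (simp add: Lv_def iv_ev u(2)) (simp add: csc_def fun_eq_iff fun_apply_simps)
  finally show ?thesis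
    by (simp only: cl_mult_neg_right cl_mult_uminus_right csc_neg csc_scaleR scaleR_minus_right minus_minus)
qed

text \<open>As an exterior product with \<open>1\<close>, a vector is transformed by
  \<open>Lv_ev\<close>.\<close>

lemma xvec_ev: "xvec m x = ev m x mv_one"
proof
  fix A
  have "(if A = {j} then x j else 0) = csc (x j) (ew j mv_one) A" for j
  proof (cases "A = {j}")
    case True
    then have e: "{b \<in> A. b < j} = {}" by auto
    have "sg j A = (1::real)" by (simp only: sg_def e card.empty power_0)
    then show ?thesis using True by (simp add: csc_def ew_def mv_one_def)
  next
    case False
    then have "j \<in> A \<Longrightarrow> A - {j} \<noteq> {}" by blast
    then show ?thesis using False by (simp add: csc_def ew_def mv_one_def)
  qed
  then show "xvec m x A = ev m x mv_one A" by (simp add: xvec_def ev_def fun_apply_simps)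
qed

lemma iv_one: "iv m u mv_one = 0"
  by (auto simp: iv_def iw_def mv_one_def csc_def fun_eq_iff fun_apply_simps intro!: sum.neutral)

lemma Lv_xvec: "Lv m u (xvec m x) = xvec m (rv m u x)"
proof -
  have "Lv m u mv_one = mv_one" by (simp add: Lv_def iv_one)
  then show ?thesis unfolding xvec_ev Lv_ev by simp
qed

lemma svec_xvec: "svec m 1 (xvec m x)"
  unfolding svec_def xvec_def
proof (intro allI impI)
  fix A assume *: "(\<Sum>j<m. if A = {j} then x j else 0) \<noteq> 0"
  have "\<exists>j<m. A = {j}"
  proof (rule ccontr)
    assume "\<not> (\<exists>j<m. A = {j})"
    then have "(\<Sum>j<m. if A = {j} then x j else 0) = 0" by (intro sum.neutral) auto
    with * show False by simp
  qed
  then obtain j where "j < m" "A = {j}" by blast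
  then show "A \<subseteq> {..<m} \<and> card A = 1" by simp
qed

lemma xvec_coord: "xvec m x {j} = (if j < m then x j else 0)"
proof -
  have "xvec m x {j} = (\<Sum>i<m. if j = i then x i else 0)" by (auto simp: xvec_def intro!: sum.cong)
  then show ?thesis by simp
qed

lemma xvec_cong: "(\<And>j. j < m \<Longrightarrow> x j = y j) \<Longrightarrow> xvec m x = xvec m y"
  by (auto simp: xvec_def intro!: sum.cong)

lemma pev_homogeneous: "pev m k P (\<lambda>j. c * x j) = csc (c ^ k) (pev m k P x)"
proof -
  have "(\<Prod>j<m. (c * x j) ^ \<alpha> j) = c ^ k * (\<Prod>j<m. x j ^ \<alpha> j)" if "\<alpha> \<in> mindices m k" for \<alpha>
    using that by (simp add: power_mult_distrib prod.distrib power_sum[symmetric] mindices_def)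
  then show ?thesis by (simp add: pev_def csc_def sum_distrib_left mult.assoc)
qed

lemma svec_pev: "P \<in> Pspace m s k \<Longrightarrow> svec m s (pev m k P x :: nat set \<Rightarrow> real)"
  unfolding svec_def pev_def Pspace_iff by (metis (no_types, lifting) mult_eq_0_iff of_real_0 sum.neutral)

lemma xvec_neg: "xvec m (\<lambda>j. - x j) = - xvec m x"
  unfolding xvec_def fun_eq_iff fun_apply_simps sum_negf[symmetric] by (auto intro!: sum.cong)

context
  fixes m :: nat and u :: mvec
  assumes u: "svec m 1 u" "bil m (vc u) (vc u) = 1"
begin

lemma pin_single: "pin_elem m [u] = u" "pin_inv m [u] = mv_neg u"
  using u svec_neg[of m 1 u] by (simp_all add: pin_elem_def pin_inv_def cl_mult_one_right cl_mult_one_left svec_supp_in)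

lemma conj_xvec: "cl_mult m (mv_neg u) (cl_mult m (xvec m x) u) = xvec m (\<lambda>j. - rv m (vc u) x j)"
  using cl_sandwich[OF u svec_xvec, of x]
  by (simp add: cl_mult_neg_left cl_mult_neg_right cl_mult_uminus_right Lv_xvec xvec_neg csc_scaleR)

text \<open>The sign has two sources: \<open>(-1) ^ s\<close> from conjugating the value, and
  \<open>(-1) ^ k\<close> from the argument, which is conjugated to minus its reflection.\<close>

lemma Hact_single:
  assumes P: "P \<in> Pspace m s k"
  shows "Hact m [u] (pev m k P) = pev m k ((-1) ^ (s + k) *\<^sub>R prefl m k (vc u) P)"
proof
  fix x
  have arg: "pev m k P (\<lambda>j. cl_mult m (mv_neg u) (cl_mult m (xvec m x) u) {j})
     = csc ((-1) ^ k) (pev m k P (rv m (vc u) x))"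
    by (subst pev_homogeneous[symmetric], rule pev_cong) (simp add: conj_xvec xvec_coord)
  have "svec m s (csc ((-1) ^ k) (pev m k P (rv m (vc u) x)))"
    using svec_pev[OF P] by (simp add: csc_def svec_def)
  from cl_sandwich[OF u this]
  have "Hact m [u] (pev m k P) x = (-1) ^ s *\<^sub>R Lv m (vc u) (csc ((-1) ^ k) (pev m k P (rv m (vc u) x)))"
    by (simp add: Hact_def pin_single cl_mult_assoc arg)
  then show "Hact m [u] (pev m k P) x = pev m k ((-1) ^ (s + k) *\<^sub>R prefl m k (vc u) P) x"
    using pev_refl[OF P, of "vc u" x] by (simp add: pev_scale Lv_csc power_add) (simp add: csc_scaleR)
qed

lemma Hact_Cons: "Hact m (u # us) f = Hact m [u] (Hact m us f)"
proof
  fix x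
  let ?y = "\<lambda>j. cl_mult m (mv_neg u) (cl_mult m (xvec m x) u) {j}"
  have "xvec m ?y = xvec m (\<lambda>j. - rv m (vc u) x j)"
    by (rule xvec_cong) (simp add: conj_xvec xvec_coord)
  \<comment> \<open>\<open>Hact\<close> only reads coordinates of the conjugated argument; nothing
    is lost, because that argument is again a vector.\<close>
  then have y: "xvec m ?y = cl_mult m (mv_neg u) (cl_mult m (xvec m x) u)" by (simp add: conj_xvec)
  have "pin_elem m (u # us) = cl_mult m u (pin_elem m us)" "pin_inv m (u # us) = cl_mult m (pin_inv m us) (mv_neg u)"
    by (simp_all add: pin_elem_def pin_inv_def)
  then show "Hact m (u # us) f x = Hact m [u] (Hact m us f) x"
    unfolding Hact_def pin_single cl_mult_assoc y by (simp add: cl_mult_assoc)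
qed

end

lemma unit_vecs_Cons: "unit_vecs m (u # us) \<longleftrightarrow> (svec m 1 u \<and> bil m (vc u) (vc u) = 1) \<and> unit_vecs m us"
  by (auto simp: unit_vecs_def bil_def vc_def power2_eq_square)

lemma Hact_Nil:
  assumes P: "P \<in> Pspace m s k" shows "Hact m [] (pev m k P) = pev m k P"
proof
  fix x
  have *: "cl_mult m (cl_mult m mv_one (xvec m x)) mv_one = xvec m x"
    using svec_supp_in[OF svec_xvec, of m x] by (simp add: cl_mult_one_left cl_mult_one_right)
  have "pev m k P (\<lambda>j. xvec m x {j}) = pev m k P x" by (rule pev_cong) (simp add: xvec_coord)
  then show "Hact m [] (pev m k P) x = pev m k P x"
    using svec_supp_in[OF svec_pev[OF P, of x]]
    by (simp add: Hact_def pin_elem_def pin_inv_def * cl_mult_one_left cl_mult_one_right)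
qed

text \<open>Coordinates from \<open>m\<close> on are set to zero so that \<open>vc\<close> and
  \<open>xvec\<close> match these functions with unit vectors of the algebra.\<close>

definition uvec :: "nat \<Rightarrow> (nat \<Rightarrow> real) \<Rightarrow> bool" where
  "uvec m u \<longleftrightarrow> bil m u u = 1 \<and> (\<forall>j\<ge>m. u j = 0)"

definition refl_closed :: "nat \<Rightarrow> nat \<Rightarrow> cpoly set \<Rightarrow> bool" where
  "refl_closed m k W \<longleftrightarrow> (\<forall>u P. uvec m u \<and> P \<in> W \<longrightarrow> prefl m k u P \<in> W)"

lemma uvec_vc: "svec m 1 u \<Longrightarrow> bil m (vc u) (vc u) = 1 \<Longrightarrow> uvec m (vc u)"
  by (auto simp: uvec_def vc_def svec_def)

lemma vc_xvec: "uvec m u \<Longrightarrow> vc (xvec m u) = u"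
  by (auto simp: vc_def xvec_coord uvec_def fun_eq_iff)

lemma psubspace_eq: "psubspace V \<longleftrightarrow> subspace V"
  by (auto simp: psubspace_def subspace_def pzero_eq padd_eq pscale_eq)

lemma neg_one_power_scale: "subspace W \<Longrightarrow> (-1) ^ n *\<^sub>R P \<in> W \<longleftrightarrow> P \<in> W"
  using subspace_neg[of W P] subspace_neg[of W "- P"] by (cases "even n") auto

lemma unit_vecs_single: "uvec m u \<Longrightarrow> unit_vecs m [xvec m u]"
  using svec_xvec[of m u] vc_xvec[of m u] by (auto simp: unit_vecs_Cons uvec_def) (simp add: unit_vecs_def)

lemma Hact_uvec:
  assumes "uvec m u" "P \<in> Pspace m s k"
  shows "Hact m [xvec m u] (pev m k P) = pev m k ((-1) ^ (s + k) *\<^sub>R prefl m k u P)"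
  using Hact_single[OF _ _ assms(2), of "xvec m u"] assms svec_xvec[of m u] vc_xvec[of m u]
  by (simp add: uvec_def)

text \<open>\<open>Hact\<close> is multiplicative in the list of factors, so single unit vectors
  suffice, and the sign in \<open>Hact_single\<close> does not leave a subspace.\<close>

lemma H_invariant_iff:
  assumes W: "subspace W" "W \<subseteq> Pspace m s k"
  shows "H_invariant m k W \<longleftrightarrow> refl_closed m k W"
proof
  assume inv: "H_invariant m k W"
  show "refl_closed m k W" unfolding refl_closed_def
  proof safe
    fix u P assume u: "uvec m u" and P: "P \<in> W"
    let ?R = "(-1) ^ (s + k) *\<^sub>R prefl m k u P"
    have PP: "P \<in> Pspace m s k" using P W by blast
    obtain Q where Q: "Q \<in> W" "pev m k Q = (pev m k ?R :: (nat \<Rightarrow> real) \<Rightarrow> mvec)"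
      using inv[unfolded H_invariant_def peval_pev, rule_format, OF conjI[OF unit_vecs_single[OF u] P]]
        Hact_uvec[OF u PP] by auto
    have "Q = ?R"
      by (rule pev_inject[of _ m s k]) (use Q W PP in \<open>auto intro!: Pspace_scale refl_Pspace\<close>)
    then show "prefl m k u P \<in> W" using Q(1) neg_one_power_scale[OF W(1)] by metis
  qed
next
  assume inv: "refl_closed m k W"
  have "\<exists>Q\<in>W. pev m k Q = Hact m us (pev m k P)" if "unit_vecs m us" "P \<in> W" for us P
    using that
  proof (induction us)
    case Nil
    have "Hact m [] (pev m k P) = pev m k P" by (rule Hact_Nil[of P m s k]) (use Nil W in blast)
    then show ?case by (intro bexI[of _ P]) (use Nil in simp_all)
  next
    case (Cons u us)
    then obtain Q where Q: "Q \<in> W" "pev m k Q = Hact m us (pev m k P)" by (auto simp: unit_vecs_Cons)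
    have u: "svec m 1 u" "bil m (vc u) (vc u) = 1" using Cons.prems by (auto simp: unit_vecs_Cons)
    have QP: "Q \<in> Pspace m s k" using Q W by blast
    have "Hact m (u # us) (pev m k P) = pev m k ((-1) ^ (s + k) *\<^sub>R prefl m k (vc u) Q)"
      unfolding Hact_Cons[OF u, of us "pev m k P"] Q(2)[symmetric] by (rule Hact_single[OF u QP])
    moreover have "(-1) ^ (s + k) *\<^sub>R prefl m k (vc u) Q \<in> W"
      using inv Q uvec_vc[OF u] neg_one_power_scale[OF W(1)] by (auto simp: refl_closed_def)
    ultimately show ?case by (intro bexI[of _ "(-1) ^ (s + k) *\<^sub>R prefl m k (vc u) Q"]) simp_all
  qed
  then show "H_invariant m k W" unfolding H_invariant_def peval_pev by blast
qed

lemma H_equivalentE: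
  assumes "H_equivalent m k V W" "subspace V" "V \<subseteq> Pspace m s k" "W \<subseteq> Pspace m s k" "refl_closed m k V" "refl_closed m k W"
  obtains T where "bij_betw T V W" "\<And>P Q. P \<in> V \<Longrightarrow> Q \<in> V \<Longrightarrow> T (P + Q) = T P + T Q"
    "\<And>c P. P \<in> V \<Longrightarrow> T (c *\<^sub>R P) = c *\<^sub>R T P" "\<And>u P. uvec m u \<Longrightarrow> P \<in> V \<Longrightarrow> T (prefl m k u P) = prefl m k u (T P)"
proof -
  from assms(1) obtain T where T: "bij_betw T V W" "\<And>P Q. P \<in> V \<Longrightarrow> Q \<in> V \<Longrightarrow> T (P + Q) = T P + T Q"
    "\<And>c P. P \<in> V \<Longrightarrow> T (c *\<^sub>R P) = c *\<^sub>R T P" and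
    act: "\<And>us P Q. unit_vecs m us \<Longrightarrow> P \<in> V \<Longrightarrow> Q \<in> V \<Longrightarrow> pev m k Q = Hact m us (pev m k P)
         \<Longrightarrow> pev m k (T Q) = Hact m us (pev m k (T P))"
    unfolding H_equivalent_def padd_eq pscale_eq peval_pev by blast
  have "T (prefl m k u P) = prefl m k u (T P)" if u: "uvec m u" and P: "P \<in> V" for u P
  proof -
    \<comment> \<open>The action on \<open>V\<close> and on \<open>W\<close> carries the same sign,
      so it cancels by homogeneity of \<open>T\<close>.\<close>
    let ?c = "(-1) ^ (s + k) :: real"
    have TP: "T P \<in> W" using T(1) P by (auto simp: bij_betw_def)
    have R: "prefl m k u P \<in> V" using assms(5) u P by (auto simp: refl_closed_def)
    then have R': "?c *\<^sub>R prefl m k u P \<in> V" using assms(2) by (simp add: subspace_scale)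
    have "pev m k (T (?c *\<^sub>R prefl m k u P)) = Hact m [xvec m u] (pev m k (T P))"
      by (rule act[OF unit_vecs_single[OF u] P R']) (use Hact_uvec[OF u, of P s k] P assms(3) in auto)
    also have "\<dots> = pev m k (?c *\<^sub>R prefl m k u (T P))"
      using Hact_uvec[OF u, of "T P" s k] TP assms(4) by auto
    finally have "T (?c *\<^sub>R prefl m k u P) = ?c *\<^sub>R prefl m k u (T P)"
      using T(1) R' TP assms(4)
      by (intro pev_inject[of _ m s k]) (auto simp: bij_betw_def intro!: Pspace_scale refl_Pspace)
    then show ?thesis using T(3)[OF R] by simp
  qed
  then show ?thesis using that T by metis
qed

section \<open>The Fischer inner product\<close>

text \<open>The factorials make \<open>xmul j\<close> adjoint to \<open>pd j\<close>; orthonormality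
  of the index sets makes \<open>pE j\<close> adjoint to \<open>pI j\<close>.\<close>

definition ip :: "nat \<Rightarrow> nat \<Rightarrow> cpoly \<Rightarrow> cpoly \<Rightarrow> real" where
  "ip m k P Q = (\<Sum>\<alpha>\<in>mindices m k. (\<Prod>j<m. fact (\<alpha> j)) * (\<Sum>A\<in>Pow {..<m}. P \<alpha> A * Q \<alpha> A))"

lemma ip_commute: "ip m k P Q = ip m k Q P"
  by (simp add: ip_def mult.commute)

lemma ip_add_left: "ip m k (P + P') Q = ip m k P Q + ip m k P' Q"
  and ip_scale_left: "ip m k (c *\<^sub>R P) Q = c * ip m k P Q"
  and ip_diff_left: "ip m k (P - P') Q = ip m k P Q - ip m k P' Q"
  and ip_0_left [simp]: "ip m k 0 Q = 0"
  by (simp_all add: ip_def fun_apply_simps algebra_simps sum.distrib sum_subtractf sum_distrib_left)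

lemma ip_sum_left: "ip m k (sum f S) Q = (\<Sum>i\<in>S. ip m k (f i) Q)"
  by (induction S rule: infinite_finite_induct) (simp_all add: ip_add_left)

lemma ip_add_right: "ip m k Q (P + P') = ip m k Q P + ip m k Q P'"
  and ip_scale_right: "ip m k Q (c *\<^sub>R P) = c * ip m k Q P"
  and ip_diff_right: "ip m k Q (P - P') = ip m k Q P - ip m k Q P'"
  and ip_0_right [simp]: "ip m k Q 0 = 0"
  and ip_sum_right: "ip m k Q (sum f S) = (\<Sum>i\<in>S. ip m k Q (f i))"
  by (simp_all add: ip_commute[of m k Q] ip_add_left ip_scale_left ip_diff_left ip_sum_left)

lemma ip_definite:
  assumes "P \<in> Pspace m s k" "ip m k P P = 0" shows "P = 0"
proof -
  have *: "(\<Prod>j<m. fact (\<alpha> j)) * (\<Sum>A\<in>Pow {..<m}. P \<alpha> A * P \<alpha> A) = 0" if "\<alpha> \<in> mindices m k" for \<alpha>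
    using assms(2) that unfolding ip_def
    by (subst (asm) sum_nonneg_eq_0_iff) (auto intro!: mult_nonneg_nonneg[OF prod_nonneg] sum_nonneg)
  have "P \<alpha> A = 0" for \<alpha> A
  proof (rule ccontr)
    assume ne: "P \<alpha> A \<noteq> 0"
    then have A: "\<alpha> \<in> mindices m k" "A \<in> Pow {..<m}" using assms(1) by (auto simp: Pspace_iff)
    have "(\<Sum>A\<in>Pow {..<m}. P \<alpha> A * P \<alpha> A) = 0" using *[OF A(1)] by simp
    then have "P \<alpha> A * P \<alpha> A = 0" using A(2) by (subst (asm) sum_nonneg_eq_0_iff) auto
    then show False using ne by simp
  qed
  then show ?thesis by (simp add: fun_eq_iff fun_apply_simps)
qed

lemma ip_xmul:
  assumes "j < m" shows "ip m (Suc k) (xmul j P) Q = ip m k P (pd j Q)"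
proof -
  have f: "(\<Prod>i<m. fact ((\<alpha>(j := Suc (\<alpha> j))) i)) = real (Suc (\<alpha> j)) * (\<Prod>i<m. fact (\<alpha> i))" for \<alpha>
  proof -
    have "(\<Prod>i<m. fact ((\<alpha>(j := Suc (\<alpha> j))) i)) = (fact (Suc (\<alpha> j)) :: real) * (\<Prod>i\<in>{..<m} - {j}. fact (\<alpha> i))"
      using assms by (subst prod.remove[of "{..<m}" j]) auto
    moreover have "(\<Prod>i<m. fact (\<alpha> i)) = (fact (\<alpha> j) :: real) * (\<Prod>i\<in>{..<m} - {j}. fact (\<alpha> i))"
      using assms by (subst prod.remove[of "{..<m}" j]) auto
    ultimately show ?thesis by simp
  qed
  show ?thesis unfolding ip_def
    apply (subst sum_mindices_Suc[OF assms])
     apply (simp add: xmul_eq fun_apply_simps)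
    apply (rule sum.cong[OF refl])
    apply (simp only: f sum_distrib_left)
    apply (rule sum.cong[OF refl])
    apply (simp add: xmul_eq pd_eq fun_apply_simps mult_ac)
    done
qed

lemma ip_pE:
  assumes "j < m" shows "ip m k (pE j P) Q = ip m k P (pI j Q)"
proof -
  have "(\<Sum>A\<in>Pow {..<m}. ew j v A * w A) = (\<Sum>A\<in>Pow {..<m}. v A * iw j w A)" for v w :: mvec
  proof -
    have "(\<Sum>A\<in>Pow {..<m}. ew j v A * w A) = (\<Sum>A\<in>{A \<in> Pow {..<m}. j \<in> A}. sg j A * v (A - {j}) * w A)"
      by (rule sum.mono_neutral_cong_right) (auto simp: ew_def)
    also have "\<dots> = (\<Sum>A\<in>{A \<in> Pow {..<m}. j \<notin> A}. sg j A * v A * w (insert j A))"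
      by (rule sum.reindex_bij_witness[of _ "insert j" "\<lambda>A. A - {j}"])
        (use assms in \<open>auto simp: insert_absorb sg_remove\<close>)
    also have "\<dots> = (\<Sum>A\<in>Pow {..<m}. v A * iw j w A)"
      by (rule sum.mono_neutral_cong_left) (auto simp: iw_def)
    finally show ?thesis .
  qed
  then show ?thesis by (simp add: ip_def pE_def pI_def)
qed

lemma ip_pL: "ip m k (pL m u P) Q = ip m k P (pL m u Q)"
proof -
  have "(\<Sum>i<m. \<Sum>j<m. u i * u j * ip m k (pE i (pI j P)) Q) = (\<Sum>i<m. \<Sum>j<m. u i * u j * ip m k P (pE j (pI i Q)))"
    by (intro sum.cong refl) (simp add: ip_pE ip_commute[of m k _ "pI _ Q"] ip_commute[of m k _ "pE _ _"])
  also have "\<dots> = (\<Sum>i<m. \<Sum>j<m. u j * u i * ip m k P (pE i (pI j Q)))" by (rule sum.swap)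
  finally show ?thesis
    by (simp add: pL_eq ip_diff_left ip_diff_right ip_scale_left ip_scale_right ip_sum_left ip_sum_right mult.commute)
qed

lemma ip_euler:
  assumes "P \<in> Pspace m s (Suc k)"
  shows "real (Suc k) * ip m (Suc k) P Q = (\<Sum>j<m. ip m k (pd j P) (pd j Q))"
proof -
  have "real (Suc k) * ip m (Suc k) P Q = ip m (Suc k) (euler m P) Q"
    by (simp only: euler_Pspace[OF assms] ip_scale_left)
  then show ?thesis by (simp add: euler_def ip_sum_left ip_xmul)
qed

text \<open>Induction by \<open>ip_euler\<close>, which reduces the product to derivatives: the
  chain rule produces products of matrix entries that collapse by orthogonality.\<close>

lemma ip_psub:
  assumes u: "bil m u u = 1"
  shows "P \<in> Pspace m s k \<Longrightarrow> Q \<in> Pspace m s k \<Longrightarrow> ip m k (psub m (rmat u) k P) (psub m (rmat u) k Q) = ip m k P Q"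
proof (induction k arbitrary: P Q)
  case (Suc k)
  let ?S = "psub m (rmat u)"
  have S: "?S (Suc k) P \<in> Pspace m s (Suc k)" using psub_Pspace[OF Suc.prems(1)] .
  have "real (Suc k) * ip m (Suc k) (?S (Suc k) P) (?S (Suc k) Q)
     = (\<Sum>i<m. ip m k (pd i (?S (Suc k) P)) (pd i (?S (Suc k) Q)))" by (rule ip_euler[OF S])
  also have "\<dots> = (\<Sum>i<m. \<Sum>l<m. \<Sum>q<m. (rmat u l i * rmat u q i) * ip m k (?S k (pd q P)) (?S k (pd l Q)))"
    by (simp add: pd_psub[OF _ Suc.prems(1)] pd_psub[OF _ Suc.prems(2)] ip_sum_left ip_sum_right ip_scale_left
        ip_scale_right sum_distrib_left mult_ac del: psub.simps)
  also have "\<dots> = (\<Sum>l<m. \<Sum>i<m. \<Sum>q<m. (rmat u l i * rmat u q i) * ip m k (?S k (pd q P)) (?S k (pd l Q)))"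
    by (rule sum.swap)
  also have "\<dots> = (\<Sum>l<m. \<Sum>q<m. \<Sum>i<m. (rmat u l i * rmat u q i) * ip m k (?S k (pd q P)) (?S k (pd l Q)))"
    by (intro sum.cong refl sum.swap)
  also have "\<dots> = (\<Sum>l<m. \<Sum>q<m. (\<Sum>i<m. rmat u l i * rmat u q i) * ip m k (?S k (pd q P)) (?S k (pd l Q)))"
    by (simp add: sum_distrib_right)
  also have "\<dots> = (\<Sum>l<m. \<Sum>q<m. if l = q then ip m k (?S k (pd q P)) (?S k (pd l Q)) else 0)"
    by (intro sum.cong refl) (simp add: rmat_orth[OF u])
  also have "\<dots> = (\<Sum>l<m. ip m k (pd l P) (pd l Q))"
  proof -
    have "ip m k (?S k (pd l P)) (?S k (pd l Q)) = ip m k (pd l P) (pd l Q)" if "l < m" for l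
      using Suc.IH[of "pd l P" "pd l Q"] pd_Pspace[OF that Suc.prems(1)] pd_Pspace[OF that Suc.prems(2)] by simp
    then show ?thesis by simp
  qed
  also have "\<dots> = real (Suc k) * ip m (Suc k) P Q" by (rule ip_euler[OF Suc.prems(1), symmetric])
  finally show ?case by (simp del: psub.simps of_nat_Suc)
qed simp

lemma rv_rv: "bil m u u = 1 \<Longrightarrow> rv m u (rv m u x) = (x :: nat \<Rightarrow> 'a::real_field)"
proof -
  assume u: "bil m u u = 1"
  have "bil m u (rv m u x) = (\<Sum>j<m. u j * x j - 2 * bil m u x * (u j * u j))"
    unfolding bil_def[of m u "rv m u x"] by (simp add: rv_def algebra_simps)
  also have "\<dots> = bil m u x - 2 * bil m u x * bil m u u"
    unfolding sum_subtractf sum_distrib_left[symmetric] bil_def[symmetric] ..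
  finally have "bil m u (rv m u x) = bil m u x - 2 * bil m u x * bil m u u" .
  then have "bil m u (rv m u x) = - bil m u x" using u by simp
  then show ?thesis by (simp add: rv_def[of m u "rv m u x"]) (simp add: rv_def fun_eq_iff)
qed

lemma bil_of_real: "bil m (\<lambda>j. of_real (u j)) (\<lambda>j. of_real (v j)) = of_real (bil m u v)"
  by (simp add: bil_def)

lemma refl_refl:
  assumes u: "bil m u u = 1" and P: "P \<in> Pspace m s k"
  shows "prefl m k u (prefl m k u P) = P"
  by (rule pev_inject[OF refl_Pspace[OF refl_Pspace[OF P]] P])
    (simp add: pev_refl[OF refl_Pspace[OF P]] pev_refl[OF P] rv_rv[OF u] Lv_Lv[OF u])

lemma ip_refl:
  assumes u: "bil m u u = 1" and P: "P \<in> Pspace m s k" "Q \<in> Pspace m s k"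
  shows "ip m k (prefl m k u P) (prefl m k u Q) = ip m k P Q"
proof -
  have "pL m u (pL m u P) = P" for P using Lv_Lv[OF u] by (simp add: pL_def)
  then show ?thesis by (simp add: prefl_def ip_pL ip_psub[OF u P])
qed

text \<open>Consequently a harmonic polynomial in the range of \<open>rsq\<close> is orthogonal to
  itself.\<close>

lemma ip_lap: "ip m (Suc (Suc k)) (rsq m C) Z = ip m k C (lap m Z)"
  by (simp add: rsq_def lap_eq ip_sum_left ip_sum_right ip_xmul)

section \<open>Orthogonal projection onto a subspace\<close>

lemma Pspace_finite_span: "\<exists>B. finite B \<and> Pspace m s k \<subseteq> span B"
proof -
  define e where "e \<alpha> A = (\<lambda>\<beta> B. if \<beta> = \<alpha> \<and> B = A then 1 else 0 :: real)" for \<alpha> :: mindex and A :: "nat set"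
  let ?B = "(\<lambda>(\<alpha>, A). e \<alpha> A) ` (mindices m k \<times> Pow {..<m})"
  have "P \<in> span ?B" if P: "P \<in> Pspace m s k" for P
  proof -
    have "P = (\<Sum>\<alpha>\<in>mindices m k. \<Sum>A\<in>Pow {..<m}. P \<alpha> A *\<^sub>R e \<alpha> A)"
    proof (intro ext)
      fix \<beta> B
      have "(\<Sum>\<alpha>\<in>mindices m k. \<Sum>A\<in>Pow {..<m}. P \<alpha> A *\<^sub>R e \<alpha> A) \<beta> B
        = (\<Sum>\<alpha>\<in>mindices m k. if \<beta> = \<alpha> then \<Sum>A\<in>Pow {..<m}. if B = A then P \<alpha> A else 0 else 0)"
        unfolding fun_apply_simps e_def
      proof (intro sum.cong refl)
        fix \<alpha>
        show "(\<Sum>A\<in>Pow {..<m}. P \<alpha> A *\<^sub>R (if \<beta> = \<alpha> \<and> B = A then 1 else 0)) =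
          (if \<beta> = \<alpha> then \<Sum>A\<in>Pow {..<m}. if B = A then P \<alpha> A else 0 else 0)"
          by (cases "\<beta> = \<alpha>") (simp_all add: if_distrib cong: if_cong)
      qed
      also have "\<dots> = P \<beta> B"
      proof -
        have "P \<beta> B \<noteq> 0 \<Longrightarrow> \<beta> \<in> mindices m k \<and> B \<subseteq> {..<m}" using P unfolding Pspace_iff by blast
        then show ?thesis by (cases "P \<beta> B = 0") simp_all
      qed
      finally show "P \<beta> B = (\<Sum>\<alpha>\<in>mindices m k. \<Sum>A\<in>Pow {..<m}. P \<alpha> A *\<^sub>R e \<alpha> A) \<beta> B" ..
    qed
    also have "\<dots> \<in> span ?B"
      by (intro span_sum span_scale span_base image_eqI[of _ _ "(_, _)"]) auto
    finally show ?thesis .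
  qed
  then show ?thesis by (intro exI[of _ ?B]) auto
qed

text \<open>Gram-Schmidt: \<open>w\<close> is the part of the new vector orthogonal to the old span,
  and the projection is corrected by a multiple of \<open>w\<close>.\<close>

lemma ip_projection_span:
  assumes "finite B" "B \<subseteq> Pspace m s k" "P \<in> Pspace m s k"
  shows "\<exists>Q\<in>span B. \<forall>R\<in>span B. ip m k (P - Q) R = 0"
proof -
  have ext: "\<forall>R\<in>span B. ip m k P R = 0" if "\<And>R. R \<in> B \<Longrightarrow> ip m k P R = 0" for B P
  proof
    fix R assume "R \<in> span B"
    then show "ip m k P R = 0"
      by (induction rule: span_induct_alt) (simp_all add: ip_add_right ip_scale_right that)
  qed
  have sub: "span B \<subseteq> Pspace m s k" if "B \<subseteq> Pspace m s k" for B
    using span_minimal[OF that subspace_Pspace] .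
  show ?thesis using assms
  proof (induction B arbitrary: P rule: finite_induct)
    case empty
    then show ?case by (auto intro!: bexI[of _ 0])
  next
    case (insert v B)
    obtain q where q: "q \<in> span B" "\<forall>R\<in>span B. ip m k (v - q) R = 0" using insert by blast
    obtain Q where Q: "Q \<in> span B" "\<forall>R\<in>span B. ip m k (P - Q) R = 0" using insert by blast
    define w where "w = v - q"
    have wP: "w \<in> Pspace m s k" using q(1) sub[of B] insert.prems by (auto simp: w_def intro!: Pspace_diff)
    \<comment> \<open>If \<open>ip m k w w = 0\<close> then \<open>w = 0\<close> by definiteness,
      and the next equation still holds with the value \<open>0\<close> of the quotient.\<close>
    define c where "c = ip m k (P - Q) w / ip m k w w"
    have c: "ip m k (P - Q) w = c * ip m k w w"
      using ip_definite[OF wP] by (cases "ip m k w w = 0") (auto simp: c_def)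
    have mono: "span B \<subseteq> span (insert v B)" by (rule span_mono) auto
    have "w \<in> span (insert v B)" unfolding w_def by (rule span_diff[OF span_base]) (use q(1) mono in auto)
    then have "Q + c *\<^sub>R w \<in> span (insert v B)" using Q(1) mono by (auto intro!: span_add span_scale)
    moreover have "\<forall>R\<in>span (insert v B). ip m k (P - (Q + c *\<^sub>R w)) R = 0"
    proof (rule ext)
      fix R assume "R \<in> insert v B"
      moreover have orth: "ip m k (P - (Q + c *\<^sub>R w)) R = 0" if "R \<in> span B" for R
        using Q(2) q(2) that by (simp add: diff_diff_add[symmetric] ip_diff_left[of _ _ "P - Q"] ip_scale_left w_def)
      moreover have "ip m k (P - (Q + c *\<^sub>R w)) v = 0"
      proof -
        have "ip m k (P - (Q + c *\<^sub>R w)) w = 0"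
          by (simp add: diff_diff_add[symmetric] ip_diff_left[of _ _ "P - Q"] ip_scale_left c)
        then show ?thesis using orth[OF q(1)] by (simp add: w_def ip_diff_right)
      qed
      ultimately show "ip m k (P - (Q + c *\<^sub>R w)) R = 0" using span_base by blast
    qed
    ultimately show ?case by blast
  qed
qed

lemma ip_projection:
  assumes W: "subspace W" "W \<subseteq> Pspace m s k" and P: "P \<in> Pspace m s k"
  obtains Q where "Q \<in> W" "\<And>R. R \<in> W \<Longrightarrow> ip m k (P - Q) R = 0"
proof -
  obtain B where B: "B \<subseteq> W" "independent B" "W \<subseteq> span B"
    using maximal_independent_subset by blast
  obtain T where T: "finite T" "Pspace m s k \<subseteq> span T" using Pspace_finite_span by blast
  have "finite B" using independent_span_bound[OF T(1) B(2)] B(1) W(2) T(2) by blast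
  moreover have "span B = W" using B W(1) by (metis span_eq_iff span_mono subset_antisym)
  ultimately show ?thesis using ip_projection_span[of B m s k P] B(1) W(2) P that by fastforce
qed

section \<open>Harmonic polynomials on the null cone\<close>

lemma xmul_xmul_apply: "xmul j (xmul j C) \<alpha> = (if 2 \<le> \<alpha> j then C (\<alpha>(j := \<alpha> j - 2)) else 0)"
  by (auto simp: xmul_eq numeral_2_eq_2)

text \<open>Division by the squared norm, which is monic of degree \<open>2\<close> in the
  coordinate with index \<open>0\<close>; \<open>n\<close> bounds the exponent of that
  coordinate.\<close>

lemma rsq_division:
  assumes "1 \<le> m"
  shows "Z \<in> Pspace m s (Suc (Suc k)) \<Longrightarrow> (\<And>\<alpha> A. Z \<alpha> A \<noteq> 0 \<Longrightarrow> \<alpha> 0 \<le> n) \<Longrightarrow>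
    \<exists>C\<in>Pspace m s k. \<forall>\<alpha> A. (Z - rsq m C) \<alpha> A \<noteq> 0 \<longrightarrow> \<alpha> 0 \<le> 1"
proof (induction n arbitrary: Z)
  case 0
  have "rsq m 0 = 0" by (simp add: rsq_def linear_0)
  moreover have "\<alpha> 0 \<le> 1" if "Z \<alpha> A \<noteq> 0" for \<alpha> A using 0(2)[OF that] by simp
  ultimately show ?case by (intro bexI[of _ 0]) (auto simp: Pspace_0)
next
  case (Suc n)
  show ?case
  proof (cases "n = 0")
    case True
    have "rsq m 0 = 0" by (simp add: rsq_def linear_0)
    then show ?thesis using Suc.prems(2) True by (intro bexI[of _ 0]) (auto simp: Pspace_0)
  next
    case False
    \<comment> \<open>The part of exponent \<open>Suc n\<close> in the first coordinate, lowered by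
      two. In \<open>rsq m C\<close> the square of that coordinate restores it, and the other
      squares keep the exponent \<open>n - 1\<close>.\<close>
    define C where "C \<alpha> = (if \<alpha> 0 = n - 1 then Z (\<alpha>(0 := Suc (Suc (\<alpha> 0)))) else 0)" for \<alpha> :: mindex
    have C: "C \<in> Pspace m s k"
      unfolding Pspace_iff
    proof (intro allI impI)
      fix \<alpha> A assume "C \<alpha> A \<noteq> 0"
      then have "Z (\<alpha>(0 := Suc (Suc (\<alpha> 0)))) A \<noteq> 0" by (auto simp: C_def fun_apply_simps split: if_splits)
      then have "\<alpha>(0 := Suc (Suc (\<alpha> 0))) \<in> mindices m (Suc (Suc k)) \<and> A \<subseteq> {..<m} \<and> card A = s"
        using Suc.prems(1) by (auto simp: Pspace_iff)
      then show "\<alpha> \<in> mindices m k \<and> A \<subseteq> {..<m} \<and> card A = s"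
        using mindices_upd[of 0 m "\<alpha>(0 := Suc (\<alpha> 0))" "Suc k"] mindices_upd[of 0 m \<alpha> k] assms by simp
    qed
    have rC: "rsq m C \<in> Pspace m s (Suc (Suc k))"
      unfolding rsq_def using C by (intro Pspace_sum xmul_Pspace) auto
    have top: "rsq m C \<alpha> = Z \<alpha>" if "Suc n \<le> \<alpha> 0" for \<alpha>
    proof -
      have "rsq m C \<alpha> = (\<Sum>j<m. xmul j (xmul j C) \<alpha>)" unfolding rsq_def by (rule sum_fun_apply)
      also have "\<dots> = (\<Sum>j<m. if j = 0 then (if \<alpha> 0 = Suc n then Z \<alpha> else 0) else 0)"
        unfolding xmul_xmul_apply
      proof (intro sum.cong refl)
        fix j
        have "Suc (Suc (\<alpha> 0 - 2)) = \<alpha> 0" using that False by simp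
        then show "(if 2 \<le> \<alpha> j then C (\<alpha>(j := \<alpha> j - 2)) else 0) = (if j = 0 then (if \<alpha> 0 = Suc n then Z \<alpha> else 0) else 0)"
          using that False fun_upd_idem[of \<alpha> 0 "Suc n"] by (auto simp: C_def)
      qed
      also have "\<dots> = Z \<alpha>" using assms Suc.prems(2)[of \<alpha>] that
        by (auto simp: fun_eq_iff fun_apply_simps)
      finally show ?thesis .
    qed
    have low: "\<alpha> 0 \<le> n" if "(Z - rsq m C) \<alpha> A \<noteq> 0" for \<alpha> A
      using top[of \<alpha>] that by (cases "Suc n \<le> \<alpha> 0") (auto simp: fun_apply_simps)
    have "\<exists>C'\<in>Pspace m s k. \<forall>\<alpha> A. (Z - rsq m C - rsq m C') \<alpha> A \<noteq> 0 \<longrightarrow> \<alpha> 0 \<le> 1"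
      by (rule Suc.IH[of "Z - rsq m C"]) (use Pspace_diff[OF Suc.prems(1) rC] low in auto)
    then obtain C' where C': "C' \<in> Pspace m s k"
      "\<forall>\<alpha> A. (Z - rsq m C - rsq m C') \<alpha> A \<noteq> 0 \<longrightarrow> \<alpha> 0 \<le> 1" by blast
    have "rsq m (C + C') = rsq m C + rsq m C'"
      by (simp add: rsq_def linear_add[OF linear_xmul] sum.distrib)
    then have e: "Z - rsq m (C + C') = Z - rsq m C - rsq m C'" by simp
    show ?thesis by (rule bexI[of _ "C + C'"], unfold e, rule C'(2), rule Pspace_add[OF C C'(1)])
  qed
qed

lemma pev_of_real: "pev m k P (\<lambda>j. of_real (x j)) = (\<lambda>A. of_real (pev m k P x A))"
  by (simp add: pev_def)

lemma pev_indep_0: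
  assumes "\<And>\<alpha> A. P \<alpha> A \<noteq> 0 \<Longrightarrow> \<alpha> 0 = 0" "\<And>j. 1 \<le> j \<Longrightarrow> j < m \<Longrightarrow> x j = y j"
  shows "pev m k P x = pev m k P y"
  unfolding pev_def
proof (intro ext sum.cong refl)
  fix A \<alpha>
  show "(\<Prod>j<m. x j ^ \<alpha> j) * of_real (P \<alpha> A) = (\<Prod>j<m. y j ^ \<alpha> j) * of_real (P \<alpha> A)"
  proof (cases "P \<alpha> A = 0")
    case False
    have "x j ^ \<alpha> j = y j ^ \<alpha> j" if "j < m" for j
      using assms(1)[OF False] assms(2)[of j] that by (cases "j = 0") auto
    then show ?thesis by simp
  qed simp
qed

text \<open>The coordinates of \<open>x\<close> from index \<open>1\<close> on are completed to an
  isotropic vector by \<open>\<i>\<close> times their norm.\<close>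

definition null_vec :: "nat \<Rightarrow> (nat \<Rightarrow> real) \<Rightarrow> nat \<Rightarrow> complex" where
  "null_vec m x = (\<lambda>j. if j = 0 then \<i> * of_real (sqrt (\<Sum>j=1..<m. (x j)\<^sup>2)) else of_real (x j))"

lemma bil_null_vec: "1 \<le> m \<Longrightarrow> bil m (null_vec m x) (null_vec m x) = 0"
proof -
  assume "1 \<le> m"
  then have "{..<m} = insert 0 {1..<m}" by auto
  then have "bil m (null_vec m x) (null_vec m x) = null_vec m x 0 * null_vec m x 0 + (\<Sum>j=1..<m. null_vec m x j * null_vec m x j)"
    by (simp add: bil_def)
  also have "(\<Sum>j=1..<m. null_vec m x j * null_vec m x j) = of_real (\<Sum>j=1..<m. (x j)\<^sup>2)"
    by (simp add: null_vec_def power2_eq_square)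
  also have "null_vec m x 0 * null_vec m x 0 = - of_real ((sqrt (\<Sum>j=1..<m. (x j)\<^sup>2))\<^sup>2)"
  proof -
    have "(\<i> * c) * (\<i> * c) = - (c * c)" for c by (simp add: complex_eq_iff)
    then show ?thesis by (simp only: null_vec_def simp_thms if_True power2_eq_square of_real_mult)
  qed
  also have "(sqrt (\<Sum>j=1..<m. (x j)\<^sup>2))\<^sup>2 = (\<Sum>j=1..<m. (x j)\<^sup>2)"
    by (simp add: sum_nonneg)
  finally show ?thesis by simp
qed

lemma pev_rsq: "pev m (Suc (Suc k)) (rsq m C) x = csc (bil m x x) (pev m k C x)"
  by (simp add: rsq_def pev_sum pev_xmul bil_def csc_sum_left)

lemma xmul_inject_0: assumes "xmul j P = 0" shows "P = 0"
proof
  fix \<alpha>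
  have "xmul j P (\<alpha>(j := Suc (\<alpha> j))) = 0" unfolding assms by (simp add: fun_apply_simps)
  then show "P \<alpha> = 0 \<alpha>" by (simp add: xmul_eq fun_apply_simps)
qed

text \<open>Write \<open>U\<close> as \<open>U0\<close> plus the first coordinate times
  \<open>U1\<close>, with neither part depending on that coordinate. At null vectors this becomes
  \<open>U0 + \<i> r U1\<close> with real values, so both \<open>U0\<close> and \<open>r U1\<close>
  vanish.\<close>

lemma vanishing_null_cone_low:
  assumes m: "2 \<le> m" and U: "U \<in> Pspace m s k" "\<And>\<alpha> A. U \<alpha> A \<noteq> 0 \<Longrightarrow> \<alpha> 0 \<le> 1"
    and van: "\<And>x. pev m k U (null_vec m x) = 0"
  shows "U = 0"
proof -
  define U0 where "U0 \<alpha> = (if \<alpha> 0 = 0 then U \<alpha> else 0)" for \<alpha> :: mindex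
  define U1 where "U1 \<alpha> = (if \<alpha> 0 = 0 then U (\<alpha>(0 := Suc (\<alpha> 0))) else 0)" for \<alpha> :: mindex
  have U0: "U0 \<in> Pspace m s k" using U(1) by (auto simp: Pspace_iff U0_def fun_apply_simps)
  have split: "U = U0 + xmul 0 U1"
  proof (intro ext)
    fix \<alpha> A
    have "U \<alpha> A = 0" if "1 < \<alpha> 0" using U(2)[of \<alpha> A] that by (metis not_le)
    then show "U \<alpha> A = (U0 + xmul 0 U1) \<alpha> A"
      by (cases "\<alpha> 0 = 1") (auto simp: U0_def U1_def xmul_eq fun_apply_simps fun_upd_idem)
  qed
  have U1: "k \<noteq> 0 \<and> U1 \<in> Pspace m s (k - 1) \<or> U1 = 0"
  proof (cases k)
    case 0
    have "U (\<alpha>(0 := Suc (\<alpha> 0))) A = 0" for \<alpha> A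
      using U(1) mindices_upd_0[of 0 m \<alpha>] m unfolding 0 Pspace_iff by (meson less_le_trans pos2)
    then have "U (\<alpha>(0 := Suc (\<alpha> 0))) = 0" for \<alpha> by (simp add: fun_eq_iff fun_apply_simps)
    then have "U1 \<alpha> = 0" for \<alpha> by (simp only: U1_def if_cancel)
    then have "U1 = 0" by (simp add: fun_eq_iff fun_apply_simps)
    then show ?thesis by blast
  next
    case (Suc n)
    have "U1 \<in> Pspace m s n" unfolding Pspace_iff
    proof (intro allI impI)
      fix \<alpha> A assume "U1 \<alpha> A \<noteq> 0"
      then have "U (\<alpha>(0 := Suc (\<alpha> 0))) A \<noteq> 0"
        by (metis (full_types) U1_def zero_fun_apply)
      then have "\<alpha>(0 := Suc (\<alpha> 0)) \<in> mindices m (Suc n) \<and> A \<subseteq> {..<m} \<and> card A = s"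
        using U(1) unfolding Suc Pspace_iff by blast
      then show "\<alpha> \<in> mindices m n \<and> A \<subseteq> {..<m} \<and> card A = s"
        using mindices_upd[of 0 m \<alpha> n] m by simp
    qed
    then show ?thesis using Suc by simp
  qed
  show ?thesis
  proof -
    have real0: "pev m n Q (null_vec m x) A = of_real (pev m n Q x A)"
      if "\<forall>\<alpha> A. Q \<alpha> A \<noteq> 0 \<longrightarrow> \<alpha> 0 = 0" for Q n x A
    proof -
      have "pev m n Q (null_vec m x) = pev m n Q (\<lambda>j. of_real (x j))"
        by (rule pev_indep_0) (use that in \<open>auto simp: null_vec_def\<close>)
      then show ?thesis by (simp add: pev_of_real)
    qed
    have s0: "\<forall>\<alpha> A. U0 \<alpha> A \<noteq> 0 \<longrightarrow> \<alpha> 0 = 0" "\<forall>\<alpha> A. U1 \<alpha> A \<noteq> 0 \<longrightarrow> \<alpha> 0 = 0"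
      by (auto simp: U0_def U1_def fun_apply_simps split: if_splits)
    define r where "r x = sqrt (\<Sum>j=1..<m. (x j)\<^sup>2)" for x :: "nat \<Rightarrow> real"
    have key: "pev m k U0 x A = 0" "k \<noteq> 0 \<Longrightarrow> r x * pev m (k - 1) U1 x A = 0" for x A
    proof -
      have "pev m k U0 (null_vec m x) A + pev m k (xmul 0 U1) (null_vec m x) A = 0"
        using van[of x] unfolding split pev_add by (metis plus_fun_apply zero_fun_apply)
      then have "of_real (pev m k U0 x A) + pev m k (xmul 0 U1) (null_vec m x) A = 0"
        using real0[of U0 k x A, OF s0(1)] by simp
      moreover have "pev m k (xmul 0 U1) (null_vec m x) A = \<i> * of_real (r x * pev m (k - 1) U1 x A)" if "k \<noteq> 0"
        using pev_xmul[of 0 m "k - 1" U1 "null_vec m x"] real0[of U1 "k - 1" x A, OF s0(2)] m that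
        by (simp add: csc_def r_def null_vec_def)
      moreover have "xmul 0 U1 = 0" if "k = 0" using U1 that by (simp add: linear_0)
      ultimately show "pev m k U0 x A = 0" "k \<noteq> 0 \<Longrightarrow> r x * pev m (k - 1) U1 x A = 0"
        by (cases "k = 0"; auto simp: complex_eq_iff fun_apply_simps)+
    qed
    have "U0 = 0" by (rule pev_inject_0[OF U0]) (simp add: fun_eq_iff fun_apply_simps key)
    moreover have "U1 = 0"
    proof (cases "k = 0")
      case False
      then have P1: "xmul 1 U1 \<in> Pspace m s k" using U1 xmul_Pspace[of 1 m U1 s "k - 1"] m
        by (auto simp: linear_0 Pspace_0)
      \<comment> \<open>At points with \<open>r x = 0\<close> nothing is known about
        \<open>U1\<close>, but there the coordinate \<open>x 1\<close> vanishes too.\<close>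
      have "xmul 1 U1 = 0"
      proof (rule pev_inject_0[OF P1])
        fix x :: "nat \<Rightarrow> real"
        have "x 1 = 0 \<or> r x \<noteq> 0"
        proof (rule ccontr)
          assume *: "\<not> (x 1 = 0 \<or> r x \<noteq> 0)"
          have "(x 1)\<^sup>2 \<le> (\<Sum>j=1..<m. (x j)\<^sup>2)" by (rule member_le_sum) (use m in auto)
          also have "\<dots> = 0" using * by (simp add: r_def)
          finally show False using * by simp
        qed
        then have "x 1 * pev m (k - 1) U1 x A = 0" for A using key(2)[OF False, of x A] by auto
        then show "pev m k (xmul 1 U1) x = 0"
          using pev_xmul[of 1 m "k - 1" U1 x] m False by (simp add: csc_def fun_eq_iff fun_apply_simps)
      qed
      then show ?thesis by (rule xmul_inject_0)
    qed (use U1 in auto)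
    ultimately show ?thesis using split by (simp add: linear_0)
  qed
qed

text \<open>After division by the squared norm the remainder also vanishes on the null cone, hence
  is zero. Then \<open>Z\<close> is in the range of \<open>rsq\<close>, and \<open>ip_lap\<close>
  gives \<open>ip m k Z Z = 0\<close>.\<close>

lemma harmonic_null_cone:
  assumes m: "2 \<le> m" and Z: "Z \<in> Pspace m s k" "lap m Z = 0"
    and van: "\<And>x. pev m k Z (null_vec m x) = 0"
  shows "Z = 0"
proof (cases "k < 2")
  case True
  have "\<alpha> 0 \<le> 1" if "Z \<alpha> A \<noteq> 0" for \<alpha> A
  proof -
    have "\<alpha> \<in> mindices m k" using Z(1) that by (auto simp: Pspace_iff)
    then have "\<alpha> 0 \<le> k" using member_le_sum[of 0 "{..<m}" \<alpha>] m by (auto simp: mindices_def)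
    then show ?thesis using True by simp
  qed
  then show ?thesis using vanishing_null_cone_low[OF m Z(1)] van by blast
next
  case False
  then obtain n where k: "k = Suc (Suc n)" by (metis Suc_1 Suc_lessD less_antisym not_less_eq old.nat.exhaust less_2_cases_iff One_nat_def)
  have "\<alpha> 0 \<le> k" if "Z \<alpha> A \<noteq> 0" for \<alpha> A
  proof -
    have "\<alpha> \<in> mindices m k" using Z(1) that by (auto simp: Pspace_iff)
    then show ?thesis using member_le_sum[of 0 "{..<m}" \<alpha>] m by (auto simp: mindices_def)
  qed
  then obtain C where C: "C \<in> Pspace m s n" "\<forall>\<alpha> A. (Z - rsq m C) \<alpha> A \<noteq> 0 \<longrightarrow> \<alpha> 0 \<le> 1"
    using rsq_division[of m Z s n k] Z(1) m k by auto
  have rC: "rsq m C \<in> Pspace m s k"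
    unfolding rsq_def k using C by (intro Pspace_sum xmul_Pspace) auto
  have "Z - rsq m C = 0"
  proof (rule vanishing_null_cone_low[OF m Pspace_diff[OF Z(1) rC]])
    show "\<And>\<alpha> A. (Z - rsq m C) \<alpha> A \<noteq> 0 \<Longrightarrow> \<alpha> 0 \<le> 1" using C(2) by blast
    show "pev m k (Z - rsq m C) (null_vec m x) = 0" for x
      using van[of x] bil_null_vec[of m x] m pev_rsq[of m n C "null_vec m x"] by (simp add: pev_diff k)
  qed
  then have "Z = rsq m C" by simp
  then have "ip m k Z Z = 0" using ip_lap[of m n C Z] Z(2) k by simp
  then show ?thesis using ip_definite[OF Z(1)] by simp
qed

lemma pev_oX: "pev m (Suc k) (oX m P) x = ev m x (pev m k P x)"
  and pev_oJ: "pev m (Suc k) (oJ m P) x = iv m x (pev m k P x)"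
  by (simp_all add: gop_def ev_def iv_def pev_sum pev_pE pev_pI pev_xmul ew_csc iw_csc)

text \<open>The harmonic combination vanishes on the null cone and hence identically. Applying
  \<open>oD\<close> to it leaves a nonzero multiple of \<open>oX m P\<close>, and \<open>oC\<close>
  then recovers \<open>b\<close> times \<open>P\<close>; both scalars are nonzero since
  \<open>1 \<le> s < m\<close>.\<close>

lemma HH_nonvanishing:
  assumes s: "1 \<le> s" "s < m" and P: "P \<in> HH m s k"
    and van: "\<And>x. ev m (null_vec m x) (iv m (null_vec m x) (pev m k P (null_vec m x))) = 0"
  shows "P = 0"
proof -
  define a where "a = real k + real s"
  define b where "b = real k + real m - real s"
  have ab: "a > 0" "b > 0" using s by (auto simp: a_def b_def)
  \<comment> \<open>harmonic, and a nonzero multiple of the expression in \<open>van\<close> at null vectors\<close>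
  define Z where "Z = b *\<^sub>R oX m (oJ m P) - a *\<^sub>R oJ m (oX m P)"
  have "Z \<in> Pspace m s (Suc (Suc k))"
    using oX_Pspace[OF HH_oJ_Pspace[OF P]] oJ_Pspace[OF HH_oX_Pspace[OF P]] s
    by (auto simp: Z_def intro!: Pspace_intros)
  moreover have "lap m Z = 0" using HH_lap_XJ_JX[OF P] by (simp add: Z_def a_def b_def)
  moreover have "pev m (Suc (Suc k)) Z (null_vec m x) = 0" for x
    using van[of x] bil_null_vec[of m x] s
    by (simp add: Z_def pev_diff pev_scale pev_oX pev_oJ iv_ev)
  ultimately have "Z = 0" using harmonic_null_cone[of m Z s "Suc (Suc k)"] s by simp
  have "0 = oD m Z" using \<open>Z = 0\<close> by (simp add: ops_linear)
  also have "\<dots> = (b * - a - a * (a + 2)) *\<^sub>R oX m P"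
    unfolding Z_def ops_linear HH_DXJ[OF P, folded a_def] HH_DJX[OF P, folded a_def] scaleR_scaleR
    by (rule scaleR_left_diff_distrib[symmetric])
  also have "b * - a - a * (a + 2) = - (a * (a + b + 2))" by (simp add: algebra_simps)
  finally have "oX m P = 0" using ab by simp
  then have "b *\<^sub>R P = 0" using HH_CX[OF P] by (simp add: ops_linear b_def)
  then show ?thesis using ab by simp
qed

section \<open>Interpolating reflections at an isotropic vector\<close>

text \<open>Lagrange interpolation at the nodes \<open>0, ..., N\<close>, with weights independent
  of the polynomial. The induction splits off the linear factor at the new node
  \<open>c\<close>.\<close>

lemma interpolation_weights:
  fixes z :: complex
  shows "\<exists>l :: nat \<Rightarrow> complex. \<forall>p. degree p \<le> N \<longrightarrow> poly p z = (\<Sum>j\<le>N. l j * poly p (of_nat j))"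
proof (induction N)
  case 0
  have "poly p z = poly p 0" if "degree p \<le> 0" for p :: "complex poly"
    using that by (auto elim: degree_eq_zeroE)
  then show ?case by (intro exI[of _ "\<lambda>_. 1"]) auto
next
  case (Suc N)
  then obtain l :: "nat \<Rightarrow> complex" where l: "\<And>p. degree p \<le> N \<Longrightarrow> poly p z = (\<Sum>j\<le>N. l j * poly p (of_nat j))" by blast
  define c where "c = (of_nat (Suc N) :: complex)"
  \<comment> \<open>The old weights act on \<open>q(j) = (p(j) - p(c)) / (j - c)\<close>; the weight
    of the new node collects the coefficients of \<open>p(c)\<close>, so the weights sum to
    \<open>1\<close>.\<close>
  define l' where "l' j = (if j = Suc N then 1 - (\<Sum>i\<le>N. (z - c) * l i / (of_nat i - c)) else (z - c) * l j / (of_nat j - c))" for j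
  have "poly p z = (\<Sum>j\<le>Suc N. l' j * poly p (of_nat j))" if p: "degree p \<le> Suc N" for p
  proof -
    define q where "q = synthetic_div p c"
    have pq: "poly p x = (x - c) * poly q x + poly p c" for x
      using synthetic_div_correct'[of c p] by (metis (no_types) add.commute poly_add poly_mult poly_pCons q_def
          mult_zero_right add_0 mult.right_neutral uminus_add_conv_diff poly_0 mult_1 add_uminus_conv_diff)
    have "degree q \<le> N" using p by (simp add: q_def degree_synthetic_div)
    then have "poly p z = (z - c) * (\<Sum>j\<le>N. l j * poly q (of_nat j)) + poly p c"
      using pq[of z] l by simp
    also have "(z - c) * (\<Sum>j\<le>N. l j * poly q (of_nat j)) = (\<Sum>j\<le>N. l' j * (poly p (of_nat j) - poly p c))"
      unfolding sum_distrib_left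
    proof (rule sum.cong[OF refl])
      fix j assume "j \<in> {..N}"
      then have ne: "of_nat j - c \<noteq> 0" unfolding c_def right_minus_eq of_nat_eq_iff by simp
      have "poly p (of_nat j) - poly p c = (of_nat j - c) * poly q (of_nat j)" using pq[of "of_nat j"] by simp
      then show "(z - c) * (l j * poly q (of_nat j)) = l' j * (poly p (of_nat j) - poly p c)"
        using ne \<open>j \<in> {..N}\<close> by (simp add: l'_def)
    qed
    also have "\<dots> + poly p c = (\<Sum>j\<le>N. l' j * poly p (of_nat j)) + (1 - (\<Sum>j\<le>N. l' j)) * poly p c"
      by (simp add: algebra_simps sum_subtractf sum_distrib_left sum_distrib_right)
    also have "1 - (\<Sum>j\<le>N. l' j) = l' (Suc N)" by (simp add: l'_def)
    finally show ?thesis by (simp add: c_def)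
  qed
  then show ?case by blast
qed

section \<open>Polynomial dependence on the parameter of the reflection, with degree bounds\<close>

definition PD :: "nat \<Rightarrow> (complex \<Rightarrow> complex) \<Rightarrow> bool" where
  "PD N f \<longleftrightarrow> (\<exists>p. degree p \<le> N \<and> (\<forall>t. f t = poly p t))"

lemma PD_const: "PD N (\<lambda>t. c)"
  unfolding PD_def by (intro exI[of _ "[:c:]"]) simp

lemma PD_id: "PD (Suc 0) (\<lambda>t. t)"
  unfolding PD_def by (intro exI[of _ "[:0, 1:]"]) simp

lemma PD_add: "PD N f \<Longrightarrow> PD N g \<Longrightarrow> PD N (\<lambda>t. f t + g t)"
  unfolding PD_def by (metis degree_add_le poly_add)

lemma PD_diff: "PD N f \<Longrightarrow> PD N g \<Longrightarrow> PD N (\<lambda>t. f t - g t)"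
  unfolding PD_def by (metis degree_diff_le poly_diff)

lemma PD_mult: "PD N f \<Longrightarrow> PD M g \<Longrightarrow> PD (N + M) (\<lambda>t. f t * g t)"
  unfolding PD_def by (metis (no_types, lifting) add_mono degree_mult_le le_trans poly_mult)

lemma PD_cmult: "PD N f \<Longrightarrow> PD N (\<lambda>t. c * f t)"
  using PD_mult[OF PD_const[of 0 c]] by simp

lemma PD_mono: "PD N f \<Longrightarrow> N \<le> M \<Longrightarrow> PD M f"
  unfolding PD_def using le_trans by blast

lemma PD_sum: "(\<And>i. i \<in> S \<Longrightarrow> PD N (f i)) \<Longrightarrow> PD N (\<lambda>t. \<Sum>i\<in>S. f i t)"
  by (induction S rule: infinite_finite_induct) (simp_all add: PD_const PD_add)

lemma PD_power: "PD N f \<Longrightarrow> PD (n * N) (\<lambda>t. f t ^ n)"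
  by (induction n) (simp_all add: PD_const PD_mult)

lemma PD_prod: "(\<And>i. i \<in> S \<Longrightarrow> PD (N i) (f i)) \<Longrightarrow> PD (\<Sum>i\<in>S. N i) (\<lambda>t. \<Prod>i\<in>S. f i t)"
  by (induction S rule: infinite_finite_induct) (simp_all add: PD_const PD_mult)

definition atv :: "complex \<Rightarrow> nat \<Rightarrow> complex" where
  "atv t = (\<lambda>j. if j = 1 then 1 else if j = 0 then t else 0)"

abbreviation "av \<equiv> atv \<i>"

definition ut :: "real \<Rightarrow> nat \<Rightarrow> real" where
  "ut t = (\<lambda>j. (if j = 1 then 1 else if j = 0 then t else 0) / sqrt (1 + t\<^sup>2))"

text \<open>For real \<open>t\<close> this is a power of \<open>1 + t\<^sup>2\<close> times the image of \<open>P\<close> under the reflection in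
  \<open>e\<^sub>1 + t e\<^sub>0\<close>. It is polynomial in \<open>t\<close>, and at \<open>t = \<i>\<close> the vector becomes isotropic.\<close>

definition Gt :: "nat \<Rightarrow> nat \<Rightarrow> nat \<Rightarrow> cpoly \<Rightarrow> (nat \<Rightarrow> complex) \<Rightarrow> complex \<Rightarrow> nat set \<Rightarrow> complex" where
  "Gt m k n P z t = (let v = pev m k P (\<lambda>j. (1 + t\<^sup>2) * z j - 2 * bil m (atv t) z * atv t j)
     in csc ((1 + t\<^sup>2) ^ n) (csc (1 + t\<^sup>2) v - csc 2 (ev m (atv t) (iv m (atv t) v))))"

lemma PD_atv: "PD (Suc 0) (\<lambda>t. atv t j)"
  by (cases "j = 0"; cases "j = 1") (simp_all add: atv_def PD_const PD_id)

lemma PD_q: "PD 2 (\<lambda>t. 1 + t\<^sup>2)"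
  using PD_power[OF PD_id, of 2] by (intro PD_add PD_const) simp

lemma PD_pev:
  assumes "\<And>j. j < m \<Longrightarrow> PD 2 (\<lambda>t. x t j)"
  shows "PD (2 * k) (\<lambda>t. pev m k P (x t) A)"
  unfolding pev_def
proof (rule PD_sum)
  fix \<alpha> assume \<alpha>: "\<alpha> \<in> mindices m k"
  have "PD (\<Sum>j<m. \<alpha> j * 2) (\<lambda>t. \<Prod>j<m. x t j ^ \<alpha> j)"
    by (intro PD_prod PD_power assms) simp
  also have "(\<Sum>j<m. \<alpha> j * 2) = 2 * k" using \<alpha> by (simp add: mindices_def sum_distrib_right[symmetric])
  finally have "PD (2 * k) (\<lambda>t. \<Prod>j<m. x t j ^ \<alpha> j)" .
  from PD_cmult[OF this, of "of_real (P \<alpha> A)"]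
  show "PD (2 * k) (\<lambda>t. (\<Prod>j<m. x t j ^ \<alpha> j) * of_real (P \<alpha> A))"
    by (simp only: mult.commute[of "of_real (P \<alpha> A)"])
qed

lemma PD_ew: "(\<And>A. PD N (\<lambda>t. v t A)) \<Longrightarrow> PD N (\<lambda>t. ew j (v t) A)"
  and PD_iw: "(\<And>A. PD N (\<lambda>t. v t A)) \<Longrightarrow> PD N (\<lambda>t. iw j (v t) A)"
  by (cases "j \<in> A"; simp add: ew_def iw_def PD_cmult PD_const)+

lemma PD_ev:
  assumes "\<And>A. PD N (\<lambda>t. v t A)" shows "PD (Suc N) (\<lambda>t. ev m (atv t) (v t) A)"
  unfolding ev_def csc_def sum_fun_apply
  by (rule PD_sum) (use PD_mult[OF PD_atv PD_ew[OF assms]] in simp)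

lemma PD_iv:
  assumes "\<And>A. PD N (\<lambda>t. v t A)" shows "PD (Suc N) (\<lambda>t. iv m (atv t) (v t) A)"
  unfolding iv_def csc_def sum_fun_apply
  by (rule PD_sum) (use PD_mult[OF PD_atv PD_iw[OF assms]] in simp)

text \<open>Everything is built from quadratic quantities: \<open>2 * n\<close> from the power,
  \<open>2 * k\<close> from the argument of \<open>P\<close>, and \<open>2\<close> from the
  reflection of the value.\<close>

lemma PD_Gt: "PD (2 * (n + k + 1)) (\<lambda>t. Gt m k n P z t A)"
proof -
  define x where "x t = (\<lambda>j. (1 + t\<^sup>2) * z j - 2 * bil m (atv t) z * atv t j)" for t
  have b: "PD (Suc 0) (\<lambda>t. bil m (atv t) z)"
    unfolding bil_def by (rule PD_sum) (use PD_cmult[OF PD_atv] in \<open>simp add: mult.commute\<close>)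
  have "PD 2 (\<lambda>t. x t j)" for j
    unfolding x_def
  proof (rule PD_diff)
    show "PD 2 (\<lambda>t. (1 + t\<^sup>2) * z j)" using PD_cmult[OF PD_q, of "z j"] by (simp add: mult.commute)
    show "PD 2 (\<lambda>t. 2 * bil m (atv t) z * atv t j)"
      using PD_mult[OF PD_cmult[OF b, of 2] PD_atv[of j]] by (simp add: numeral_2_eq_2)
  qed
  then have v: "PD (2 * k) (\<lambda>t. pev m k P (x t) A)" for A by (intro PD_pev)
  have "PD (2 + 2 * k) (\<lambda>t. (1 + t\<^sup>2) * pev m k P (x t) A)" by (rule PD_mult[OF PD_q v])
  moreover have "PD (2 + 2 * k) (\<lambda>t. 2 * ev m (atv t) (iv m (atv t) (pev m k P (x t))) A)"
    using PD_cmult[OF PD_ev[OF PD_iv[OF v]], of 2] by simp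
  ultimately have "PD (2 + 2 * k) (\<lambda>t. (1 + t\<^sup>2) * pev m k P (x t) A - 2 * ev m (atv t) (iv m (atv t) (pev m k P (x t))) A)"
    by (rule PD_diff)
  from PD_mult[OF PD_power[OF PD_q, of n] this]
  have "PD (n * 2 + (2 + 2 * k)) (\<lambda>t. Gt m k n P z t A)"
    by (simp add: Gt_def Let_def x_def csc_def fun_apply_simps)
  then show ?thesis by (rule PD_mono) simp
qed

lemma bil_atv: "2 \<le> m \<Longrightarrow> bil m (atv t) z = z 1 + t * z 0"
proof -
  assume "2 \<le> m"
  then have "{..<m} = insert 0 (insert 1 {2..<m})" by auto
  moreover have "(\<Sum>j=2..<m. atv t j * z j) = 0" by (intro sum.neutral) (auto simp: atv_def)
  ultimately show ?thesis by (simp add: bil_def) (simp add: atv_def)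
qed

lemma bil_av: "2 \<le> m \<Longrightarrow> bil m av av = 0"
  by (simp add: bil_atv) (simp add: atv_def)

lemma ut_atv: "complex_of_real (ut t j) = atv (of_real t) j / of_real (sqrt (1 + t\<^sup>2))"
  by (simp add: ut_def atv_def)

lemma uvec_ut: assumes "2 \<le> m" shows "uvec m (ut t)"
proof -
  have q: "1 + t\<^sup>2 > 0" by (simp add: add_pos_nonneg)
  have "{..<m} = insert 0 (insert 1 {2..<m})" using assms by auto
  moreover have "(\<Sum>j=2..<m. ut t j * ut t j) = 0" by (intro sum.neutral) (auto simp: ut_def)
  ultimately have "bil m (ut t) (ut t) = ut t 0 * ut t 0 + ut t 1 * ut t 1" by (simp add: bil_def)
  also have "\<dots> = (t\<^sup>2 + 1) / (sqrt (1 + t\<^sup>2))\<^sup>2"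
    by (simp add: ut_def power2_eq_square add_divide_distrib)
  also have "\<dots> = 1" using q by simp
  finally show ?thesis using assms by (auto simp: uvec_def ut_def)
qed

lemma ev_scale: "ev m (\<lambda>j. c * z j) v = csc c (ev m z v)"
  and iv_scale: "iv m (\<lambda>j. c * z j) v = csc c (iv m z v)"
  by (simp_all add: ev_def iv_def csc_sum)

lemma bil_scale: "bil m (\<lambda>j. c * z j) w = c * bil m z w"
  by (simp add: bil_def sum_distrib_left mult.assoc)

text \<open>Normalising \<open>atv t\<close> costs one factor \<open>1 / (1 + t\<^sup>2)\<close> for
  each of the \<open>k\<close> degrees of the argument and one for the value, so \<open>n\<close>
  spare powers remain.\<close>

lemma Gt_real:
  assumes P: "P \<in> Pspace m s k"
  shows "Gt m k n P z (of_real t) = csc ((1 + of_real t ^ 2) ^ (n + k + 1)) (pev m k (prefl m k (ut t) P) z)"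
proof -
  define q :: complex where "q = 1 + of_real t ^ 2"
  define r :: complex where "r = 1 / of_real (sqrt (1 + t\<^sup>2))"
  have "1 + t\<^sup>2 > 0" by (simp add: add_pos_nonneg)
  then have "(sqrt (1 + t\<^sup>2))\<^sup>2 = 1 + t\<^sup>2" by simp
  then have "complex_of_real (sqrt (1 + t\<^sup>2)) ^ 2 = q" by (metis of_real_1 of_real_add of_real_power q_def)
  moreover have q0: "q \<noteq> 0" using \<open>1 + t\<^sup>2 > 0\<close> unfolding q_def
    by (metis of_real_1 of_real_add of_real_power of_real_eq_0_iff less_irrefl)
  ultimately have rr: "r * r = 1 / q" by (simp add: r_def power2_eq_square)
  have u: "(\<lambda>j. complex_of_real (ut t j)) = (\<lambda>j. r * atv (of_real t) j)"
    by (simp add: ut_atv r_def)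
  let ?w = "\<lambda>j. q * z j - 2 * bil m (atv (of_real t)) z * atv (of_real t) j"
  have "rv m (\<lambda>j. complex_of_real (ut t j)) z j = (1 / q) * ?w j" for j
  proof -
    have "rv m (\<lambda>j. complex_of_real (ut t j)) z j = z j - 2 * ((r * r) * bil m (atv (of_real t)) z) * atv (of_real t) j"
      unfolding u rv_def bil_scale by (simp add: mult_ac)
    then show ?thesis using q0 unfolding rr by (simp add: field_simps)
  qed
  then have "pev m k P (rv m (\<lambda>j. complex_of_real (ut t j)) z) = csc ((1 / q) ^ k) (pev m k P ?w)"
    unfolding pev_homogeneous[symmetric] by presburger
  then have "pev m k (prefl m k (ut t) P) z = csc ((1 / q) ^ k) (Lv m (\<lambda>j. complex_of_real (ut t j)) (pev m k P ?w))"
    unfolding pev_refl[OF P] by (simp add: Lv_csc)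
  also have "Lv m (\<lambda>j. complex_of_real (ut t j)) (pev m k P ?w)
     = csc (1 / q) (csc q (pev m k P ?w) - csc 2 (ev m (atv (of_real t)) (iv m (atv (of_real t)) (pev m k P ?w))))"
    unfolding Lv_def u ev_scale iv_scale ev_csc csc_csc rr csc_diff using q0 by (simp add: mult_ac)
  finally have "csc (q ^ (n + k + 1)) (pev m k (prefl m k (ut t) P) z) =
     csc (q ^ (n + k + 1) * (1 / q) ^ k * (1 / q)) (csc q (pev m k P ?w) - csc 2 (ev m (atv (of_real t)) (iv m (atv (of_real t)) (pev m k P ?w))))"
    by (simp add: mult.assoc)
  also have "q ^ (n + k + 1) * (1 / q) ^ k * (1 / q) = q ^ n" using q0 by (simp add: power_add field_simps)
  finally show ?thesis unfolding Gt_def Let_def q_def by (rule sym)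
qed

text \<open>At \<open>\<i>\<close> the factor \<open>1 + t\<^sup>2\<close> is zero: the argument of
  \<open>P\<close> collapses to a multiple of \<open>av\<close>, and the spare power is
  \<open>0 ^ n\<close>.\<close>

lemma Gt_i:
  "Gt m k n P z \<i> = (if n = 0 then csc ((-2) ^ (k + 1) * bil m av z ^ k) (ev m av (iv m av (pev m k P av))) else 0)"
proof -
  have "pev m k P (\<lambda>j. (1 + \<i>\<^sup>2) * z j - 2 * bil m av z * av j) = csc ((- 2 * bil m av z) ^ k) (pev m k P av)"
    unfolding pev_homogeneous[symmetric] by simp
  moreover have "(- (2 * bil m av z)) ^ k = (- 2) ^ k * bil m av z ^ k"
    by (metis mult_minus_left power_mult_distrib)
  ultimately show ?thesis
    by (simp add: Gt_def Let_def ev_csc iv_csc power_mult_distrib csc_neg[symmetric])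
      (simp add: csc_def fun_eq_iff fun_apply_simps)
qed

definition gact :: "nat \<Rightarrow> nat \<Rightarrow> nat \<Rightarrow> (nat \<Rightarrow> real) \<Rightarrow> cpoly \<Rightarrow> cpoly" where
  "gact m k N w P = (\<Sum>j\<le>N. w j *\<^sub>R prefl m k (ut (real j)) P)"

text \<open>The value, up to a scalar factor depending on \<open>z\<close>, of the reflection
  interpolated at \<open>\<i>\<close>.\<close>

definition topv :: "nat \<Rightarrow> nat \<Rightarrow> cpoly \<Rightarrow> nat set \<Rightarrow> complex" where
  "topv m k P = ev m av (iv m av (pev m k P av))"

text \<open>The weights are chosen before \<open>m\<close>, \<open>s\<close>, \<open>k\<close> and
  \<open>P\<close>, so that equivariant maps between spaces of different degree transport the
  operators. The spare exponent in degree \<open>k\<close> is \<open>n - (k + 1)\<close>, hence zero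
  results unless \<open>n = k + 1\<close>.\<close>

lemma isotropic_interpolation:
  "\<exists>w1 w2. \<forall>m s k P z. P \<in> Pspace m s k \<longrightarrow> k + 1 \<le> n \<longrightarrow>
      pev m k (gact m k (2 * n) w1 P) z + csc \<i> (pev m k (gact m k (2 * n) w2 P) z) =
      (if n = k + 1 then csc ((-2) ^ (k + 1) * bil m av z ^ k) (topv m k P) else 0)"
proof -
  obtain l :: "nat \<Rightarrow> complex" where l: "\<And>p. degree p \<le> 2 * n \<Longrightarrow> poly p \<i> = (\<Sum>j\<le>2*n. l j * poly p (of_nat j))"
    using interpolation_weights by blast
  \<comment> \<open>With the spare exponent adjusted to the degree, the power of
    \<open>1 + t\<^sup>2\<close> in \<open>Gt_real\<close> is always \<open>n\<close> and can be
    absorbed into the weights.\<close>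
  define mu where "mu j = l j * (1 + of_real (real j) ^ 2) ^ n" for j
  show ?thesis
  proof (rule exI[of _ "\<lambda>j. Re (mu j)"], rule exI[of _ "\<lambda>j. Im (mu j)"], intro allI impI)
    fix m s k :: nat and P :: cpoly and z :: "nat \<Rightarrow> complex"
    assume P: "P \<in> Pspace m s k" and kn: "k + 1 \<le> n"
    define d where "d = n - (k + 1)"
    have n: "d + k + 1 = n" using kn by (simp add: d_def)
    have "Gt m k d P z \<i> A = (\<Sum>j\<le>2*n. csc (mu j) (pev m k (prefl m k (ut (real j)) P) z) A)" for A
    proof -
      obtain p where p: "degree p \<le> 2 * n" "\<And>t. Gt m k d P z t A = poly p t"
        using PD_Gt[of d k m P z A] unfolding n PD_def by blast
      have "Gt m k d P z \<i> A = (\<Sum>j\<le>2*n. l j * Gt m k d P z (of_real (real j)) A)"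
        using l[OF p(1)] by (simp add: p(2))
      then show ?thesis unfolding Gt_real[OF P] n by (simp add: mu_def csc_def mult.assoc)
    qed
    then have "Gt m k d P z \<i> = (\<Sum>j\<le>2*n. csc (mu j) (pev m k (prefl m k (ut (real j)) P) z))"
      by (simp add: fun_eq_iff fun_apply_simps)
    also have "\<dots> = (\<Sum>j\<le>2*n. csc (of_real (Re (mu j))) (pev m k (prefl m k (ut (real j)) P) z)
        + csc \<i> (csc (of_real (Im (mu j))) (pev m k (prefl m k (ut (real j)) P) z)))"
      by (intro sum.cong refl) (simp add: csc_add_left[symmetric] complex_eq[symmetric])
    also have "\<dots> = pev m k (gact m k (2 * n) (\<lambda>j. Re (mu j)) P) z + csc \<i> (pev m k (gact m k (2 * n) (\<lambda>j. Im (mu j)) P) z)"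
      by (simp add: gact_def pev_sum pev_scale sum.distrib csc_sum)
    finally show "pev m k (gact m k (2 * n) (\<lambda>j. Re (mu j)) P) z + csc \<i> (pev m k (gact m k (2 * n) (\<lambda>j. Im (mu j)) P) z) =
      (if n = k + 1 then csc ((-2) ^ (k + 1) * bil m av z ^ k) (topv m k P) else 0)"
      using n by (auto simp: Gt_i topv_def)
  qed
qed

section \<open>Irreducibility\<close>

text \<open>\<open>F\<close> lies in the complexification of \<open>W\<close>.\<close>

definition inC :: "nat \<Rightarrow> nat \<Rightarrow> cpoly set \<Rightarrow> ((nat \<Rightarrow> complex) \<Rightarrow> nat set \<Rightarrow> complex) \<Rightarrow> bool" where
  "inC m k W F \<longleftrightarrow> (\<exists>P\<in>W. \<exists>Q\<in>W. \<forall>z. F z = pev m k P z + csc \<i> (pev m k Q z))"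

lemma inC_add:
  assumes "subspace W" "inC m k W F" "inC m k W G" shows "inC m k W (\<lambda>z. F z + G z)"
proof -
  obtain P Q P' Q' where *: "P \<in> W" "Q \<in> W" "P' \<in> W" "Q' \<in> W"
    "\<And>z. F z = pev m k P z + csc \<i> (pev m k Q z)" "\<And>z. G z = pev m k P' z + csc \<i> (pev m k Q' z)"
    using assms(2,3) unfolding inC_def by blast
  have "P + P' \<in> W" "Q + Q' \<in> W" using * assms(1) by (simp_all add: subspace_add)
  then show ?thesis unfolding inC_def
    by (intro bexI[of _ "P + P'"] bexI[of _ "Q + Q'"]) (simp_all add: * pev_add csc_add)
qed

lemma inC_csc:
  assumes "subspace W" "inC m k W F" shows "inC m k W (\<lambda>z. csc c (F z))"
proof -
  obtain P Q where *: "P \<in> W" "Q \<in> W" "\<And>z. F z = pev m k P z + csc \<i> (pev m k Q z)"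
    using assms(2) unfolding inC_def by blast
  let ?P = "Re c *\<^sub>R P - Im c *\<^sub>R Q" and ?Q = "Im c *\<^sub>R P + Re c *\<^sub>R Q"
  have "?P \<in> W" "?Q \<in> W" using * assms(1) by (simp_all add: subspace_add subspace_diff subspace_scale)
  moreover have "csc c (F z) = pev m k ?P z + csc \<i> (pev m k ?Q z)" for z
    unfolding *(3) pev_add pev_diff pev_scale
    by (simp add: csc_def fun_eq_iff fun_apply_simps complex_eq_iff algebra_simps)
  ultimately show ?thesis unfolding inC_def by blast
qed

lemma inC_refl:
  assumes "refl_closed m k W" "W \<subseteq> Pspace m s k" "inC m k W F" "uvec m u"
  shows "inC m k W (\<lambda>z. Lv m (\<lambda>j. of_real (u j)) (F (rv m (\<lambda>j. of_real (u j)) z)))"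
proof -
  obtain P Q where *: "P \<in> W" "Q \<in> W" "\<And>z. F z = pev m k P z + csc \<i> (pev m k Q z)"
    using assms(3) unfolding inC_def by blast
  have PQ: "P \<in> Pspace m s k" "Q \<in> Pspace m s k" using * assms(2) by auto
  have "prefl m k u P \<in> W" "prefl m k u Q \<in> W" using * assms(1,4) by (auto simp: refl_closed_def)
  then show ?thesis unfolding inC_def
    by (intro bexI[of _ "prefl m k u P"] bexI[of _ "prefl m k u Q"])
      (simp_all add: *(3) pev_refl[OF PQ(1)] pev_refl[OF PQ(2)] Lv_add Lv_csc)
qed

definition fF :: "nat \<Rightarrow> nat \<Rightarrow> (nat set \<Rightarrow> complex) \<Rightarrow> (nat \<Rightarrow> complex) \<Rightarrow> nat set \<Rightarrow> complex" where
  "fF m k v = (\<lambda>z. csc (bil m av z ^ k) v)"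

lemma bil_lin_right: "bil m a (rv m u z) = bil m a z - 2 * bil m u z * bil m a u"
proof -
  have "bil m a (rv m u z) = (\<Sum>j<m. a j * z j - 2 * bil m u z * (a j * u j))"
    unfolding bil_def[of m a "rv m u z"] by (simp add: rv_def algebra_simps)
  then show ?thesis unfolding sum_subtractf sum_distrib_left[symmetric] bil_def[symmetric] .
qed

lemma bil_av_0: "2 \<le> m \<Longrightarrow> u 0 = 0 \<Longrightarrow> u 1 = 0 \<Longrightarrow> bil m av u = 0"
  by (simp add: bil_atv)

lemma rv_av: "2 \<le> m \<Longrightarrow> u 0 = 0 \<Longrightarrow> u 1 = 0 \<Longrightarrow> rv m u av = av"
  using bil_av_0[of m u] by (simp add: rv_def bil_commute[of m u])

lemma inC_fF_add: "subspace W \<Longrightarrow> inC m k W (fF m k v) \<Longrightarrow> inC m k W (fF m k w) \<Longrightarrow> inC m k W (fF m k (v + w))"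
  using inC_add[of W m k "fF m k v" "fF m k w"] by (simp add: fF_def csc_add)

lemma inC_fF_csc: "subspace W \<Longrightarrow> inC m k W (fF m k v) \<Longrightarrow> inC m k W (fF m k (csc c v))"
  using inC_csc[of W m k "fF m k v" c] by (simp add: fF_def mult.commute)

text \<open>Such a \<open>u\<close> is orthogonal to \<open>av\<close>, so its reflection leaves the
  scalar factor unchanged and acts on \<open>v\<close> alone.\<close>

lemma inC_fF_refl:
  assumes "2 \<le> m" "refl_closed m k W" "W \<subseteq> Pspace m s k" "inC m k W (fF m k v)" "uvec m u" "u 0 = 0" "u 1 = 0"
  shows "inC m k W (fF m k (Lv m (\<lambda>j. of_real (u j)) v))"
  using inC_refl[OF assms(2-5)] bil_av_0[of m "\<lambda>j. of_real (u j)"] assms(1,6,7)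
  by (simp add: fF_def Lv_csc bil_lin_right)

section \<open>Sign changes and exchanges of the coordinates that leave \<open>av\<close>
  fixed\<close>

definition un :: "nat \<Rightarrow> nat \<Rightarrow> real" where "un j = (\<lambda>i. if i = j then 1 else 0)"

lemma uvec_un: "j < m \<Longrightarrow> uvec m (un j)"
  by (auto simp: uvec_def un_def bil_def if_distrib cong: if_cong)

lemma Lv_un:
  assumes "j < m" shows "Lv m (\<lambda>i. of_real (un j i)) v = (\<lambda>C. if j \<in> C then - v C else v C :: 'a::real_field)"
proof -
  have *: "(\<lambda>i. of_real (un j i)) = (\<lambda>i. if i = j then 1 else 0 :: 'a)" by (auto simp: un_def)
  show ?thesis
    unfolding * Lv_def ew_ev_unit[OF assms, symmetric] iw_iv_unit[OF assms, symmetric]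
    by (auto simp: fun_eq_iff fun_apply_simps csc_def ew_def iw_def sg_remove insert_absorb)
qed

text \<open>Projection to a joint eigenspace of the sign changes with index from \<open>2\<close> to
  \<open>n - 1\<close>, with eigenvalues prescribed by \<open>C0\<close>. The indices
  \<open>0\<close> and \<open>1\<close> are left out because their sign changes move
  \<open>av\<close>.\<close>

definition agree :: "nat \<Rightarrow> nat set \<Rightarrow> (nat set \<Rightarrow> complex) \<Rightarrow> nat set \<Rightarrow> complex" where
  "agree n C0 v = (\<lambda>C. if \<forall>j. 2 \<le> j \<and> j < n \<longrightarrow> (j \<in> C \<longleftrightarrow> j \<in> C0) then v C else 0)"

lemma agree_Suc:
  assumes "2 \<le> n" "n < m"
  shows "agree (Suc n) C0 v = csc (1 / 2) (agree n C0 v + csc (if n \<in> C0 then -1 else 1) (Lv m (\<lambda>i. of_real (un n i)) (agree n C0 v)))"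
proof
  fix C
  have "(\<forall>j. 2 \<le> j \<and> j < Suc n \<longrightarrow> (j \<in> C \<longleftrightarrow> j \<in> C0)) \<longleftrightarrow>
     (\<forall>j. 2 \<le> j \<and> j < n \<longrightarrow> (j \<in> C \<longleftrightarrow> j \<in> C0)) \<and> (n \<in> C \<longleftrightarrow> n \<in> C0)"
    using assms by (auto simp: less_Suc_eq)
  then show "agree (Suc n) C0 v C = csc (1 / 2) (agree n C0 v + csc (if n \<in> C0 then -1 else 1) (Lv m (\<lambda>i. of_real (un n i)) (agree n C0 v))) C"
    unfolding Lv_un[OF assms(2)] by (auto simp: agree_def csc_def fun_apply_simps)
qed

lemma inC_agree:
  assumes W: "2 \<le> m" "subspace W" "refl_closed m k W" "W \<subseteq> Pspace m s k" and v: "inC m k W (fF m k v)"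
  shows "n \<le> m \<Longrightarrow> inC m k W (fF m k (agree n C0 v))"
proof (induction n)
  case 0
  then show ?case using v by (simp add: agree_def)
next
  case (Suc n)
  show ?case
  proof (cases "2 \<le> n")
    case True
    have "un n 0 = 0" "un n 1 = 0" using True by (auto simp: un_def)
    then have "inC m k W (fF m k (Lv m (\<lambda>i. of_real (un n i)) (agree n C0 v)))"
      using inC_fF_refl[OF W(1,3,4) Suc.IH uvec_un[of n m]] Suc.prems by auto
    then show ?thesis unfolding agree_Suc[OF True, of m, simplified Suc_le_eq[symmetric], OF Suc.prems]
      using W(2) Suc.IH Suc.prems by (intro inC_fF_csc inC_fF_add) auto
  next
    case False
    then have "agree (Suc n) C0 v = agree n C0 v" by (intro ext) (use False in \<open>auto simp: agree_def\<close>)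
    then show ?thesis using Suc by simp
  qed
qed

definition bs :: "nat set \<Rightarrow> nat set \<Rightarrow> complex" where
  "bs B = (\<lambda>C. if C = B then 1 else 0)"

lemma ev_av: "2 \<le> m \<Longrightarrow> ev m av v = ew 1 v + csc \<i> (ew 0 v)"
  and iv_av: "2 \<le> m \<Longrightarrow> iv m av v = iw 1 v + csc \<i> (iw 0 v)"
proof -
  assume "2 \<le> m"
  then have m: "{..<m} = insert 0 (insert 1 {2..<m})" by auto
  have "(\<Sum>j=2..<m. csc (av j) (ew j v)) = 0" "(\<Sum>j=2..<m. csc (av j) (iw j v)) = 0"
    by (intro sum.neutral; auto simp: atv_def)+
  then show "ev m av v = ew 1 v + csc \<i> (ew 0 v)" "iv m av v = iw 1 v + csc \<i> (iw 0 v)"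
    unfolding ev_def iv_def m by (simp_all add: atv_def add.commute)
qed

lemma sg_low:
  assumes "B \<subseteq> {2..<m}"
  shows "sg 0 C = (1::complex)" "sg 1 (insert 1 B) = (1::complex)" "sg 1 (insert 0 (insert 1 B)) = (-1::complex)"
    "sg 1 (insert 0 B) = (-1::complex)" "sg 1 B = (1::complex)"
proof -
  have e: "{b \<in> B. b < 1} = {}" using assms by auto
  show 1: "sg 1 B = (1::complex)" by (simp only: sg_def e card.empty power_0)
  have "0 \<notin> B" "1 \<notin> B" using assms by auto
  then show "sg 1 (insert 1 B) = (1::complex)" "sg 1 (insert 0 B) = (-1::complex)"
    "sg 1 (insert 0 (insert 1 B)) = (-1::complex)" using 1 by (simp_all add: sg_insert)
qed (simp add: sg_def)

lemma ev_av_bs: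
  assumes "2 \<le> m" and B: "B \<subseteq> {2..<m}"
  shows "ev m av (bs B) C = (if C = insert 1 B then 1 else if C = insert 0 B then \<i> else 0)"
proof -
  have n: "0 \<notin> B" "1 \<notin> B" using B by auto
  have e1: "ew 1 (bs B) C = (if C = insert 1 B then 1 else 0)"
    using n sg_low(2)[OF B] by (auto simp: ew_def bs_def insert_absorb)
  have e0: "ew 0 (bs B) C = (if C = insert 0 B then 1 else 0)"
    using n sg_low(1)[OF B] by (auto simp: ew_def bs_def insert_absorb)
  have "insert 1 B \<noteq> insert 0 B" using n by auto
  then show ?thesis unfolding ev_av[OF assms(1)] plus_fun_apply csc_def e1 e0 by auto
qed

text \<open>Exterior and interior multiplication by \<open>av\<close> involve only the indices
  \<open>0\<close> and \<open>1\<close>. For each \<open>B\<close> their joint kernel leaves, among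
  the four sets extending \<open>B\<close> by these indices, only multiples of
  \<open>ev m av (bs B)\<close>.\<close>

lemma isotropic_kernel_coords:
  assumes m: "2 \<le> m" and v: "ev m av v = 0" "iv m av v = 0" and B: "B \<subseteq> {2..<m}"
  shows "v B = 0" "v (insert 0 (insert 1 B)) = 0" "v (insert 0 B) = \<i> * v (insert 1 B)"
proof -
  have n: "0 \<notin> B" "1 \<notin> B" using B by auto
  note s = sg_low[OF B]
  have E: "ew 1 v C + \<i> * ew 0 v C = 0" and I: "iw 1 v C + \<i> * iw 0 v C = 0" for C
    using v unfolding ev_av[OF m] iv_av[OF m] by (metis csc_def plus_fun_apply zero_fun_apply)+
  show "v B = 0" using E[of "insert 0 B"] n by (simp add: ew_def s)
  show "v (insert 0 (insert 1 B)) = 0" using I[of "insert 1 B"] n by (simp add: iw_def s)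
  have "insert 0 (insert 1 B) - {1} = insert 0 B" "insert 0 (insert 1 B) - {0} = insert 1 B" using n by auto
  then have "\<i> * v (insert 1 B) - v (insert 0 B) = 0" using E[of "insert 0 (insert 1 B)"] n by (simp add: ew_def s del: One_nat_def)
  then show "v (insert 0 B) = \<i> * v (insert 1 B)" by simp
qed

lemma low_part_cases:
  fixes m :: nat
  assumes "C \<subseteq> {..<m}" "B = C \<inter> {2..<m}"
  shows "C = B \<or> C = insert 0 B \<or> C = insert 1 B \<or> C = insert 0 (insert 1 B)"
proof -
  have C: "C = B \<union> (C \<inter> {0, 1})" using assms by (auto simp: not_le less_2_cases_iff)
  have "C = B" if "0 \<notin> C" "1 \<notin> C" using C that by auto
  moreover have "C = insert 0 B" if "0 \<in> C" "1 \<notin> C" using C that by auto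
  moreover have "C = insert 1 B" if "0 \<notin> C" "1 \<in> C" using C that by auto
  moreover have "C = insert 0 (insert 1 B)" if "0 \<in> C" "1 \<in> C" using C that by auto
  ultimately show ?thesis by blast
qed

text \<open>All sign changes together fix the part \<open>B\<close> of the index set; the kernel
  condition then leaves one degree of freedom, read off at \<open>insert 1 B\<close>.\<close>

lemma agree_isotropic:
  assumes m: "2 \<le> m" and v: "ev m av v = 0" "iv m av v = 0" "supp_in m v" and B: "B = C0 \<inter> {2..<m}"
  shows "agree m C0 v = csc (v (insert 1 B)) (ev m av (bs B))"
proof
  fix C
  have B': "B \<subseteq> {2..<m}" using B by auto
  have n: "0 \<notin> B" "1 \<notin> B" using B' by auto
  note k = isotropic_kernel_coords[OF m v(1,2) B']
  have iff: "(\<forall>j. 2 \<le> j \<and> j < m \<longrightarrow> (j \<in> C \<longleftrightarrow> j \<in> C0)) \<longleftrightarrow> B = C \<inter> {2..<m}"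
    unfolding B set_eq_iff Int_iff atLeastLessThan_iff by blast
  show "agree m C0 v C = csc (v (insert 1 B)) (ev m av (bs B)) C"
  proof (cases "C \<subseteq> {..<m} \<and> B = C \<inter> {2..<m}")
    case True
    have agr: "agree m C0 v C = v C" unfolding agree_def iff by (rule if_P[OF conjunct2[OF True]])
    have ne: "insert 1 B \<noteq> B" "insert 0 B \<noteq> B" "insert 0 (insert 1 B) \<noteq> insert 1 B"
      "insert 0 (insert 1 B) \<noteq> insert 0 B" "insert 0 B \<noteq> insert 1 B"
      using n by (metis insertCI insert_iff zero_neq_one)+
    from low_part_cases[OF conjunct1[OF True] conjunct2[OF True]]
    show ?thesis unfolding agr csc_def ev_av_bs[OF m B']
    proof (elim disjE)
      assume C: "C = B"
      show "v C = v (insert 1 B) * (if C = insert 1 B then 1 else if C = insert 0 B then \<i> else 0)"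
        unfolding C using k(1) ne(1,2)[symmetric] by (simp only: if_False mult_zero_right)
    next
      assume C: "C = insert 0 B"
      show "v C = v (insert 1 B) * (if C = insert 1 B then 1 else if C = insert 0 B then \<i> else 0)"
        unfolding C using k(3) ne(5) by (simp only: if_False if_True mult.commute simp_thms)
    next
      assume C: "C = insert 1 B"
      show "v C = v (insert 1 B) * (if C = insert 1 B then 1 else if C = insert 0 B then \<i> else 0)"
        unfolding C by (simp only: if_True mult_1_right simp_thms)
    next
      assume C: "C = insert 0 (insert 1 B)"
      show "v C = v (insert 1 B) * (if C = insert 1 B then 1 else if C = insert 0 B then \<i> else 0)"
        unfolding C using k(2) ne(3,4) by (simp only: if_False mult_zero_right)
    qed
  next
    case False
    have "insert 1 B \<subseteq> {..<m}" "insert 0 B \<subseteq> {..<m}" "B = insert 1 B \<inter> {2..<m}" "B = insert 0 B \<inter> {2..<m}"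
      using B' m by auto
    then have "ev m av (bs B) C = 0" using False unfolding ev_av_bs[OF m B'] by auto
    moreover have "agree m C0 v C = 0" using False v(3) unfolding agree_def iff supp_in_def by auto
    ultimately show ?thesis by (simp add: csc_def)
  qed
qed

text \<open>This reflection sends \<open>e\<^sub>i\<close> to \<open>- e\<^sub>j\<close> and
  \<open>e\<^sub>j\<close> to \<open>- e\<^sub>i\<close>, and fixes the other generators.\<close>

lemma exchange_reflection:
  assumes "i < m" "j < m" "i \<noteq> j"
  defines "u \<equiv> (\<lambda>l. if l = i \<or> l = j then 1 / sqrt 2 else 0)"
  shows "uvec m u" and "Lv m (\<lambda>l. complex_of_real (u l)) v = v - (ew i (iw i v + iw j v) + ew j (iw i v + iw j v))"
proof -
  have sub: "(\<Sum>l<m. f l) = f i + f j" if "\<And>l. l \<noteq> i \<Longrightarrow> l \<noteq> j \<Longrightarrow> f l = 0" for f :: "nat \<Rightarrow> 'b::comm_monoid_add"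
  proof -
    have "(\<Sum>l<m. f l) = (\<Sum>l\<in>{i, j}. f l)" by (rule sum.mono_neutral_right) (use assms that in auto)
    then show ?thesis using assms(3) by simp
  qed
  have "bil m u u = 1 / sqrt 2 * (1 / sqrt 2) + 1 / sqrt 2 * (1 / sqrt 2)"
    unfolding bil_def by (subst sub) (auto simp: u_def)
  then show "uvec m u" using assms(1,2) by (auto simp: uvec_def u_def)
  define c where "c = complex_of_real (1 / sqrt 2)"
  have c: "2 * (c * c) = 1" unfolding c_def by (simp flip: of_real_mult)
  have "ev m (\<lambda>l. complex_of_real (u l)) v = csc c (ew i v) + csc c (ew j v)" for v
    unfolding ev_def by (subst sub) (auto simp: u_def c_def)
  moreover have "iv m (\<lambda>l. complex_of_real (u l)) v = csc c (iw i v) + csc c (iw j v)" for v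
    unfolding iv_def by (subst sub) (auto simp: u_def c_def)
  ultimately show "Lv m (\<lambda>l. complex_of_real (u l)) v = v - (ew i (iw i v + iw j v) + ew j (iw i v + iw j v))"
    by (simp add: Lv_def csc_add[symmetric] ew_csc c)
qed

lemma iw_bs_notin: "j \<notin> B \<Longrightarrow> iw j (bs B) = 0"
  by (auto simp: iw_def bs_def fun_eq_iff fun_apply_simps)

lemma iw_bs: "i \<in> B \<Longrightarrow> iw i (bs B) = csc (sg i B) (bs (B - {i}))"
  by (auto simp: iw_def bs_def fun_eq_iff fun_apply_simps csc_def sg_remove insert_absorb)

lemma ew_bs: "i \<notin> B \<Longrightarrow> ew i (bs B) = csc (sg i B) (bs (insert i B))"
  by (auto simp: ew_def bs_def fun_eq_iff fun_apply_simps csc_def sg_insert insert_absorb)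

lemma exchange_bs:
  assumes "i < m" "j < m" "i \<in> B" "j \<notin> B"
  defines "u \<equiv> (\<lambda>l. if l = i \<or> l = j then 1 / sqrt 2 else 0)"
  shows "\<exists>c. c \<noteq> 0 \<and> Lv m (\<lambda>l. complex_of_real (u l)) (bs B) = csc c (bs (insert j (B - {i})))"
proof -
  have ij: "i \<noteq> j" using assms by auto
  have "sg i (B - {i}) = (sg i B :: complex)" using assms by (simp add: sg_remove)
  then have "ew i (iw i (bs B)) = bs B"
    using assms by (simp add: iw_bs ew_csc ew_bs insert_absorb)
  moreover have "ew j (iw i (bs B)) = csc (sg i B * sg j (B - {i})) (bs (insert j (B - {i})))"
    using assms by (simp add: iw_bs ew_csc ew_bs)
  ultimately have "Lv m (\<lambda>l. complex_of_real (u l)) (bs B) = csc (- (sg i B * sg j (B - {i}))) (bs (insert j (B - {i})))"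
    using exchange_reflection(2)[OF assms(1,2) ij] iw_bs_notin[OF assms(4)]
    by (simp add: u_def ew_add) (simp add: csc_def fun_eq_iff fun_apply_simps)
  moreover have "- (sg i B * sg j (B - {i})) \<noteq> (0::complex)" by (simp add: sg_def)
  ultimately show ?thesis by blast
qed

lemma inC_exchange:
  assumes W: "2 \<le> m" "subspace W" "refl_closed m k W" "W \<subseteq> Pspace m s k"
    and B: "inC m k W (fF m k (ev m av (bs B)))" "B \<subseteq> {2..<m}" "i \<in> B" "j \<in> {2..<m}" "j \<notin> B"
  shows "inC m k W (fF m k (ev m av (bs (insert j (B - {i})))))"
proof -
  define u where "u = (\<lambda>l. if l = i \<or> l = j then 1 / sqrt 2 else 0 :: real)"
  have ij: "i < m" "j < m" "i \<noteq> j" "2 \<le> i" "2 \<le> j" using B by auto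
  obtain c where c: "c \<noteq> 0" "Lv m (\<lambda>l. complex_of_real (u l)) (bs B) = csc c (bs (insert j (B - {i})))"
    using exchange_bs[OF ij(1,2) B(3,5)] unfolding u_def by blast
  have u: "uvec m u" using exchange_reflection(1)[OF ij(1,2,3)] by (simp add: u_def)
  have u0: "u 0 = 0" "u 1 = 0" using ij by (auto simp: u_def)
  have "inC m k W (fF m k (Lv m (\<lambda>l. complex_of_real (u l)) (ev m av (bs B))))"
    by (rule inC_fF_refl[OF W(1,3,4) B(1) u u0])
  also have "Lv m (\<lambda>l. complex_of_real (u l)) (ev m av (bs B)) = csc c (ev m av (bs (insert j (B - {i}))))"
    using rv_av[OF W(1), of "\<lambda>l. complex_of_real (u l)"] u0 by (simp add: Lv_ev c(2) ev_csc)
  finally have "inC m k W (fF m k (csc (1 / c) (csc c (ev m av (bs (insert j (B - {i})))))))"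
    by (rule inC_fF_csc[OF W(2)])
  then show ?thesis using c(1) by simp
qed

text \<open>Each exchange replaces an index of \<open>B - B'\<close> by one of
  \<open>B' - B\<close>.\<close>

lemma inC_all_bs:
  assumes W: "2 \<le> m" "subspace W" "refl_closed m k W" "W \<subseteq> Pspace m s k"
  shows "inC m k W (fF m k (ev m av (bs B))) \<Longrightarrow> B \<subseteq> {2..<m} \<Longrightarrow> B' \<subseteq> {2..<m} \<Longrightarrow> card B = card B'
    \<Longrightarrow> inC m k W (fF m k (ev m av (bs B')))"
proof (induction "card (B - B')" arbitrary: B)
  case 0
  have fin: "finite B" "finite B'" using 0 by (auto intro: finite_subset)
  then have "B \<subseteq> B'" using 0 by simp
  then have "B = B'" using 0 fin card_subset_eq by blast
  then show ?case using 0 by simp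
next
  case (Suc n)
  have fin: "finite B" "finite B'" using Suc by (auto intro: finite_subset)
  from Suc(2) obtain i where i: "i \<in> B - B'" by (metis all_not_in_conv card.empty nat.distinct(1))
  have "B' - B \<noteq> {}" using i Suc(6) fin by (metis DiffE Diff_eq_empty_iff card_subset_eq)
  then obtain j where j: "j \<in> B' - B" by blast
  let ?B = "insert j (B - {i})"
  have "?B - B' = (B - B') - {i}" using j by auto
  then have n: "n = card (?B - B')" using Suc(2) i fin by simp
  have "i \<in> B" "j \<in> {2..<m}" "j \<notin> B" using i j Suc(5) by auto
  then have inC: "inC m k W (fF m k (ev m av (bs ?B)))" by (rule inC_exchange[OF W Suc(3,4)])
  have "card ?B = Suc (card (B - {i}))" using j fin by (intro card_insert_disjoint) auto
  also have "\<dots> = card B'" using i fin Suc(6) card_Suc_Diff1[of B i] by simp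
  finally have c: "card ?B = card B'" .
  have "?B \<subseteq> {2..<m}" using Suc(4) \<open>j \<in> {2..<m}\<close> by blast
  from Suc(1)[OF n inC this Suc(5) c] show ?case .
qed

section \<open>Support and nonvanishing of \<open>topv\<close>\<close>

lemma supp_ev_iv:
  assumes "\<And>A. p A \<noteq> 0 \<Longrightarrow> A \<subseteq> {..<m} \<and> card A = s" "ev m z (iv m w p) C \<noteq> 0"
  shows "C \<subseteq> {..<m} \<and> card C = s"
proof -
  have "(\<Sum>i<m. \<Sum>j<m. z i * w j * ew i (iw j p) C) \<noteq> 0"
    using assms(2) by (simp add: ev_iv_sum fun_apply_simps csc_def)
  then obtain i where i: "i < m" "(\<Sum>j<m. z i * w j * ew i (iw j p) C) \<noteq> 0"
    by (metis (no_types, lifting) lessThan_iff sum.neutral)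
  then obtain j where j: "j < m" "z i * w j * ew i (iw j p) C \<noteq> 0"
    by (metis (no_types, lifting) lessThan_iff sum.neutral)
  then have *: "i \<in> C" "j \<notin> C - {i}" "p (insert j (C - {i})) \<noteq> 0"
    by (auto simp: ew_def iw_def split: if_splits)
  then have **: "insert j (C - {i}) \<subseteq> {..<m}" "card (insert j (C - {i})) = s" using assms(1) by blast+
  then have "finite (C - {i})" by (metis finite_insert finite_lessThan finite_subset)
  then have "finite C" by simp
  have "card C = card (insert j (C - {i}))"
    using * \<open>finite C\<close> by (metis card.insert card_Suc_Diff1 finite_Diff)
  then show ?thesis using ** * i(1) by auto
qed

lemma pev_supp: "P \<in> Pspace m s k \<Longrightarrow> pev m k P z A \<noteq> 0 \<Longrightarrow> A \<subseteq> {..<m} \<and> card A = s"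
  unfolding pev_def Pspace_iff by (metis (no_types, lifting) mult_eq_0_iff of_real_0 sum.neutral)

lemma topv_facts:
  assumes "2 \<le> m" "P \<in> Pspace m s k"
  shows "ev m av (topv m k P) = 0" "iv m av (topv m k P) = 0" "supp_in m (topv m k P)"
    "\<And>C. topv m k P C \<noteq> 0 \<Longrightarrow> card C = s"
proof -
  have sup: "C \<subseteq> {..<m} \<and> card C = s" if "topv m k P C \<noteq> 0" for C
    using supp_ev_iv[of "pev m k P av" m s av av C] pev_supp[OF assms(2)] that unfolding topv_def by blast
  then show "supp_in m (topv m k P)" "\<And>C. topv m k P C \<noteq> 0 \<Longrightarrow> card C = s"
    unfolding supp_in_def by blast+
qed (use bil_av[OF assms(1)] in \<open>simp_all add: topv_def iv_ev\<close>)

text \<open>After division by \<open>r\<close> the real part is a unit vector \<open>y\<close>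
  orthogonal to \<open>e\<^sub>0\<close>. The Householder reflection in \<open>e\<^sub>1 - y\<close>
  carries \<open>e\<^sub>1\<close> to \<open>y\<close> and fixes \<open>e\<^sub>0\<close>, hence
  carries \<open>av\<close> to the normalised null vector. If \<open>r = 0\<close> or
  \<open>y = e\<^sub>1\<close> no reflection is applied.\<close>

lemma null_vec_reflected:
  assumes m: "2 \<le> m"
  shows "\<exists>r. (\<forall>j<m. null_vec m x j = r * av j) \<or>
    (\<exists>u. uvec m u \<and> (\<forall>j<m. null_vec m x j = r * rv m (\<lambda>j. of_real (u j)) av j))"
proof -
  define r where "r = sqrt (\<Sum>j=1..<m. (x j)\<^sup>2)"
  define y where "y j = (if j = 0 \<or> m \<le> j then 0 else x j / r)" for j
  show ?thesis
  proof (cases "r = 0")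
    case True
    have "x j = 0" if "1 \<le> j" "j < m" for j
    proof -
      have "(\<Sum>j=1..<m. (x j)\<^sup>2) = 0" using True by (simp add: r_def)
      then show ?thesis using that by (simp add: sum_nonneg_eq_0_iff)
    qed
    then have "\<forall>j<m. null_vec m x j = 0 * av j" using True by (auto simp: null_vec_def r_def)
    then show ?thesis by blast
  next
    case False
    have xr: "null_vec m x j = of_real r * (of_real (y j) + (if j = 0 then \<i> else 0))" if "j < m" for j
    proof (cases "j = 0")
      case True
      then show ?thesis by (simp add: null_vec_def r_def y_def)
    next
      case j: False
      then show ?thesis using False that by (simp add: null_vec_def y_def)
    qed
    have r2: "r\<^sup>2 = (\<Sum>j=1..<m. (x j)\<^sup>2)" unfolding r_def by (simp add: sum_nonneg)
    have yy: "bil m y y = 1"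
    proof -
      have "{..<m} = insert 0 {1..<m}" using m by auto
      then have "bil m y y = (\<Sum>j=1..<m. y j * y j)" by (simp add: bil_def) (simp add: y_def)
      also have "\<dots> = (\<Sum>j=1..<m. (x j)\<^sup>2 / r\<^sup>2)"
        by (intro sum.cong) (auto simp: y_def power2_eq_square)
      also have "\<dots> = r\<^sup>2 / r\<^sup>2" by (simp only: sum_divide_distrib[symmetric] r2[symmetric])
      also have "\<dots> = 1" using False by simp
      finally show ?thesis .
    qed
    show ?thesis
    proof (cases "y = un 1")
      case True
      then have "null_vec m x j = of_real r * av j" if "j < m" for j
        using xr[OF that] by (auto simp: un_def atv_def)
      then show ?thesis by blast
    next
      case False
      define d where "d j = un 1 j - y j" for j
      have d1: "bil m (un 1) w = w 1" for w using m by (simp add: bil_def un_def if_distrib if_distribR cong: if_cong)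
      have dw: "bil m d w = w 1 - bil m y w" for w
        using d1[of w] by (simp add: bil_def d_def algebra_simps sum_subtractf)
      have dd: "bil m d d = 2 - 2 * y 1"
      proof -
        have "bil m y d = y 1 - 1" using d1[of y] yy
          by (simp add: bil_def d_def algebra_simps sum_subtractf mult.commute[of _ "un 1 _"])
        then show ?thesis using dw[of d] by (simp add: d_def un_def)
      qed
      have pos: "bil m d d > 0"
      proof -
        obtain j where j: "y j \<noteq> un 1 j" using False by auto
        then have "j < m" using m by (auto simp: y_def un_def split: if_splits)
        then have "0 < (\<Sum>j<m. d j * d j)"
          by (intro sum_pos2[of _ j]) (use j in \<open>auto simp: d_def zero_less_mult_iff linorder_neq_iff\<close>)
        then show ?thesis by (simp add: bil_def)
      qed
      define n where "n = sqrt (bil m d d)"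
      have n: "n * n = bil m d d" "n \<noteq> 0" using pos by (simp_all add: n_def)
      define u where "u j = d j / n" for j
      have "bil m u u = bil m d d / (n * n)" by (simp add: bil_def u_def sum_divide_distrib)
      then have "uvec m u" using n pos m by (auto simp: uvec_def u_def d_def un_def y_def)
      have "rv m (\<lambda>j. of_real (u j)) av j = of_real (y j) + (if j = 0 then \<i> else 0)" for j
      proof -
        have "bil m (\<lambda>j. of_real (u j)) av = of_real (u 1) + \<i> * of_real (u 0)"
          using m by (simp add: bil_commute[of m _ av] bil_atv)
        also have "u 0 = 0" by (simp add: u_def d_def un_def y_def)
        also have "u 1 = (1 - y 1) / n" by (simp add: u_def d_def un_def)
        finally have "rv m (\<lambda>j. of_real (u j)) av j = av j - of_real (2 * ((1 - y 1) / n) * (d j / n))"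
          by (simp add: rv_def u_def)
        also have "2 * ((1 - y 1) / n) * (d j / n) = d j * ((2 - 2 * y 1) / (n * n))" by (simp add: field_simps)
        also have "(2 - 2 * y 1) / (n * n) = 1" unfolding dd[symmetric] n(1)[symmetric] using n(2) by simp
        finally show ?thesis by (auto simp: d_def un_def atv_def y_def)
      qed
      then have "\<forall>j<m. null_vec m x j = of_real r * rv m (\<lambda>j. of_real (u j)) av j" using xr by simp
      then show ?thesis using \<open>uvec m u\<close> by blast
    qed
  qed
qed

lemma ev_cong: "(\<And>j. j < m \<Longrightarrow> x j = y j) \<Longrightarrow> ev m x v = ev m y v"
  and iv_cong: "(\<And>j. j < m \<Longrightarrow> x j = y j) \<Longrightarrow> iv m x v = iv m y v"
  by (simp_all add: ev_def iv_def)

text \<open>Reflections move evaluation at any null vector to evaluation at \<open>av\<close>. If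
  \<open>topv\<close> were zero on all of \<open>W\<close>, closure under reflections would make
  \<open>HH_nonvanishing\<close> applicable to every element.\<close>

lemma topv_nonzero:
  assumes s: "1 \<le> s" "s < m" and W: "W \<subseteq> HH m s k" "refl_closed m k W" "W \<noteq> {}" "W \<noteq> {0}"
  shows "\<exists>P\<in>W. topv m k P \<noteq> 0"
proof (rule ccontr)
  assume "\<not> ?thesis"
  then have z: "\<And>P. P \<in> W \<Longrightarrow> topv m k P = 0" by blast
  have m: "2 \<le> m" using s by simp
  obtain P where P: "P \<in> W" "P \<noteq> 0" using W by blast
  have PP: "P \<in> Pspace m s k" using P W by (auto simp: HH_def)
  have van: "ev m (null_vec m x) (iv m (null_vec m x) (pev m k P (null_vec m x))) = 0" for x
  proof -
    have scale: "ev m (null_vec m x) (iv m (null_vec m x) (pev m k P (null_vec m x))) =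
      csc (r * r * r ^ k) (ev m c (iv m c (pev m k P c)))" if "\<forall>j<m. null_vec m x j = r * c j" for r c
    proof -
      have "pev m k P (null_vec m x) = pev m k P (\<lambda>j. r * c j)" by (rule pev_cong) (use that in simp)
      moreover have "ev m (null_vec m x) v = csc r (ev m c v)" for v
        unfolding ev_scale[symmetric] by (rule ev_cong) (use that in simp)
      moreover have "iv m (null_vec m x) v = csc r (iv m c v)" for v
        unfolding iv_scale[symmetric] by (rule iv_cong) (use that in simp)
      ultimately show ?thesis by (simp add: pev_homogeneous ev_csc iv_csc mult_ac)
    qed
    obtain r where "(\<forall>j<m. null_vec m x j = r * av j) \<or>
      (\<exists>u. uvec m u \<and> (\<forall>j<m. null_vec m x j = r * rv m (\<lambda>j. of_real (u j)) av j))"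
      using null_vec_reflected[OF m, of x] by auto
    then show ?thesis
    proof (elim disjE exE conjE)
      assume "\<forall>j<m. null_vec m x j = r * av j"
      then show ?thesis using scale[of r av] z[OF P(1)] by (simp add: topv_def)
    next
      fix u assume u: "uvec m u" and e: "\<forall>j<m. null_vec m x j = r * rv m (\<lambda>j. of_real (u j)) av j"
      let ?u = "\<lambda>j. complex_of_real (u j)"
      have uu: "bil m ?u ?u = 1" using u bil_of_real[of m u u, where ?'a = complex] by (simp add: uvec_def)
      let ?c = "rv m ?u av"
      have "topv m k (prefl m k u P) = 0" using z W(2) u P(1) by (auto simp: refl_closed_def)
      then have "ev m av (iv m av (Lv m ?u (pev m k P ?c))) = 0" by (simp add: topv_def pev_refl[OF PP])
      moreover have "Lv m ?u (ev m ?c (iv m ?c p)) = ev m av (iv m av (Lv m ?u p))" for p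
        by (simp add: Lv_ev Lv_iv[OF uu] rv_rv[OF uu])
      ultimately have "Lv m ?u (Lv m ?u (ev m ?c (iv m ?c (pev m k P ?c)))) = 0" by simp
      then have "ev m ?c (iv m ?c (pev m k P ?c)) = 0" by (simp add: Lv_Lv[OF uu])
      then show ?thesis using scale[OF e] by simp
    qed
  qed
  have "P = 0" by (rule HH_nonvanishing[OF s _ van]) (use P W(1) in blast)
  with P(2) show False ..
qed

lemma subspace_gact:
  "subspace W \<Longrightarrow> refl_closed m k W \<Longrightarrow> 2 \<le> m \<Longrightarrow> P \<in> W \<Longrightarrow> gact m k N w P \<in> W"
  unfolding gact_def by (intro subspace_sum subspace_scale) (auto simp: refl_closed_def uvec_ut)

lemma inC_topv:
  assumes "subspace W" "refl_closed m k W" "2 \<le> m" "W \<subseteq> Pspace m s k" "P \<in> W"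
  shows "inC m k W (fF m k (topv m k P))"
proof -
  have PP: "P \<in> Pspace m s k" using assms(4,5) by blast
  obtain w1 w2 where w': "\<forall>m s k' P z. P \<in> Pspace m s k' \<longrightarrow> k' + 1 \<le> k + 1 \<longrightarrow>
      pev m k' (gact m k' (2 * (k + 1)) w1 P) z + csc \<i> (pev m k' (gact m k' (2 * (k + 1)) w2 P) z) =
      (if k + 1 = k' + 1 then csc ((-2) ^ (k' + 1) * bil m av z ^ k') (topv m k' P) else 0)"
    using isotropic_interpolation[of "k + 1"] by (elim exE)
  have w: "pev m k (gact m k (2 * (k + 1)) w1 P) z + csc \<i> (pev m k (gact m k (2 * (k + 1)) w2 P) z) =
      csc ((-2) ^ (k + 1) * bil m av z ^ k) (topv m k P)" for z
    using w'[rule_format, OF PP] by simp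
  have "inC m k W (fF m k (csc ((-2) ^ (k + 1)) (topv m k P)))"
    unfolding inC_def
  proof (rule bexI, rule bexI)
    show "\<forall>z. fF m k (csc ((-2) ^ (k + 1)) (topv m k P)) z =
      pev m k (gact m k (2 * (k + 1)) w1 P) z + csc \<i> (pev m k (gact m k (2 * (k + 1)) w2 P) z)"
      unfolding w fF_def csc_csc by (simp only: mult.commute simp_thms)
  qed (intro subspace_gact assms)+
  from inC_fF_csc[OF assms(1) this, of "1 / (-2) ^ (k + 1)"] show ?thesis by simp
qed

lemma inC_bs:
  assumes s: "1 \<le> s" "s < m" and W: "subspace W" "W \<subseteq> HH m s k" "refl_closed m k W" "W \<noteq> {0}"
    and B: "B \<subseteq> {2..<m}" "card B = s - 1"
  shows "inC m k W (fF m k (ev m av (bs B)))"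
proof -
  have m: "2 \<le> m" using s by simp
  have WP: "W \<subseteq> Pspace m s k" using W(2) by (auto simp: HH_def)
  have "W \<noteq> {}" using subspace_0[OF W(1)] by blast
  then obtain P where P: "P \<in> W" "topv m k P \<noteq> 0" using topv_nonzero[OF s W(2,3)] W(4) by blast
  have PP: "P \<in> Pspace m s k" using P WP by blast
  note t = topv_facts[OF m PP]
  obtain C0 where C0: "topv m k P C0 \<noteq> 0" using P(2) by (auto simp: fun_eq_iff fun_apply_simps)
  define B0 where "B0 = C0 \<inter> {2..<m}"
  have B0: "B0 \<subseteq> {2..<m}" by (auto simp: B0_def)
  have "C0 \<subseteq> {..<m}" using t(3) C0 by (auto simp: supp_in_def)
  \<comment> \<open>\<open>C0\<close> contains exactly one of \<open>0\<close> and \<open>1\<close>,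
    and the coordinates at \<open>insert 0 B0\<close> and \<open>insert 1 B0\<close> differ by the
    factor \<open>\<i>\<close>.\<close>
  from low_part_cases[OF this B0_def] isotropic_kernel_coords[OF m t(1,2) B0] C0
  have ne: "topv m k P (insert 1 B0) \<noteq> 0" by auto
  have "finite B0" "1 \<notin> B0" using B0 by (auto intro: finite_subset)
  then have "card B0 = s - 1" using t(4)[OF ne] by simp
  have "inC m k W (fF m k (agree m C0 (topv m k P)))"
    using inC_agree[OF m W(1,3) WP inC_topv[OF W(1,3) m WP P(1)]] by simp
  then have "inC m k W (fF m k (csc (topv m k P (insert 1 B0)) (ev m av (bs B0))))"
    unfolding agree_isotropic[OF m t(1-3) B0_def] .
  from inC_fF_csc[OF W(1) this, of "1 / topv m k P (insert 1 B0)"] ne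
  have "inC m k W (fF m k (ev m av (bs B0)))" by simp
  then show ?thesis using inC_all_bs[OF m W(1,3) WP _ B0 B(1)] B(2) \<open>card B0 = s - 1\<close> by simp
qed

section \<open>Minimality of the spaces \<open>HH\<close>\<close>

lemma pev_complex_inject:
  assumes P: "P \<in> Pspace m s k" "Q \<in> Pspace m s k" "P' \<in> Pspace m s k" "Q' \<in> Pspace m s k"
    and eq: "\<And>z. pev m k P z + csc \<i> (pev m k Q z) = pev m k P' z + csc \<i> (pev m k Q' z)"
  shows "P = P'" "Q = Q'"
proof -
  have "pev m k P x A = pev m k P' x A \<and> pev m k Q x A = pev m k Q' x A" for x :: "nat \<Rightarrow> real" and A
  proof -
    have "pev m k P (\<lambda>j. complex_of_real (x j)) A + \<i> * pev m k Q (\<lambda>j. complex_of_real (x j)) A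
      = pev m k P' (\<lambda>j. complex_of_real (x j)) A + \<i> * pev m k Q' (\<lambda>j. complex_of_real (x j)) A"
      using arg_cong[OF eq[of "\<lambda>j. complex_of_real (x j)"], of "\<lambda>v. v A"] unfolding plus_fun_apply csc_def .
    then show ?thesis unfolding pev_of_real by (simp add: complex_eq_iff)
  qed
  then have "pev m k P x = pev m k P' x" "pev m k Q x = pev m k Q' x" for x :: "nat \<Rightarrow> real" by (blast intro: ext)+
  then show "P = P'" "Q = Q'" using pev_inject[OF P(1,3)] pev_inject[OF P(2,4)] by blast+
qed

lemma HH_minimal_generic:
  assumes s: "1 \<le> s" "s < m" and W: "subspace W" "W \<subseteq> HH m s k" "refl_closed m k W" "W \<noteq> {0}"
  shows "W = HH m s k"
proof (rule ccontr)
  assume "W \<noteq> HH m s k"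
  then obtain P where P: "P \<in> HH m s k" "P \<notin> W" using W by blast
  have m: "2 \<le> m" using s by simp
  have HP: "HH m s k \<subseteq> Pspace m s k" by (auto simp: HH_def)
  have WP: "W \<subseteq> Pspace m s k" using W(2) HP by blast
  define U where "U = {Q \<in> HH m s k. \<forall>R\<in>W. ip m k Q R = 0}"
  have U: "subspace U" unfolding subspace_def U_def
    using subspace_HH[of m s k] by (auto simp: subspace_0 subspace_add subspace_scale ip_add_left ip_scale_left)
  have "refl_closed m k U" unfolding refl_closed_def
  proof safe
    fix u Q assume u: "uvec m u" and Q: "Q \<in> U"
    have uu: "bil m u u = 1" using u by (simp add: uvec_def)
    have QH: "Q \<in> HH m s k" using Q by (simp add: U_def)
    have "ip m k (prefl m k u Q) R = 0" if R: "R \<in> W" for R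
    proof -
      have RP: "R \<in> Pspace m s k" and QP: "Q \<in> Pspace m s k" using R WP QH HP by auto
      have "ip m k (prefl m k u Q) (prefl m k u (prefl m k u R)) = ip m k Q (prefl m k u R)"
        by (rule ip_refl[OF uu QP refl_Pspace[OF RP]])
      also have "\<dots> = 0" using Q W(3) u R by (auto simp: U_def refl_closed_def)
      finally show ?thesis by (simp add: refl_refl[OF uu RP])
    qed
    then show "prefl m k u Q \<in> U" using refl_HH[OF uu QH] by (simp add: U_def)
  qed
  moreover have "U \<noteq> {0}"
  proof -
    obtain Q where Q: "Q \<in> W" "\<And>R. R \<in> W \<Longrightarrow> ip m k (P - Q) R = 0"
      using ip_projection[OF W(1) WP, of P] P(1) HP by blast
    have "P - Q \<in> U" using P(1) Q W(2) subspace_diff[OF subspace_HH] by (auto simp: U_def)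
    moreover have "P - Q \<noteq> 0" using P(2) Q(1) by auto
    ultimately show ?thesis by blast
  qed
  moreover have UH: "U \<subseteq> HH m s k" by (auto simp: U_def)
  \<comment> \<open>Any \<open>s - 1\<close> indices from \<open>2\<close> on would do; they exist
    because \<open>s < m\<close>.\<close>
  define B where "B = {2..<s + 1}"
  have B: "B \<subseteq> {2..<m}" "card B = s - 1" using s by (auto simp: B_def)
  have "inC m k W (fF m k (ev m av (bs B)))" by (rule inC_bs[OF s W B])
  then obtain P1 Q1 where 1: "P1 \<in> W" "Q1 \<in> W" "\<And>z. fF m k (ev m av (bs B)) z = pev m k P1 z + csc \<i> (pev m k Q1 z)"
    unfolding inC_def by blast
  have "inC m k U (fF m k (ev m av (bs B)))"
    using calculation by (intro inC_bs[OF s U UH _ _ B])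
  then obtain P2 Q2 where 2: "P2 \<in> U" "Q2 \<in> U" "\<And>z. fF m k (ev m av (bs B)) z = pev m k P2 z + csc \<i> (pev m k Q2 z)"
    unfolding inC_def by blast
  have Ps: "P1 \<in> Pspace m s k" "Q1 \<in> Pspace m s k" "P2 \<in> Pspace m s k" "Q2 \<in> Pspace m s k"
    using 1 2 WP UH HP by auto
  have eq: "P1 = P2" "Q1 = Q2"
    using pev_complex_inject[OF Ps] 1(3) 2(3) by metis+
  have "ip m k P1 P1 = 0" "ip m k Q1 Q1 = 0" using 1 2 unfolding eq by (auto simp: U_def)
  then have "P1 = 0" "Q1 = 0" using ip_definite Ps by blast+
  then have "fF m k (ev m av (bs B)) z = 0" for z using 1(3) by simp
  \<comment> \<open>At \<open>z = e\<^sub>1\<close> one has \<open>bil m av z = 1\<close>, and the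
    coordinate at \<open>insert 1 B\<close> is \<open>1\<close>, a contradiction.\<close>
  then have "fF m k (ev m av (bs B)) (\<lambda>j. if j = 1 then 1 else 0) (insert 1 B) = 0" by (simp add: fun_apply_simps)
  then show False using m by (simp add: fF_def csc_def bil_atv ev_av_bs[OF m B(1)])
qed

text \<open>The constants of grade \<open>0\<close> or \<open>m\<close> form a space of dimension at
  most one, so minimality is elementary there.\<close>

lemma Pspace_0_extreme:
  assumes "s = 0 \<or> s = m"
  shows "\<exists>\<alpha> A. \<forall>P\<in>Pspace m s 0. \<forall>\<beta> B. P \<beta> B \<noteq> 0 \<longrightarrow> \<beta> = \<alpha> \<and> B = A"
proof -
  define A where "A = (if s = 0 then {} else {..<m})"
  have "B = A" if "B \<subseteq> {..<m}" "card B = s" for B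
  proof -
    have "finite B" using that finite_subset by blast
    then show ?thesis using that assms card_subset_eq[of "{..<m}" B] by (auto simp: A_def)
  qed
  note A = this
  have "\<beta> = (\<lambda>_. 0) \<and> B = A" if P: "P \<in> Pspace m s 0" and ne: "P \<beta> B \<noteq> 0" for P \<beta> B
  proof -
    have "\<beta> \<in> mindices m 0 \<and> B \<subseteq> {..<m} \<and> card B = s"
      using P[unfolded Pspace_iff, rule_format, OF ne] .
    then show ?thesis using A by (simp add: mindices_0)
  qed
  then show ?thesis by (intro exI[of _ "\<lambda>_. 0"] exI[of _ A]) simp
qed

text \<open>In grade \<open>0\<close> the operator \<open>oJ\<close> kills \<open>P\<close>, in
  grade \<open>m\<close> the operator \<open>oX\<close> does; yet \<open>oD oJ\<close>, respectively
  \<open>oC oX\<close>, multiplies \<open>P\<close> by \<open>k\<close>.\<close>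

lemma HH_extreme:
  assumes "s = 0 \<or> s = m" "0 < k" shows "HH m s k = {0}"
proof -
  have "P = 0" if P: "P \<in> HH m s k" for P
    using assms(1)
  proof
    assume "s = 0"
    then have "oJ m P = 0" using oJ_Pspace_0 HH_Pspace[OF P] by blast
    then show ?thesis using HH_DJ[OF P] assms(2) \<open>s = 0\<close> by (simp add: ops_linear)
  next
    assume "s = m"
    then have "oX m P = 0" using Pspace_gt[OF HH_oX_Pspace[OF P]] by simp
    then show ?thesis using HH_CX[OF P] assms(2) \<open>s = m\<close> by (simp add: ops_linear)
  qed
  then show ?thesis using subspace_0[OF subspace_HH] by blast
qed

lemma HH_minimal:
  assumes s: "s \<le> m" and W: "subspace W" "W \<subseteq> HH m s k" "refl_closed m k W"
  shows "W = {0} \<or> W = HH m s k"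
proof (cases "1 \<le> s \<and> s < m")
  case True
  then show ?thesis using HH_minimal_generic[OF _ _ W] by blast
next
  case False
  then have ex: "s = 0 \<or> s = m" using s by linarith
  show ?thesis
  proof (cases "0 < k")
    case True
    then show ?thesis using HH_extreme[OF ex True] W(2) subspace_0[OF W(1)] by blast
  next
    case False
    then have k: "k = 0" by simp
    from Pspace_0_extreme[OF ex] obtain \<alpha> A where
      *: "\<forall>P\<in>Pspace m s 0. \<forall>\<beta> B. P \<beta> B \<noteq> 0 \<longrightarrow> \<beta> = \<alpha> \<and> B = A" by (elim exE)
    note 1 = *[rule_format]
    have "HH m s k \<subseteq> W" if P: "P \<in> W" "P \<noteq> 0" for P
    proof
      fix Q assume "Q \<in> HH m s k"
      then have PQ: "P \<in> Pspace m s 0" "Q \<in> Pspace m s 0" using P W(2) unfolding k HH_def by auto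
      obtain \<gamma> C where "P \<gamma> C \<noteq> 0" using P(2) by (auto simp: fun_eq_iff fun_apply_simps)
      with 1[OF PQ(1) this] have PA: "P \<alpha> A \<noteq> 0" by metis
      have "Q \<beta> B = (Q \<alpha> A / P \<alpha> A) * P \<beta> B" for \<beta> B
      proof (cases "\<beta> = \<alpha> \<and> B = A")
        case True
        then show ?thesis using PA by (metis nonzero_eq_divide_eq)
      next
        case False
        then have "P \<beta> B = 0" "Q \<beta> B = 0" using 1[OF PQ(1)] 1[OF PQ(2)] by metis+
        then show ?thesis by (simp only: mult_zero_right)
      qed
      note pointwise = this
      have e: "Q = (Q \<alpha> A / P \<alpha> A) *\<^sub>R P"
        unfolding fun_eq_iff scaleR_fun_apply real_scaleR_def by (intro allI) (rule pointwise)
      show "Q \<in> W" by (subst e) (rule subspace_scale[OF W(1) P(1)])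
    qed
    then show ?thesis using W(2) subspace_0[OF W(1)] by blast
  qed
qed

text \<open>Injectivity and equivariance are asked for on \<open>HH m s' k'\<close> only. Such a map
  pulls questions about a summand back to this space, of possibly different grade and
  degree.\<close>

definition intertwines :: "nat \<Rightarrow> nat \<Rightarrow> nat \<Rightarrow> nat \<Rightarrow> nat \<Rightarrow> (cpoly \<Rightarrow> cpoly) \<Rightarrow> bool" where
  "intertwines m s' k' s k \<phi> \<longleftrightarrow> s' \<le> m \<and> linear \<phi> \<and> (\<forall>h\<in>HH m s' k'. \<phi> h \<in> Pspace m s k \<and> (\<phi> h = 0 \<longrightarrow> h = 0) \<and>
     (\<forall>u. uvec m u \<longrightarrow> \<phi> (prefl m k' u h) = prefl m k u (\<phi> h)))"

lemma refl_closed_HH: "refl_closed m k (HH m s k)"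
  by (simp add: refl_closed_def uvec_def refl_HH)

context
  fixes m s' k' s k :: nat and \<phi> :: "cpoly \<Rightarrow> cpoly"
  assumes tw: "intertwines m s' k' s k \<phi>"
begin

lemma intertwines_subspace: "subspace (\<phi> ` HH m s' k')"
  using tw by (intro linear_subspace_image subspace_HH) (simp add: intertwines_def)

lemma intertwines_Pspace: "\<phi> ` HH m s' k' \<subseteq> Pspace m s k"
  using tw by (auto simp: intertwines_def)

lemma intertwines_refl_closed: "refl_closed m k (\<phi> ` HH m s' k')"
  unfolding refl_closed_def
proof (intro allI impI)
  fix u P assume "uvec m u \<and> P \<in> \<phi> ` HH m s' k'"
  then obtain h where h: "uvec m u" "h \<in> HH m s' k'" "P = \<phi> h" by blast
  then have "prefl m k u P = \<phi> (prefl m k' u h)" using tw by (simp add: intertwines_def)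
  moreover have "prefl m k' u h \<in> HH m s' k'" using h refl_HH by (simp add: uvec_def)
  ultimately show "prefl m k u P \<in> \<phi> ` HH m s' k'" by blast
qed

lemma H_irreducible_image:
  assumes "\<phi> ` HH m s' k' \<noteq> {0}"
  shows "H_irreducible m k (\<phi> ` HH m s' k')"
  unfolding H_irreducible_def psubspace_eq pzero_eq
proof (intro conjI allI impI)
  show "H_invariant m k (\<phi> ` HH m s' k')"
    using H_invariant_iff[OF intertwines_subspace intertwines_Pspace] intertwines_refl_closed by blast
  fix W assume W: "subspace W \<and> W \<subseteq> \<phi> ` HH m s' k' \<and> H_invariant m k W"
  then have Wr: "refl_closed m k W" using H_invariant_iff[of W m s k] intertwines_Pspace by blast
  have lin: "linear \<phi>" using tw by (simp add: intertwines_def)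
  \<comment> \<open>The preimage of \<open>W\<close> is an invariant subspace of the source, where
    \<open>HH_minimal\<close> applies.\<close>
  define U where "U = {h \<in> HH m s' k'. \<phi> h \<in> W}"
  have "subspace U" unfolding subspace_def U_def
    using subspace_HH[of m s' k'] W
    by (auto simp: subspace_0 subspace_add subspace_scale linear_0[OF lin] linear_add[OF lin] linear_cmul[OF lin])
  moreover have "refl_closed m k' U" unfolding refl_closed_def
  proof (intro allI impI)
    fix u h assume *: "uvec m u \<and> h \<in> U"
    then have "\<phi> (prefl m k' u h) = prefl m k u (\<phi> h)" using tw by (simp add: intertwines_def U_def)
    then show "prefl m k' u h \<in> U" using * Wr refl_closed_HH[of m k' s'] by (simp add: U_def refl_closed_def)
  qed
  moreover have "U \<subseteq> HH m s' k'" by (auto simp: U_def)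
  ultimately have "U = {0} \<or> U = HH m s' k'" using tw by (intro HH_minimal) (simp add: intertwines_def)
  moreover have "W = \<phi> ` U" using W by (auto simp: U_def)
  ultimately show "W = {0} \<or> W = \<phi> ` HH m s' k'" using linear_0[OF lin] by auto
qed (use assms intertwines_subspace in auto)

lemma intertwines_gact:
  assumes "2 \<le> m" "h \<in> HH m s' k'" shows "\<phi> (gact m k' N w h) = gact m k N w (\<phi> h)"
proof -
  have lin: "linear \<phi>" using tw by (simp add: intertwines_def)
  have comm: "\<phi> (prefl m k' u h) = prefl m k u (\<phi> h)" if "uvec m u" for u
    using tw assms(2) that unfolding intertwines_def by blast
  show ?thesis
    by (simp only: gact_def linear_sum[OF lin] linear_cmul[OF lin] comm[OF uvec_ut[OF assms(1)]])
qed

end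

section \<open>Inequivalence\<close>

lemma gact_Pspace: "P \<in> Pspace m s k \<Longrightarrow> gact m k N w P \<in> Pspace m s k"
  unfolding gact_def by (intro Pspace_sum Pspace_scale refl_Pspace)

lemma HH_nonzero_range: "HH m s k \<noteq> {0} \<Longrightarrow> 0 < k \<Longrightarrow> 1 \<le> s \<and> s < m"
  using HH_extreme[of s m k] HH_gt[of m s k] by (metis le_less_linear less_one linorder_cases)

text \<open>Interpolation with exponent \<open>n + 1\<close>. Below degree \<open>n\<close> the
  complex identity is zero and its real and imaginary parts vanish separately; in degree
  \<open>n\<close> an element with nonzero \<open>topv\<close> is not killed by both parts.\<close>

lemma separating_gact:
  obtains w1 w2 where
    "\<And>m s k h w. \<lbrakk>k < n; h \<in> HH m s k; w \<in> {w1, w2}\<rbrakk> \<Longrightarrow> gact m k (2 * (n + 1)) w h = 0"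
    "\<And>m s. \<lbrakk>HH m s n \<noteq> {0}; 0 < n\<rbrakk> \<Longrightarrow> \<exists>w\<in>{w1, w2}. \<exists>h\<in>HH m s n. gact m n (2 * (n + 1)) w h \<noteq> 0"
    "\<And>m s P z. P \<in> Pspace m s n \<Longrightarrow> pev m n (gact m n (2 * (n + 1)) w1 P) z + csc \<i> (pev m n (gact m n (2 * (n + 1)) w2 P) z)
      = csc ((-2) ^ (n + 1) * bil m av z ^ n) (topv m n P)"
proof -
  obtain w1 w2 where w: "\<forall>m s k P z. P \<in> Pspace m s k \<longrightarrow> k + 1 \<le> n + 1 \<longrightarrow>
      pev m k (gact m k (2 * (n + 1)) w1 P) z + csc \<i> (pev m k (gact m k (2 * (n + 1)) w2 P) z) =
      (if n + 1 = k + 1 then csc ((-2) ^ (k + 1) * bil m av z ^ k) (topv m k P) else 0)"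
    using isotropic_interpolation[of "n + 1"] by (elim exE)
  have eq: "pev m n (gact m n (2 * (n + 1)) w1 P) z + csc \<i> (pev m n (gact m n (2 * (n + 1)) w2 P) z)
      = csc ((-2) ^ (n + 1) * bil m av z ^ n) (topv m n P)" if "P \<in> Pspace m s n" for m s P z
    using w[rule_format, OF that] by simp
  show ?thesis
  proof (rule that[of w1 w2])
    fix m s k h w assume *: "k < n" "h \<in> HH m s k" "w \<in> {w1, w2}"
    have h: "h \<in> Pspace m s k" using * by (simp add: HH_def)
    have e: "pev m k (gact m k (2 * (n + 1)) w1 h) z + csc \<i> (pev m k (gact m k (2 * (n + 1)) w2 h) z)
        = pev m k 0 z + csc \<i> (pev m k 0 z)" for z
      using w[rule_format, OF h, of z] *(1) by simp
    have "gact m k (2 * (n + 1)) w1 h = 0" "gact m k (2 * (n + 1)) w2 h = 0"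
      by (rule pev_complex_inject[OF gact_Pspace[OF h] gact_Pspace[OF h] Pspace_0 Pspace_0 e])+
    then show "gact m k (2 * (n + 1)) w h = 0" using *(3) by auto
  next
    fix m s assume H: "HH m s n \<noteq> {0}" and n: "0 < n"
    have s: "1 \<le> s" "s < m" using HH_nonzero_range[OF H n] by auto
    have "HH m s n \<noteq> {}" using subspace_0[OF subspace_HH] by blast
    then obtain h where h: "h \<in> HH m s n" "topv m n h \<noteq> 0"
      using topv_nonzero[OF s subset_refl refl_closed_HH] H by blast
    have hP: "h \<in> Pspace m s n" using h by (simp add: HH_def)
    show "\<exists>w\<in>{w1, w2}. \<exists>h\<in>HH m s n. gact m n (2 * (n + 1)) w h \<noteq> 0"
    proof (rule ccontr)
      assume "\<not> ?thesis"
      then have z: "gact m n (2 * (n + 1)) w1 h = 0" "gact m n (2 * (n + 1)) w2 h = 0" using h by auto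
      have m: "2 \<le> m" using s by simp
      have "csc ((-2) ^ (n + 1) * bil m av (\<lambda>j. if j = 1 then 1 else 0) ^ n) (topv m n h) = 0"
        unfolding eq[OF hP, symmetric] z by simp
      then have "csc ((-2) ^ (n + 1)) (topv m n h) = 0" by (simp add: bil_atv[OF m])
      then have "csc (1 / (-2) ^ (n + 1)) (csc ((-2) ^ (n + 1)) (topv m n h)) = 0" by simp
      then show False using h(2) by simp
    qed
  qed (rule eq)
qed

definition flipsum :: "nat \<Rightarrow> nat \<Rightarrow> nat set \<Rightarrow> cpoly \<Rightarrow> cpoly" where
  "flipsum m k J P = (\<Sum>j\<in>J. prefl m k (un j) P)"

text \<open>On constants a sign change is \<open>P - 2 pE j (pI j P)\<close>, and the sum is
  \<open>m P - 2 numE m P\<close>. The eigenvalue determines \<open>s\<close>.\<close>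

lemma flipsum_all:
  assumes P: "P \<in> Pspace m s 0"
  shows "flipsum m 0 {..<m} P = (real m - 2 * real s) *\<^sub>R P"
proof -
  have "prefl m 0 (un j) P = P - 2 *\<^sub>R pE j (pI j P)" if j: "j < m" for j
  proof -
    have "(\<Sum>i<m. \<Sum>l<m. (un j i * un j l) *\<^sub>R pE i (pI l P)) = (\<Sum>i<m. \<Sum>l<m. if i = j then if l = j then pE i (pI l P) else 0 else 0)"
      by (intro sum.cong) (auto simp: un_def)
    also have "\<dots> = (\<Sum>i<m. if i = j then pE i (pI j P) else 0)" using j by (intro sum.cong) auto
    also have "\<dots> = pE j (pI j P)" using j by simp
    finally show ?thesis by (simp add: prefl_def pL_eq)
  qed
  then have "flipsum m 0 {..<m} P = real m *\<^sub>R P - 2 *\<^sub>R numE m P"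
    by (simp add: flipsum_def sum_subtractf numE_def sum_constant_scaleR scaleR_sum_right del: sum_constant)
  then show ?thesis by (simp add: numE_Pspace[OF P] scaleR_left_diff_distrib)
qed

text \<open>Every index set in the support of \<open>topv\<close> contains exactly one of
  \<open>0\<close> and \<open>1\<close>, hence \<open>s - 1\<close> of the other
  \<open>m - 2\<close> indices, and \<open>(m - 2) - 2 (s - 1) = m - 2 s\<close>.\<close>

lemma topv_flips:
  assumes m: "2 \<le> m" and P: "P \<in> Pspace m s k" and s: "1 \<le> s"
  shows "(\<Sum>j=2..<m. Lv m (\<lambda>i. of_real (un j i)) (topv m k P)) = csc (of_real (real m - 2 * real s)) (topv m k P)"
proof
  fix C
  let ?v = "topv m k P"
  note t = topv_facts[OF m P]
  have "(\<Sum>j=2..<m. Lv m (\<lambda>i. of_real (un j i)) ?v) C = (\<Sum>j=2..<m. if j \<in> C then - ?v C else ?v C)"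
    unfolding sum_fun_apply by (intro sum.cong) (simp_all add: Lv_un)
  also have "\<dots> = (of_nat (m - 2) - 2 * of_nat (card (C \<inter> {2..<m}))) * ?v C"
  proof -
    have "(\<Sum>j=2..<m. if j \<in> C then - ?v C else ?v C) = (\<Sum>j=2..<m. ?v C - 2 * (if j \<in> C then ?v C else 0))"
      by (intro sum.cong) auto
    also have "\<dots> = of_nat (m - 2) * ?v C - 2 * (\<Sum>j=2..<m. if j \<in> C then ?v C else 0)"
      by (simp add: sum_subtractf sum_distrib_left)
    also have "(\<Sum>j=2..<m. if j \<in> C then ?v C else 0) = of_nat (card (C \<inter> {2..<m})) * ?v C"
      by (simp add: sum.If_cases Int_commute)
    finally show ?thesis by (simp add: algebra_simps)
  qed
  also have "\<dots> = of_real (real m - 2 * real s) * ?v C"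
  proof (cases "?v C = 0")
    case False
    define B where "B = C \<inter> {2..<m}"
    have B: "B \<subseteq> {2..<m}" by (auto simp: B_def)
    have "C \<subseteq> {..<m}" using t(3) False by (auto simp: supp_in_def)
    from low_part_cases[OF this B_def] isotropic_kernel_coords(1,2)[OF m t(1,2) B] False
    have "C = insert 0 B \<or> C = insert 1 B" by metis
    moreover have "finite B" "0 \<notin> B" "1 \<notin> B" using B by (auto intro: finite_subset)
    ultimately have "card C = Suc (card B)" by auto
    then have "s = Suc (card B)" using t(4)[OF False] by simp
    then show ?thesis using m by (simp add: B_def[symmetric] of_nat_diff)
  qed simp
  finally show "(\<Sum>j=2..<m. Lv m (\<lambda>i. of_real (un j i)) ?v) C = csc (of_real (real m - 2 * real s)) ?v C"
    by (simp add: csc_def)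
qed

lemma flipsum_Pspace: "P \<in> Pspace m s k \<Longrightarrow> flipsum m k J P \<in> Pspace m s k"
  unfolding flipsum_def by (intro Pspace_sum refl_Pspace)

text \<open>The sign changes involved do not alter \<open>bil m av z\<close>, so they act through
  \<open>topv\<close> only, and the real eigenvalue passes to both real operators.\<close>

lemma flipsum_gact:
  assumes m: "2 \<le> m" and P: "P \<in> Pspace m s k" and s: "1 \<le> s"
    and eq: "\<And>z. pev m k (gact m k N w1 P) z + csc \<i> (pev m k (gact m k N w2 P) z)
      = csc (c * bil m av z ^ k) (topv m k P)"
    and w: "w \<in> {w1, w2}"
  shows "flipsum m k {2..<m} (gact m k N w P) = (real m - 2 * real s) *\<^sub>R gact m k N w P"
proof -
  let ?g1 = "gact m k N w1 P" and ?g2 = "gact m k N w2 P" and ?J = "{2..<m}"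
  have g: "?g1 \<in> Pspace m s k" "?g2 \<in> Pspace m s k" using P gact_Pspace by blast+
  have "pev m k (flipsum m k ?J ?g1) z + csc \<i> (pev m k (flipsum m k ?J ?g2) z)
     = pev m k ((real m - 2 * real s) *\<^sub>R ?g1) z + csc \<i> (pev m k ((real m - 2 * real s) *\<^sub>R ?g2) z)" for z
  proof -
    have "pev m k (flipsum m k ?J ?g1) z + csc \<i> (pev m k (flipsum m k ?J ?g2) z)
      = (\<Sum>j\<in>?J. pev m k (prefl m k (un j) ?g1) z + csc \<i> (pev m k (prefl m k (un j) ?g2) z))"
      by (simp add: flipsum_def pev_sum csc_sum sum.distrib)
    also have "\<dots> = (\<Sum>j\<in>?J. csc (c * bil m av z ^ k) (Lv m (\<lambda>i. of_real (un j i)) (topv m k P)))"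
    proof (rule sum.cong[OF refl])
      fix j assume "j \<in> ?J"
      let ?u = "\<lambda>i. complex_of_real (un j i)"
      have "bil m av ?u = 0" using \<open>j \<in> ?J\<close> by (intro bil_av_0[OF m]) (auto simp: un_def)
      then have "bil m av (rv m ?u z) = bil m av z" by (simp add: bil_lin_right)
      then have "csc (c * bil m av z ^ k) (topv m k P) = pev m k ?g1 (rv m ?u z) + csc \<i> (pev m k ?g2 (rv m ?u z))"
        by (simp add: eq)
      then show "pev m k (prefl m k (un j) ?g1) z + csc \<i> (pev m k (prefl m k (un j) ?g2) z)
         = csc (c * bil m av z ^ k) (Lv m ?u (topv m k P))"
        by (simp add: pev_refl[OF g(1)] pev_refl[OF g(2)] Lv_csc[symmetric] Lv_add[symmetric])
    qed
    also have "\<dots> = csc (c * bil m av z ^ k) (csc (of_real (real m - 2 * real s)) (topv m k P))"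
      unfolding csc_sum[symmetric] topv_flips[OF m P s] ..
    also have "\<dots> = csc (of_real (real m - 2 * real s)) (csc (c * bil m av z ^ k) (topv m k P))"
      by (simp only: csc_csc mult.commute)
    also have "\<dots> = pev m k ((real m - 2 * real s) *\<^sub>R ?g1) z + csc \<i> (pev m k ((real m - 2 * real s) *\<^sub>R ?g2) z)"
      unfolding eq[symmetric] by (simp only: pev_scale csc_add csc_csc mult.commute)
    finally show ?thesis .
  qed
  from pev_complex_inject[OF flipsum_Pspace[OF g(1)] flipsum_Pspace[OF g(2)] Pspace_scale[OF g(1)] Pspace_scale[OF g(2)] this]
  show ?thesis using w by auto
qed

lemma intertwines_flipsum:
  assumes tw: "intertwines m s' k' s k \<phi>" and "J \<subseteq> {..<m}" "h \<in> HH m s' k'"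
  shows "\<phi> (flipsum m k' J h) = flipsum m k J (\<phi> h)"
proof -
  have lin: "linear \<phi>" using tw by (simp add: intertwines_def)
  have "\<phi> (prefl m k' (un j) h) = prefl m k (un j) (\<phi> h)" if "j \<in> J" for j
  proof -
    have "uvec m (un j)" using assms(2) that by (intro uvec_un) auto
    then show ?thesis using tw assms(3) unfolding intertwines_def by blast
  qed
  then show ?thesis by (simp add: flipsum_def linear_sum[OF lin])
qed

text \<open>\<open>T\<close> is linear on \<open>V\<close> only, so the induction has to carry
  membership of the partial sums in \<open>V\<close>.\<close>

lemma equivariant_sum:
  assumes V: "subspace V" "refl_closed m k V"
    and T: "\<And>P Q. P \<in> V \<Longrightarrow> Q \<in> V \<Longrightarrow> T (P + Q) = T P + T Q" "\<And>c P. P \<in> V \<Longrightarrow> T (c *\<^sub>R P) = c *\<^sub>R T P"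
      "\<And>u P. uvec m u \<Longrightarrow> P \<in> V \<Longrightarrow> T (prefl m k u P) = prefl m k u (T P)"
    and P: "P \<in> V" and J: "finite J" "\<And>j. j \<in> J \<Longrightarrow> uvec m (u j)"
  shows "T (\<Sum>j\<in>J. c j *\<^sub>R prefl m k (u j) P) = (\<Sum>j\<in>J. c j *\<^sub>R prefl m k (u j) (T P))"
proof -
  have r: "prefl m k (u j) P \<in> V" if "j \<in> J" for j
    using V(2)[unfolded refl_closed_def, rule_format, OF conjI[OF J(2)[OF that] P]] .
  have "(\<Sum>j\<in>J. c j *\<^sub>R prefl m k (u j) P) \<in> V \<and>
    T (\<Sum>j\<in>J. c j *\<^sub>R prefl m k (u j) P) = (\<Sum>j\<in>J. c j *\<^sub>R prefl m k (u j) (T P))"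
    using J(1) J(2) r
  proof (induction J rule: finite_induct)
    case empty
    have "T 0 = 0" using T(2)[OF subspace_0[OF V(1)], of 0] by (simp only: scaleR_zero_left)
    then show ?case using subspace_0[OF V(1)] by simp
  next
    case (insert j J)
    let ?S = "\<Sum>j\<in>J. c j *\<^sub>R prefl m k (u j) P"
    have IH: "?S \<in> V" "T ?S = (\<Sum>j\<in>J. c j *\<^sub>R prefl m k (u j) (T P))"
      using insert.IH insert.prems by blast+
    have a: "c j *\<^sub>R prefl m k (u j) P \<in> V" by (rule subspace_scale[OF V(1) insert.prems(2)]) simp
    have "T (c j *\<^sub>R prefl m k (u j) P) = c j *\<^sub>R prefl m k (u j) (T P)"
      using T(2)[OF insert.prems(2), of j] T(3)[OF insert.prems(1) P, of j] by simp
    then show ?case using subspace_add[OF V(1) a IH(1)] T(1)[OF a IH(1)] IH(2) insert.hyps by simp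
  qed
  then show ?thesis by (rule conjunct2)
qed

text \<open>An equivalence commutes with every fixed combination of reflections, and so do
  \<open>\<phi>1\<close> and \<open>\<phi>2\<close>. It is enough to find a combination that behaves
  differently on the two sources.\<close>

lemma inequivalent:
  assumes tw1: "intertwines m s1 k1 s k \<phi>1" and tw2: "intertwines m s2 k2 s k \<phi>2"
    and ne: "\<phi>1 ` HH m s1 k1 \<noteq> {0}" "\<phi>2 ` HH m s2 k2 \<noteq> {0}" and diff: "(s1, k1) \<noteq> (s2, k2)"
  shows "\<not> H_equivalent m k (\<phi>1 ` HH m s1 k1) (\<phi>2 ` HH m s2 k2)"
proof
  let ?V = "\<phi>1 ` HH m s1 k1" and ?W = "\<phi>2 ` HH m s2 k2"
  assume "H_equivalent m k ?V ?W"
  from H_equivalentE[OF this intertwines_subspace[OF tw1] intertwines_Pspace[OF tw1] intertwines_Pspace[OF tw2]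
      intertwines_refl_closed[OF tw1] intertwines_refl_closed[OF tw2]]
  obtain T where T: "bij_betw T ?V ?W" "\<And>P Q. P \<in> ?V \<Longrightarrow> Q \<in> ?V \<Longrightarrow> T (P + Q) = T P + T Q"
    "\<And>c P. P \<in> ?V \<Longrightarrow> T (c *\<^sub>R P) = c *\<^sub>R T P" "\<And>u P. uvec m u \<Longrightarrow> P \<in> ?V \<Longrightarrow> T (prefl m k u P) = prefl m k u (T P)"
    by metis
  have lin: "linear \<phi>1" "linear \<phi>2" using tw1 tw2 by (simp_all add: intertwines_def)
  have nz: "HH m s1 k1 \<noteq> {0}" "HH m s2 k2 \<noteq> {0}"
  proof -
    have "\<phi>1 ` {0} = {0}" "\<phi>2 ` {0} = {0}" by (simp_all only: image_insert image_empty linear_0[OF lin(1)] linear_0[OF lin(2)])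
    then show "HH m s1 k1 \<noteq> {0}" "HH m s2 k2 \<noteq> {0}" using ne by metis+
  qed
  have sub: "subspace ?V" by (rule intertwines_subspace[OF tw1])
  have V0: "0 \<in> ?V" by (rule subspace_0[OF sub])
  have T0: "T 0 = 0" using T(3)[OF V0, of 0] by simp
  have TW: "T P \<in> ?W" if "P \<in> ?V" for P using T(1) that by (auto simp: bij_betw_def)
  have Tinj: "P = 0" if "P \<in> ?V" "T P = 0" for P
    using T(1) that V0 T0 by (metis bij_betw_def inj_onD)
  have Tsum: "T (\<Sum>j\<in>J. c j *\<^sub>R prefl m k (u j) P) = (\<Sum>j\<in>J. c j *\<^sub>R prefl m k (u j) (T P))"
    if "P \<in> ?V" "finite J" "\<And>j. j \<in> J \<Longrightarrow> uvec m (u j)" for J :: "nat set" and c u P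
    by (rule equivariant_sum[OF sub intertwines_refl_closed[OF tw1]], fact T(2), fact T(3), fact T(4),
      fact that(1), fact that(2), fact that(3))
  have Tflip: "T (flipsum m k J P) = flipsum m k J (T P)" if "P \<in> ?V" "J \<subseteq> {..<m}" for J P
  proof -
    have u: "uvec m (un j)" if "j \<in> J" for j using \<open>J \<subseteq> {..<m}\<close> that by (intro uvec_un) auto
    have "finite J" using that(2) finite_subset by blast
    have "T (\<Sum>j\<in>J. 1 *\<^sub>R prefl m k (un j) P) = (\<Sum>j\<in>J. 1 *\<^sub>R prefl m k (un j) (T P))"
      by (rule Tsum[OF that(1) \<open>finite J\<close> u])
    then show ?thesis unfolding flipsum_def by simp
  qed
  have Tgact: "T (gact m k N w P) = gact m k N w (T P)" if "P \<in> ?V" "2 \<le> m" for N w P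
    unfolding gact_def by (rule Tsum[OF that(1) finite_atMost uvec_ut[OF that(2)]])
  consider "k2 < k1" | "k1 < k2" | "k1 = k2" "k1 = 0" | "k1 = k2" "0 < k1" by linarith
  then show False
  proof cases
    case 1
    then have m: "2 \<le> m" using HH_nonzero_range[OF nz(1)] by simp
    obtain w1 w2 where w:
      "\<And>m s k h w. \<lbrakk>k < k1; h \<in> HH m s k; w \<in> {w1, w2}\<rbrakk> \<Longrightarrow> gact m k (2 * (k1 + 1)) w h = 0"
      "\<And>m s. \<lbrakk>HH m s k1 \<noteq> {0}; 0 < k1\<rbrakk> \<Longrightarrow> \<exists>w\<in>{w1, w2}. \<exists>h\<in>HH m s k1. gact m k1 (2 * (k1 + 1)) w h \<noteq> 0"
      using separating_gact[of k1] by metis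
    let ?N = "2 * (k1 + 1)"
    obtain w' h where h: "w' \<in> {w1, w2}" "h \<in> HH m s1 k1" "gact m k1 ?N w' h \<noteq> 0" using w(2)[OF nz(1)] 1 by force
    obtain h' where h': "h' \<in> HH m s2 k2" "T (\<phi>1 h) = \<phi>2 h'" using TW h(2) by blast
    have "T (\<phi>1 (gact m k1 ?N w' h)) = gact m k ?N w' (\<phi>2 h')"
      using Tgact[of "\<phi>1 h" ?N w'] h(2) h'(2) m intertwines_gact[OF tw1 m h(2)] by simp
    also have "\<dots> = \<phi>2 (gact m k2 ?N w' h')" using intertwines_gact[OF tw2 m h'(1)] by simp
    also have "\<dots> = 0" using w(1)[OF 1 h'(1) h(1)] by (simp add: linear_0[OF lin(2)])
    finally have z: "T (\<phi>1 (gact m k1 ?N w' h)) = 0" .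
    have mem: "gact m k1 ?N w' h \<in> HH m s1 k1" by (rule subspace_gact[OF subspace_HH refl_closed_HH m h(2)])
    then have "\<phi>1 (gact m k1 ?N w' h) = 0" using Tinj z by blast
    then show False using h(3) mem tw1 by (simp add: intertwines_def)
  next
    case 2
    then have m: "2 \<le> m" using HH_nonzero_range[OF nz(2)] by simp
    obtain w1 w2 where w:
      "\<And>m s k h w. \<lbrakk>k < k2; h \<in> HH m s k; w \<in> {w1, w2}\<rbrakk> \<Longrightarrow> gact m k (2 * (k2 + 1)) w h = 0"
      "\<And>m s. \<lbrakk>HH m s k2 \<noteq> {0}; 0 < k2\<rbrakk> \<Longrightarrow> \<exists>w\<in>{w1, w2}. \<exists>h\<in>HH m s k2. gact m k2 (2 * (k2 + 1)) w h \<noteq> 0"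
      using separating_gact[of k2] by metis
    let ?N = "2 * (k2 + 1)"
    obtain w' h' where h': "w' \<in> {w1, w2}" "h' \<in> HH m s2 k2" "gact m k2 ?N w' h' \<noteq> 0" using w(2)[OF nz(2)] 2 by force
    have "\<phi>2 h' \<in> T ` ?V" unfolding bij_betw_imp_surj_on[OF T(1)] using h'(2) by (rule imageI)
    then obtain h where h: "h \<in> HH m s1 k1" "T (\<phi>1 h) = \<phi>2 h'" by (elim imageE) simp
    have "\<phi>2 (gact m k2 ?N w' h') = gact m k ?N w' (T (\<phi>1 h))" using intertwines_gact[OF tw2 m h'(2)] h(2) by simp
    also have "\<dots> = T (\<phi>1 (gact m k1 ?N w' h))"
      using Tgact[of "\<phi>1 h" ?N w'] h(1) m intertwines_gact[OF tw1 m h(1)] by simp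
    also have "\<dots> = 0" using w(1)[OF 2 h(1) h'(1)] by (simp add: linear_0[OF lin(1)] T0)
    finally have z: "\<phi>2 (gact m k2 ?N w' h') = 0" .
    have mem: "gact m k2 ?N w' h' \<in> HH m s2 k2" by (rule subspace_gact[OF subspace_HH refl_closed_HH m h'(2)])
    then show False using h'(3) z tw2 by (simp add: intertwines_def)
  next
    \<comment> \<open>In degree \<open>0\<close> the grades \<open>0\<close> and \<open>m\<close>
      can occur and \<open>2 \<le> m\<close> may fail, so the sum over all sign changes is used
      without the isotropic vector.\<close>
    case 3
    then have ss: "s1 \<noteq> s2" using diff by simp
    obtain h where h: "h \<in> HH m s1 k1" "\<phi>1 h \<noteq> 0" using ne(1) V0 by auto
    obtain h' where h': "h' \<in> HH m s2 k2" "T (\<phi>1 h) = \<phi>2 h'" using TW h(1) by blast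
    have f: "flipsum m k1 {..<m} h = (real m - 2 * real s1) *\<^sub>R h" "flipsum m k2 {..<m} h' = (real m - 2 * real s2) *\<^sub>R h'"
      using flipsum_all h(1) h'(1) 3 by (auto simp: HH_def)
    have "T (flipsum m k {..<m} (\<phi>1 h)) = flipsum m k {..<m} (\<phi>2 h')"
      using Tflip[of "\<phi>1 h" "{..<m}"] h(1) h'(2) by simp
    then have "T (\<phi>1 (flipsum m k1 {..<m} h)) = \<phi>2 (flipsum m k2 {..<m} h')"
      using intertwines_flipsum[OF tw1 _ h(1), of "{..<m}"] intertwines_flipsum[OF tw2 _ h'(1), of "{..<m}"] by simp
    then have "(real m - 2 * real s1) *\<^sub>R T (\<phi>1 h) = (real m - 2 * real s2) *\<^sub>R T (\<phi>1 h)"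
      using T(3)[of "\<phi>1 h"] h(1) h'(2) by (simp add: f linear_cmul[OF lin(1)] linear_cmul[OF lin(2)])
    then have "T (\<phi>1 h) = 0" using ss by simp
    then show False using Tinj[of "\<phi>1 h"] h by blast
  next
    case 4
    then have ss: "s1 \<noteq> s2" using diff by simp
    have s1: "1 \<le> s1" "s1 < m" and s2: "1 \<le> s2" "s2 < m"
      using HH_nonzero_range[OF nz(1)] HH_nonzero_range[OF nz(2)] 4 by auto
    have m: "2 \<le> m" using s1 by simp
    have J: "{2..<m} \<subseteq> {..<m}" by auto
    let ?N = "2 * (k1 + 1)"
    obtain w1 w2 where
      sep: "\<And>m s. \<lbrakk>HH m s k1 \<noteq> {0}; 0 < k1\<rbrakk> \<Longrightarrow> \<exists>w\<in>{w1, w2}. \<exists>h\<in>HH m s k1. gact m k1 ?N w h \<noteq> 0" and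
      eq: "\<And>m s P z. P \<in> Pspace m s k1 \<Longrightarrow> pev m k1 (gact m k1 ?N w1 P) z + csc \<i> (pev m k1 (gact m k1 ?N w2 P) z)
        = csc ((-2) ^ (k1 + 1) * bil m av z ^ k1) (topv m k1 P)"
      using separating_gact[of k1] by metis
    obtain w h where h: "w \<in> {w1, w2}" "h \<in> HH m s1 k1" "gact m k1 ?N w h \<noteq> 0" using sep[OF nz(1)] 4 by force
    obtain h' where h': "h' \<in> HH m s2 k2" "T (\<phi>1 h) = \<phi>2 h'" using TW h(2) by blast
    let ?g = "gact m k1 ?N w h" and ?g' = "gact m k2 ?N w h'"
    have P: "h \<in> Pspace m s1 k1" "h' \<in> Pspace m s2 k1" using h(2) h'(1) 4 by (auto simp: HH_def)
    have f: "flipsum m k1 {2..<m} ?g = (real m - 2 * real s1) *\<^sub>R ?g"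
      by (rule flipsum_gact[OF m P(1) s1(1) eq[OF P(1)] h(1)])
    have f': "flipsum m k2 {2..<m} ?g' = (real m - 2 * real s2) *\<^sub>R ?g'"
      unfolding 4(1)[symmetric] by (rule flipsum_gact[OF m P(2) s2(1) eq[OF P(2)] h(1)])
    have mem: "?g \<in> HH m s1 k1" by (rule subspace_gact[OF subspace_HH refl_closed_HH m h(2)])
    have mem': "?g' \<in> HH m s2 k2" by (rule subspace_gact[OF subspace_HH refl_closed_HH m h'(1)])
    have Tg: "T (\<phi>1 ?g) = \<phi>2 ?g'"
      using Tgact[of "\<phi>1 h" ?N w] h(2) h'(2) m intertwines_gact[OF tw1 m h(2)] intertwines_gact[OF tw2 m h'(1)] by simp
    have "T (flipsum m k {2..<m} (\<phi>1 ?g)) = flipsum m k {2..<m} (\<phi>2 ?g')"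
      using Tflip[of "\<phi>1 ?g" "{2..<m}"] mem J Tg by simp
    then have "T (\<phi>1 (flipsum m k1 {2..<m} ?g)) = \<phi>2 (flipsum m k2 {2..<m} ?g')"
      using intertwines_flipsum[OF tw1 J mem] intertwines_flipsum[OF tw2 J mem'] by simp
    then have "(real m - 2 * real s1) *\<^sub>R T (\<phi>1 ?g) = (real m - 2 * real s2) *\<^sub>R T (\<phi>1 ?g)"
      using T(3)[of "\<phi>1 ?g"] mem Tg unfolding f f' by (simp add: linear_cmul[OF lin(1)] linear_cmul[OF lin(2)])
    then have "T (\<phi>1 ?g) = 0" using ss by simp
    then have "\<phi>1 ?g = 0" using Tinj mem by blast
    then show False using h(3) mem tw1 by (simp add: intertwines_def)
  qed
qed

section \<open>The four summands\<close>

lemma intertwines_id: "s \<le> m \<Longrightarrow> intertwines m s k s k (\<lambda>h. h)"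
  by (auto simp: intertwines_def HH_def intro: linearI)

lemma intertwines_oX:
  assumes "s \<le> m" "1 \<le> s" "1 \<le> k" shows "intertwines m (s - 1) (k - 1) s k (oX m)"
  unfolding intertwines_def
proof (intro conjI ballI allI impI)
  fix h assume h: "h \<in> HH m (s - 1) (k - 1)"
  show "oX m h \<in> Pspace m s k" using HH_oX_Pspace[OF h] assms by simp
  have "real (k - 1) + real m - real (s - 1) \<noteq> 0" using assms by (simp add: of_nat_diff)
  then show "h = 0" if "oX m h = 0" using HH_CX[OF h] that by (simp add: ops_linear)
  show "oX m (prefl m (k - 1) u h) = prefl m k u (oX m h)" if "uvec m u" for u
    using refl_oX[OF _ HH_Pspace[OF h], of u] that assms by (simp add: uvec_def)
qed (use assms in auto)

lemma intertwines_oJ: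
  assumes "s < m" "1 \<le> k" shows "intertwines m (s + 1) (k - 1) s k (oJ m)"
  unfolding intertwines_def
proof (intro conjI ballI allI impI)
  fix h assume h: "h \<in> HH m (s + 1) (k - 1)"
  show "oJ m h \<in> Pspace m s k" using HH_oJ_Pspace[OF h] assms by simp
  have "real (k - 1) + real (s + 1) \<noteq> 0" by linarith
  then show "h = 0" if "oJ m h = 0" using HH_DJ[OF h] that by (simp add: ops_linear)
  show "oJ m (prefl m (k - 1) u h) = prefl m k u (oJ m h)" if "uvec m u" for u
    using refl_oJ[OF _ HH_Pspace[OF h], of u] that assms by (simp add: uvec_def)
qed (use assms in auto)

lemma intertwines_wop3:
  assumes "1 \<le> s" "s < m" "2 \<le> k" shows "intertwines m s (k - 2) s k (wop3 m s k)"
  unfolding intertwines_def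
proof (intro conjI ballI allI impI)
  fix h assume h: "h \<in> HH m s (k - 2)"
  then have S: "h \<in> S3 m s k" using assms by (simp add: S3_def)
  from S3_facts[OF S] obtain c where c: "c \<noteq> 0" "oD m (oC m (wop3 m s k h)) = c *\<^sub>R h" "wop3 m s k h \<in> Pspace m s k"
    by metis
  show "wop3 m s k h \<in> Pspace m s k" by (rule c)
  show "h = 0" if "wop3 m s k h = 0" using c(1,2) that by (simp add: ops_linear)
  show "wop3 m s k (prefl m (k - 2) u h) = prefl m k u (wop3 m s k h)" if "uvec m u" for u
  proof -
    have u: "bil m u u = 1" using that by (simp add: uvec_def)
    have P: "h \<in> Pspace m s (k - 2)" using h by (simp add: HH_def)
    have k: "Suc (Suc (k - 2)) = k" using assms by linarith
    have "prefl m k u (oX m (oJ m h)) = oX m (oJ m (prefl m (k - 2) u h))"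
      using refl_oX[OF u oJ_Pspace[OF P]] refl_oJ[OF u P] unfolding k by simp
    moreover have "prefl m k u (oJ m (oX m h)) = oJ m (oX m (prefl m (k - 2) u h))"
      using refl_oJ[OF u oX_Pspace[OF P]] refl_oX[OF u P] unfolding k by simp
    ultimately show ?thesis
      by (simp add: wop3_def wop_def linear_add[OF linear_refl] linear_cmul[OF linear_refl])
  qed
qed (use assms linear_wop in \<open>auto simp: wop3_def\<close>)

text \<open>The labels are integers because truncated subtraction could identify two of them; as
  integer pairs they are distinct, which feeds the hypothesis \<open>diff\<close> of
  \<open>inequivalent\<close>.\<close>

lemma summand_presentation:
  fixes m s k i :: nat
  assumes "s \<le> m" "i < 4"
  defines "V \<equiv> [HH m s k, oX m ` S1 m s k, oJ m ` S2 m s k, wop3 m s k ` S3 m s k]"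
  assumes ne: "V ! i \<noteq> {0}"
  shows "\<exists>s' k' \<phi>. V ! i = \<phi> ` HH m s' k' \<and> intertwines m s' k' s k \<phi> \<and>
    (int s', int k') = [(int s, int k), (int s - 1, int k - 1), (int s + 1, int k - 1), (int s, int k - 2)] ! i"
proof -
  have w0: "wop3 m s k 0 = 0" by (simp add: wop3_def linear_0[OF linear_wop])
  consider "i = 0" | "i = 1" | "i = 2" | "i = 3" using assms(2) by linarith
  then show ?thesis
  proof cases
    case 1
    then show ?thesis using intertwines_id[OF assms(1), of k]
      by (intro exI[of _ s] exI[of _ k] exI[of _ "\<lambda>h. h"]) (simp add: V_def)
  next
    case 2
    then have *: "1 \<le> s \<and> 1 \<le> k" using ne by (auto simp: V_def S1_def ops_linear split: if_splits)
    then show ?thesis using 2 intertwines_oX[OF assms(1)]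
      by (intro exI[of _ "s - 1"] exI[of _ "k - 1"] exI[of _ "oX m"]) (simp add: V_def S1_def of_nat_diff)
  next
    case 3
    then have *: "s < m \<and> 1 \<le> k" using ne by (auto simp: V_def S2_def ops_linear split: if_splits)
    then show ?thesis using 3 intertwines_oJ[of s m k]
      by (intro exI[of _ "s + 1"] exI[of _ "k - 1"] exI[of _ "oJ m"]) (simp add: V_def S2_def of_nat_diff)
  next
    case 4
    then have *: "1 \<le> s \<and> s < m \<and> 2 \<le> k" using ne w0 by (auto simp: V_def S3_def split: if_splits)
    then show ?thesis using 4 intertwines_wop3[of s m k]
      by (intro exI[of _ s] exI[of _ "k - 2"] exI[of _ "wop3 m s k"]) (simp add: V_def S3_def of_nat_diff)
  qed
qed

theorem theorem4:
  fixes m s k :: nat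
  assumes "1 \<le> m" and "s \<le> m"
  defines "V \<equiv> [Hsp m (int s) (int k),
                 xwedge m ` Hsp m (int s - 1) (int k - 1),
                 xdot m ` Hsp m (int s + 1) (int k - 1),
                 Wt m s k]"
  shows "is_direct_sum (KerTLap m s k) V
         \<and> (\<forall>i<length V. V ! i \<noteq> {pzero} \<longrightarrow> H_irreducible m k (V ! i))
         \<and> (\<forall>i<length V. \<forall>j<length V. i \<noteq> j \<and> V ! i \<noteq> {pzero} \<and> V ! j \<noteq> {pzero}
               \<longrightarrow> \<not> H_equivalent m k (V ! i) (V ! j))
         \<and> is_direct_sum (KerLap m s k \<inter> KerTLap m s k) (take 3 V)"
proof (intro conjI allI impI)
  let ?U = "[HH m s k, oX m ` S1 m s k, oJ m ` S2 m s k, wop3 m s k ` S3 m s k]"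
  let ?lab = "[(int s, int k), (int s - 1, int k - 1), (int s + 1, int k - 1), (int s, int k - 2)]"
  note s = assms(2)
  have V: "V = ?U"
    unfolding V_def Hsp_eq[OF s] summand1[OF s] summand2[OF s] summand3[OF s] ..
  have len: "length V = 4" by (simp add: V)
  note presentation = summand_presentation[OF s, where k = k, folded V]
  show "is_direct_sum (KerTLap m s k) V"
    unfolding V by (rule direct_sum_KerTLap[OF s])
  show "is_direct_sum (KerLap m s k \<inter> KerTLap m s k) (take 3 V)"
    unfolding V using direct_sum_KerLap[OF s] by (simp add: numeral_3_eq_3)
  {
    fix i assume i: "i < length V" "V ! i \<noteq> {pzero}"
    with presentation[of i] show "H_irreducible m k (V ! i)"
      unfolding len pzero_eq by (metis H_irreducible_image)
  }
  fix i j
  assume ij: "i < length V" "j < length V" "i \<noteq> j \<and> V ! i \<noteq> {pzero} \<and> V ! j \<noteq> {pzero}"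
  have i: "i < 4" "V ! i \<noteq> {0}" and j: "j < 4" "V ! j \<noteq> {0}"
    using ij by (simp_all add: len pzero_eq)
  obtain s1 k1 \<phi>1 where 1: "V ! i = \<phi>1 ` HH m s1 k1" "intertwines m s1 k1 s k \<phi>1" "(int s1, int k1) = ?lab ! i"
    using presentation[OF i] by blast
  obtain s2 k2 \<phi>2 where 2: "V ! j = \<phi>2 ` HH m s2 k2" "intertwines m s2 k2 s k \<phi>2" "(int s2, int k2) = ?lab ! j"
    using presentation[OF j] by blast
  have "distinct ?lab" by simp
  then have "?lab ! i \<noteq> ?lab ! j" using i(1) j(1) ij(3) by (subst nth_eq_iff_index_eq) simp_all
  then have "(s1, k1) \<noteq> (s2, k2)" using 1(3) 2(3) by auto
  then show "\<not> H_equivalent m k (V ! i) (V ! j)"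
    using inequivalent[OF 1(2) 2(2)] i(2) j(2) unfolding 1(1) 2(1) by blast
qed

end
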